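(* Let $X$ be a real Banach space and let $M$ be a (closed) subspace of $X$ such that $\mathfrak{F}(M)$ is an ideal of $\mathfrak{F}(X)$. If $M$ has the Lip-$\mathcal{K}$-BAP, $\mathfrak{F}(X)/\mathfrak{F}(M)$ has the $\mathcal{K}$-BAP and $X^*$ has the B$\mathrm{W}^*$D, then $X$ has the Lip-$\mathcal{K}$-BAP.
   Context: All Banach spaces are real. For Banach spaces $X,Y$, $\mathcal{L}(X,Y)$ is the space of bounded linear operators, $\mathcal{K}(X,Y)$ the compact operators, and $\mathrm{Lip}_0(X,Y)$ is the Banach space of Lipschitz maps $f:X\to Y$ with $f(0)=0$, with norm $\|f\|_{\mathrm{Lip}}=\sup_{x\neq y}\|f(x)-f(y)\|/\|x-y\|$; $\mathrm{Lip}_0(X)=\mathrm{Lip}_0(X,\mathbb{R})$. For $x\in X$ let $\delta_x\in \mathrm{Lip}_0(X)^*$, $\delta_x(f)=f(x)$. The Lipschitz-free space is $\mathfrak{F}(X)=\overline{\mathrm{span}}\{\delta_x: x\in X\}\subseteq \mathrm{Lip}_0(X)^*$, and $\delta_X:X\to\mathfrak{F}(X)$, $\delta_X(x)=\delta_x$. For a subspace $M\subseteq X$, $\mathfrak{F}(M)$ is identified isometrically with the subspace $\overline{\mathrm{span}}\{\delta_x:x\in M\}$ of $\mathfrak{F}(X)$. For each $f\in\mathrm{Lip}_0(X,Y)$ there is a unique $L_f\in\mathcal{L}(\mathfrak{F}(X),Y)$ with $L_f\delta_X=f$, and $\|L_f\|=\|f\|_{\mathrm{Lip}}$. For $\lambda\ge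 1$: $\mathcal{K}^\lambda(X,Y)=\{T\in\mathcal{K}(X,Y):\|T\|\le\lambda\}$; $\mathrm{Lip}_{\mathcal{K}}(X,Y)=\{f\in\mathrm{Lip}_0(X,Y): L_f\in\mathcal{K}(\mathfrak{F}(X),Y)\}$; $\mathrm{Lip}_{\mathcal{K}}^\lambda(X,Y)=\{f\in\mathrm{Lip}_{\mathcal{K}}(X,Y):\|f\|_{\mathrm{Lip}}\le\lambda\}$. $\tau_c$ denotes the compact-open topology (uniform convergence on compact subsets of the domain). A Banach space $Z$ has the $\mathcal{K}$-BAP if $\mathrm{Id}_Z\in\overline{\mathcal{K}^\lambda(Z,Z)}^{\tau_c}$ for some $\lambda\ge1$, and the Lip-$\mathcal{K}$-BAP if $\mathrm{Id}_Z\in\overline{\mathrm{Lip}_{\mathcal{K}}^\lambda(Z,Z)}^{\tau_c}$ for some $\lambda\ge1$. A subspace $N$ of a Banach space $Z$ is an ideal in $Z$ (or locally complemented in $Z$) if $N^\perp$ is the kernel of a norm-one projection on $Z^*$; equivalently, there is a bounded linear $\sigma:N^*\to Z^*$ with $\sigma(y^* )(y)=y^*(y)$ and $\|\sigma(y^* )\|=\|y^*\|$ for all $y^*\in N^*$, $y\in N$. The dual space $Z^*$ has the bounded weak-star density for compact operators (B$\mathrm{W}^*$D) if $\mathcal{K}^1(Z^*,Z^* )\subseteq\overline{\mathcal{K}_{w^*}^\lambda(Z^*,Z^* )}^{w^*}$ for some $\lambda\ge1$, where $\mathcal{K}_{w^*}^\lambda(Z^*,Z^* )$ is the set of compact operators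 on $Z^*$ that are weak-star to weak-star continuous and have norm at most $\lambda$, and the closure is in the weak-star topology of $\mathcal{L}(Z^*,Z^* )=(Z^*\widehat{\otimes}_\pi Z)^*$ (projective tensor product, $\langle z^*\otimes z,T\rangle=(Tz^* )(z)$). *)

theory Defs
  imports "HOL-Analysis.Analysis"
begin

section \<open>Lipschitz maps vanishing at the origin\<close>

typedef (overloaded) ('a::real_normed_vector, 'b::real_normed_vector) lip0 =
  "{f :: 'a \<Rightarrow> 'b. f 0 = 0 \<and> (\<exists>C. C-lipschitz_on UNIV f)}"
  morphisms lip_apply Abs_lip0
  by (rule exI[of _ "\<lambda>_. 0"]) (auto intro!: exI[of _ 0] lipschitz_onI)

setup_lifting type_definition_lip0

text \<open>The supremum is taken over all pairs: the pairs with \<open>x = y\<close> contribute \<open>0 / 0 = 0\<close>, which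
  does not change the value and keeps the index set nonempty when the domain is the zero space.\<close>

definition lip_norm :: "('a::real_normed_vector \<Rightarrow> 'b::real_normed_vector) \<Rightarrow> real" where
  "lip_norm f = (SUP (x, y). norm (f x - f y) / norm (x - y))"

lemma lip_norm_bdd:
  assumes "C-lipschitz_on UNIV f"
  shows "bdd_above (range (\<lambda>(x, y). norm (f x - f y) / norm (x - y)))"
proof (rule bdd_aboveI2)
  fix p :: "'a \<times> 'a"
  obtain x y where p: "p = (x, y)" by fastforce
  have "norm (f x - f y) \<le> C * norm (x - y)" "C \<ge> 0"
    using assms lipschitz_onD[OF assms, of x y] lipschitz_on_nonneg by (auto simp: dist_norm)
  then show "(case p of (x, y) \<Rightarrow> norm (f x - f y) / norm (x - y)) \<le> C"
    by (cases "x = y") (auto simp: p divide_le_eq)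
qed

lemma lip_norm_bound:
  assumes "C-lipschitz_on UNIV f"
  shows "norm (f x - f y) \<le> lip_norm f * norm (x - y)"
proof (cases "x = y")
  case False
  have "norm (f x - f y) / norm (x - y) \<le> lip_norm f"
    unfolding lip_norm_def using cSUP_upper[OF _ lip_norm_bdd[OF assms], of "(x, y)"] by simp
  then show ?thesis using False by (simp add: divide_le_eq)
qed simp

lemma lip_norm_nonneg:
  assumes "C-lipschitz_on UNIV f"
  shows "0 \<le> lip_norm f"
  unfolding lip_norm_def using cSUP_upper[OF _ lip_norm_bdd[OF assms], of "(0, 0)"] by simp

lemma lip_norm_least:
  assumes "\<And>x y. norm (f x - f y) \<le> C * norm (x - y)" "0 \<le> C"
  shows "lip_norm f \<le> C"
  unfolding lip_norm_def
proof (rule cSUP_least)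
  fix p :: "'a \<times> 'a"
  obtain x y where p: "p = (x, y)" by fastforce
  show "(case p of (x, y) \<Rightarrow> norm (f x - f y) / norm (x - y)) \<le> C"
    using assms(1)[of x y] assms(2) by (cases "x = y") (auto simp: p divide_le_eq)
qed simp

lemma lip_norm_scaleR:
  assumes "C-lipschitz_on UNIV f"
  shows "lip_norm (\<lambda>x. a *\<^sub>R f x) = \<bar>a\<bar> * lip_norm f"
proof -
  have le: "lip_norm (\<lambda>x. a *\<^sub>R f x) \<le> \<bar>a\<bar> * lip_norm f"
    if "C-lipschitz_on UNIV f" for a C and f :: "'a \<Rightarrow> 'b"
  proof (rule lip_norm_least)
    show "norm (a *\<^sub>R f x - a *\<^sub>R f y) \<le> \<bar>a\<bar> * lip_norm f * norm (x - y)" for x y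
      using mult_left_mono[OF lip_norm_bound[OF that, of x y], of "\<bar>a\<bar>"]
      by (simp flip: scaleR_diff_right add: mult.assoc)
  qed (simp add: lip_norm_nonneg[OF that])
  show ?thesis
  proof (cases "a = 0")
    case True
    have "0-lipschitz_on UNIV (\<lambda>x::'a. 0 :: 'b)" by (rule lipschitz_onI) auto
    with True le[OF assms, of 0] lip_norm_nonneg show ?thesis by (fastforce intro: antisym)
  next
    case False
    have "(\<bar>a\<bar> * C)-lipschitz_on UNIV (\<lambda>x. a *\<^sub>R f x)"
      using assms by (rule lipschitz_on_cmult)
    from le[OF this, of "inverse a"] False
    have "lip_norm f \<le> inverse \<bar>a\<bar> * lip_norm (\<lambda>x. a *\<^sub>R f x)" by simp
    then show ?thesis using le[OF assms, of a] False by (simp add: field_simps)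
  qed
qed

instantiation lip0 :: (real_normed_vector, real_normed_vector) real_normed_vector
begin

lift_definition zero_lip0 :: "('a, 'b) lip0" is "\<lambda>_. 0"
  by (auto intro!: exI[of _ 0] lipschitz_onI)

lift_definition plus_lip0 :: "('a, 'b) lip0 \<Rightarrow> ('a, 'b) lip0 \<Rightarrow> ('a, 'b) lip0"
  is "\<lambda>f g x. f x + g x"
  by (auto intro: lipschitz_on_add)

lift_definition minus_lip0 :: "('a, 'b) lip0 \<Rightarrow> ('a, 'b) lip0 \<Rightarrow> ('a, 'b) lip0"
  is "\<lambda>f g x. f x - g x"
  by (auto intro: lipschitz_on_diff)

lift_definition uminus_lip0 :: "('a, 'b) lip0 \<Rightarrow> ('a, 'b) lip0"
  is "\<lambda>f x. - f x"
  by auto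

lift_definition scaleR_lip0 :: "real \<Rightarrow> ('a, 'b) lip0 \<Rightarrow> ('a, 'b) lip0"
  is "\<lambda>a f x. a *\<^sub>R f x"
  by (auto intro: lipschitz_on_cmult)

lift_definition norm_lip0 :: "('a, 'b) lip0 \<Rightarrow> real" is lip_norm .

definition dist_lip0 :: "('a, 'b) lip0 \<Rightarrow> ('a, 'b) lip0 \<Rightarrow> real"
  where "dist_lip0 f g = norm (f - g)"

definition sgn_lip0 :: "('a, 'b) lip0 \<Rightarrow> ('a, 'b) lip0"
  where "sgn_lip0 f = scaleR (inverse (norm f)) f"

definition [code del]:
  "(uniformity :: (('a, 'b) lip0 \<times> ('a, 'b) lip0) filter) =
    (INF e\<in>{0 <..}. principal {(f, g). dist f g < e})"

definition open_lip0 :: "('a, 'b) lip0 set \<Rightarrow> bool"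
  where [code del]: "open_lip0 S = (\<forall>f\<in>S. \<forall>\<^sub>F (f', g) in uniformity. f' = f \<longrightarrow> g \<in> S)"

instance
proof
  fix f g h :: "('a, 'b) lip0" and a b :: real
  show "f + g + h = f + (g + h)" "f + g = g + f" "0 + f = f" "- f + f = 0" "f - g = f + - g"
    "a *\<^sub>R (f + g) = a *\<^sub>R f + a *\<^sub>R g" "(a + b) *\<^sub>R f = a *\<^sub>R f + b *\<^sub>R f"
    "a *\<^sub>R b *\<^sub>R f = (a * b) *\<^sub>R f" "1 *\<^sub>R f = f"
    by (transfer, simp add: algebra_simps)+
  show "dist f g = norm (f - g)" by (rule dist_lip0_def)
  show "sgn f = scaleR (inverse (norm f)) f" by (rule sgn_lip0_def)
  show "(uniformity :: (('a, 'b) lip0 \<times> ('a, 'b) lip0) filter) =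
    (INF e\<in>{0 <..}. principal {(f, g). dist f g < e})" by (rule uniformity_lip0_def)
  show "open U = (\<forall>f\<in>U. \<forall>\<^sub>F (f', g) in uniformity. f' = f \<longrightarrow> g \<in> U)" for U :: "('a, 'b) lip0 set"
    by (rule open_lip0_def)
  show "norm (a *\<^sub>R f) = \<bar>a\<bar> * norm f"
    by transfer (auto intro: lip_norm_scaleR)
  show "norm (f + g) \<le> norm f + norm g"
  proof transfer
    fix f g :: "'a \<Rightarrow> 'b"
    assume "f 0 = 0 \<and> (\<exists>C. C-lipschitz_on UNIV f)" "g 0 = 0 \<and> (\<exists>C. C-lipschitz_on UNIV g)"
    then obtain C D where C: "C-lipschitz_on UNIV f" and D: "D-lipschitz_on UNIV g" by blast
    show "lip_norm (\<lambda>x. f x + g x) \<le> lip_norm f + lip_norm g"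
    proof (rule lip_norm_least)
      fix x y
      have "norm (f x + g x - (f y + g y)) \<le> norm (f x - f y) + norm (g x - g y)"
        by (metis add_diff_add norm_triangle_ineq)
      then show "norm (f x + g x - (f y + g y)) \<le> (lip_norm f + lip_norm g) * norm (x - y)"
        using lip_norm_bound[OF C, of x y] lip_norm_bound[OF D, of x y] by (simp add: distrib_right)
    qed (simp add: lip_norm_nonneg[OF C] lip_norm_nonneg[OF D])
  qed
  show "norm f = 0 \<longleftrightarrow> f = 0"
  proof transfer
    fix f :: "'a \<Rightarrow> 'b"
    assume "f 0 = 0 \<and> (\<exists>C. C-lipschitz_on UNIV f)"
    then obtain C where f0: "f 0 = 0" and C: "C-lipschitz_on UNIV f" by blast
    show "lip_norm f = 0 \<longleftrightarrow> f = (\<lambda>_. 0)"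
    proof
      assume "lip_norm f = 0"
      then show "f = (\<lambda>_. 0)" using lip_norm_bound[OF C, of _ 0] f0 by auto
    next
      assume "f = (\<lambda>_. 0)"
      then show "lip_norm f = 0"
        using lip_norm_least[of f 0] lip_norm_nonneg[OF C] by auto
    qed
  qed
qed

end

lemma lip0_norm_bound: "norm (lip_apply f x - lip_apply f y) \<le> norm f * norm (x - y)"
  by transfer (auto intro: lip_norm_bound)

lemma lip0_zero: "lip_apply f 0 = 0"
  by transfer simp


section \<open>Lipschitz-free spaces\<close>

lift_definition lip_eval :: "'a::real_normed_vector \<Rightarrow> (('a, real) lip0 \<Rightarrow>\<^sub>L real)"
  is "\<lambda>x f. lip_apply f x"
proof (rule bounded_linear_intro)
  fix x :: 'a and f g :: "('a, real) lip0" and r :: real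
  show "lip_apply (f + g) x = lip_apply f x + lip_apply g x" by transfer simp
  show "lip_apply (r *\<^sub>R f) x = r *\<^sub>R lip_apply f x" by transfer simp
  show "norm (lip_apply f x) \<le> norm f * norm x"
    using lip0_norm_bound[of f x 0] by (simp add: lip0_zero)
qed

typedef (overloaded) ('a::real_normed_vector) lipfree =
  "closure (span (range lip_eval)) :: (('a, real) lip0 \<Rightarrow>\<^sub>L real) set"
  morphisms free_functional Abs_lipfree
  by (rule exI[of _ 0]) (rule subsetD[OF closure_subset span_zero])

setup_lifting type_definition_lipfree

lemma subspace_free:
  "subspace (closure (span (range lip_eval)) :: (('a::real_normed_vector, real) lip0 \<Rightarrow>\<^sub>L real) set)"
proof (rule subspaceI)
  let ?S = "span (range lip_eval) :: (('a, real) lip0 \<Rightarrow>\<^sub>L real) set"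
  show "0 \<in> closure ?S" by (rule subsetD[OF closure_subset span_zero])
  fix u assume u: "u \<in> closure ?S"
  then obtain s where s: "\<And>n. s n \<in> ?S" "s \<longlonglongrightarrow> u" unfolding closure_sequential by blast
  show "u + v \<in> closure ?S" if v: "v \<in> closure ?S" for v
  proof -
    obtain t where t: "\<And>n. t n \<in> ?S" "t \<longlonglongrightarrow> v" using v unfolding closure_sequential by blast
    show ?thesis
      unfolding closure_sequential
      by (rule exI[of _ "\<lambda>n. s n + t n"]) (simp add: s t span_add tendsto_add)
  qed
  show "a *\<^sub>R u \<in> closure ?S" for a
    unfolding closure_sequential
    by (rule exI[of _ "\<lambda>n. a *\<^sub>R s n"]) (simp add: s span_scale tendsto_scaleR)
qed

instantiation lipfree :: (real_normed_vector) real_normed_vector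
begin

lift_definition zero_lipfree :: "'a lipfree" is 0
  by (rule subspace_0[OF subspace_free])

lift_definition plus_lipfree :: "'a lipfree \<Rightarrow> 'a lipfree \<Rightarrow> 'a lipfree" is "(+)"
  by (rule subspace_add[OF subspace_free])

lift_definition minus_lipfree :: "'a lipfree \<Rightarrow> 'a lipfree \<Rightarrow> 'a lipfree" is "(-)"
  by (rule subspace_diff[OF subspace_free])

lift_definition uminus_lipfree :: "'a lipfree \<Rightarrow> 'a lipfree" is uminus
  by (rule subspace_neg[OF subspace_free])

lift_definition scaleR_lipfree :: "real \<Rightarrow> 'a lipfree \<Rightarrow> 'a lipfree" is "(*\<^sub>R)"
  by (rule subspace_scale[OF subspace_free])

lift_definition norm_lipfree :: "'a lipfree \<Rightarrow> real" is norm .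

definition dist_lipfree :: "'a lipfree \<Rightarrow> 'a lipfree \<Rightarrow> real"
  where "dist_lipfree u v = norm (u - v)"

definition sgn_lipfree :: "'a lipfree \<Rightarrow> 'a lipfree"
  where "sgn_lipfree u = scaleR (inverse (norm u)) u"

definition [code del]:
  "(uniformity :: ('a lipfree \<times> 'a lipfree) filter) =
    (INF e\<in>{0 <..}. principal {(u, v). dist u v < e})"

definition open_lipfree :: "'a lipfree set \<Rightarrow> bool"
  where [code del]: "open_lipfree S = (\<forall>u\<in>S. \<forall>\<^sub>F (u', v) in uniformity. u' = u \<longrightarrow> v \<in> S)"

instance
proof
  fix u v w :: "'a lipfree" and a b :: real
  show "u + v + w = u + (v + w)" "u + v = v + u" "0 + u = u" "- u + u = 0" "u - v = u + - v"
    "a *\<^sub>R (u + v) = a *\<^sub>R u + a *\<^sub>R v" "(a + b) *\<^sub>R u = a *\<^sub>R u + b *\<^sub>R u"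
    "a *\<^sub>R b *\<^sub>R u = (a * b) *\<^sub>R u" "1 *\<^sub>R u = u"
    by (transfer, simp add: algebra_simps)+
  show "dist u v = norm (u - v)" by (rule dist_lipfree_def)
  show "sgn u = scaleR (inverse (norm u)) u" by (rule sgn_lipfree_def)
  show "(uniformity :: ('a lipfree \<times> 'a lipfree) filter) =
    (INF e\<in>{0 <..}. principal {(u, v). dist u v < e})" by (rule uniformity_lipfree_def)
  show "open U = (\<forall>u\<in>U. \<forall>\<^sub>F (u', v) in uniformity. u' = u \<longrightarrow> v \<in> U)" for U :: "'a lipfree set"
    by (rule open_lipfree_def)
  show "norm (a *\<^sub>R u) = \<bar>a\<bar> * norm u" by transfer simp
  show "norm (u + v) \<le> norm u + norm v" by transfer (rule norm_triangle_ineq)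
  show "norm u = 0 \<longleftrightarrow> u = 0" by transfer simp
qed

end

lemma dist_free_functional: "dist (free_functional u) (free_functional v) = dist u v"
  unfolding dist_norm by transfer simp

instance lipfree :: (real_normed_vector) banach
proof
  fix X :: "nat \<Rightarrow> 'a lipfree"
  assume "Cauchy X"
  then have "Cauchy (\<lambda>n. free_functional (X n))"
    by (simp add: Cauchy_def dist_free_functional)
  then obtain l where l: "(\<lambda>n. free_functional (X n)) \<longlonglongrightarrow> l"
    using Cauchy_convergent_iff convergent_def by blast
  have "l \<in> closure (span (range lip_eval))"
    by (rule closed_sequentially[OF closed_closure _ l]) (simp add: free_functional)
  then obtain u where "l = free_functional u" by (metis Abs_lipfree_inverse)
  then have "X \<longlonglongrightarrow> u"
    using l by (simp add: lim_sequentially dist_free_functional)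
  then show "convergent X" by (auto simp: convergent_def)
qed

lift_definition lip_delta :: "'a::real_normed_vector \<Rightarrow> 'a lipfree" is lip_eval
  by (rule subsetD[OF closure_subset span_base]) (rule rangeI)

text \<open>For a subspace \<open>M\<close>, this is the copy of the free space over \<open>M\<close> inside the free space
  over the ambient space.\<close>

definition free_sub :: "'a::real_normed_vector set \<Rightarrow> 'a lipfree set" where
  "free_sub M = closure (span (lip_delta ` M))"


section \<open>Compact operators and approximation properties\<close>

definition compact_operator ::
    "('a::real_normed_vector \<Rightarrow>\<^sub>L 'b::real_normed_vector) \<Rightarrow> bool" where
  "compact_operator T \<longleftrightarrow> compact (closure (blinfun_apply T ` cball 0 1))"

definition compact_ops :: "real \<Rightarrow> ('a::real_normed_vector \<Rightarrow>\<^sub>L 'b::real_normed_vector) set" where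
  "compact_ops r = {T. compact_operator T \<and> norm T \<le> r}"

text \<open>The operator \<open>L\<close> below is the linearization of \<open>f\<close>; it is determined by \<open>f\<close>, see
  the lemma following the definition.\<close>

definition lip_compact_maps :: "real \<Rightarrow> ('a::real_normed_vector, 'b::real_normed_vector) lip0 set" where
  "lip_compact_maps r =
    {f. (\<exists>L :: 'a lipfree \<Rightarrow>\<^sub>L 'b. (\<forall>x. blinfun_apply L (lip_delta x) = lip_apply f x) \<and> compact_operator L)
        \<and> norm f \<le> r}"

lemma span_delta_dense: "closure (span (range lip_delta)) = (UNIV :: 'a::real_normed_vector lipfree set)"
proof (rule UNIV_eq_I[symmetric])
  fix u :: "'a lipfree"
  have lin: "linear (free_functional :: 'a lipfree \<Rightarrow> _)"
    by (rule linearI) (rule plus_lipfree.rep_eq scaleR_lipfree.rep_eq)+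
  have eq: "free_functional ` span (range lip_delta) = span (range (lip_eval :: 'a \<Rightarrow> _))"
    unfolding linear_span_image[OF lin, symmetric] image_image lip_delta.rep_eq ..
  show "u \<in> closure (span (range lip_delta))"
    unfolding closure_approachable
  proof (intro allI impI)
    fix e :: real assume "0 < e"
    then obtain y where y: "y \<in> span (range (lip_eval :: 'a \<Rightarrow> _))" "dist y (free_functional u) < e"
      using free_functional[of u, unfolded closure_approachable] by blast
    from y(1) obtain v where v: "v \<in> span (range lip_delta)" and yv: "y = free_functional v"
      unfolding eq[symmetric] by (rule imageE)
    have "dist v u < e" using y(2) by (simp only: yv dist_free_functional)
    with v show "\<exists>y\<in>span (range lip_delta). dist y u < e" by (rule bexI[rotated])
  qed
qed

lemma linearization_unique:
  fixes L L' :: "'a::real_normed_vector lipfree \<Rightarrow>\<^sub>L 'b::real_normed_vector"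
  assumes "\<And>x. blinfun_apply L (lip_delta x) = blinfun_apply L' (lip_delta x)"
  shows "L = L'"
proof (rule blinfun_eqI)
  fix u
  have lin: "linear (blinfun_apply L)" "linear (blinfun_apply L')"
    by (rule bounded_linear.linear[OF blinfun.bounded_linear_right])+
  have span: "blinfun_apply L v = blinfun_apply L' v" if "v \<in> span (range lip_delta)" for v
    using linear_eq_on[OF lin that] assms by blast
  have "closed {v. blinfun_apply L v = blinfun_apply L' v}"
    by (rule closed_Collect_eq) (rule linear_continuous_on[OF blinfun.bounded_linear_right])+
  then have "closure (span (range lip_delta)) \<subseteq> {v. blinfun_apply L v = blinfun_apply L' v}"
    by (rule closure_minimal[rotated]) (use span in blast)
  then show "blinfun_apply L u = blinfun_apply L' u" unfolding span_delta_dense by blast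
qed

text \<open>The topology of uniform convergence on compact sets, on the space of all maps. On continuous
  maps it is the compact-open topology; only closures of sets of continuous maps, at the
  identity, are used.\<close>

definition compact_uniform_topology ::
    "('a::topological_space \<Rightarrow> 'b::metric_space) topology" where
  "compact_uniform_topology = topology (\<lambda>U. \<forall>f\<in>U. \<exists>K e. compact K \<and> e > 0 \<and>
      {g. \<forall>x\<in>K. dist (g x) (f x) < e} \<subseteq> U)"

lemma openin_compact_uniform_topology:
  "openin compact_uniform_topology U \<longleftrightarrow> (\<forall>f\<in>U. \<exists>K e. compact K \<and> e > 0 \<and>
      {g. \<forall>x\<in>K. dist (g x) (f x) < e} \<subseteq> U)"
proof -
  define P where "P U \<longleftrightarrow> (\<forall>f\<in>U. \<exists>K e. compact K \<and> e > 0 \<and>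
      {g. \<forall>x\<in>K. dist (g x) (f x) < e} \<subseteq> U)" for U :: "('a \<Rightarrow> 'b) set"
  have int: "P (U \<inter> V)" if U: "P U" and V: "P V" for U V
    unfolding P_def
  proof
    fix f assume f: "f \<in> U \<inter> V"
    obtain K e where 1: "compact K" "e > 0" "{g. \<forall>x\<in>K. dist (g x) (f x) < e} \<subseteq> U"
      using bspec[OF U[unfolded P_def] IntD1[OF f]] by (elim exE conjE)
    obtain K' e' where 2: "compact K'" "e' > 0" "{g. \<forall>x\<in>K'. dist (g x) (f x) < e'} \<subseteq> V"
      using bspec[OF V[unfolded P_def] IntD2[OF f]] by (elim exE conjE)
    have "{g. \<forall>x\<in>K \<union> K'. dist (g x) (f x) < min e e'} \<subseteq> U \<inter> V"
    proof
      fix g assume "g \<in> {g. \<forall>x\<in>K \<union> K'. dist (g x) (f x) < min e e'}"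
      then have "g \<in> {g. \<forall>x\<in>K. dist (g x) (f x) < e}" "g \<in> {g. \<forall>x\<in>K'. dist (g x) (f x) < e'}"
        by simp_all
      then show "g \<in> U \<inter> V" by (intro IntI subsetD[OF 1(3)] subsetD[OF 2(3)])
    qed
    moreover have "compact (K \<union> K')" "min e e' > 0" using 1 2 by (simp_all add: compact_Un)
    ultimately show "\<exists>K e. compact K \<and> e > 0 \<and> {g. \<forall>x\<in>K. dist (g x) (f x) < e} \<subseteq> U \<inter> V"
      by (intro exI conjI)
  qed
  have union: "P (\<Union>\<K>)" if "\<forall>U\<in>\<K>. P U" for \<K>
    unfolding P_def
  proof
    fix f assume "f \<in> \<Union>\<K>"
    then obtain U where U: "U \<in> \<K>" "f \<in> U" by (rule UnionE)
    have "P U" using that U(1) by (rule bspec)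
    obtain K e where 1: "compact K" "e > 0" "{g. \<forall>x\<in>K. dist (g x) (f x) < e} \<subseteq> U"
      using bspec[OF \<open>P U\<close>[unfolded P_def] U(2)] by (elim exE conjE)
    have "{g. \<forall>x\<in>K. dist (g x) (f x) < e} \<subseteq> \<Union>\<K>"
      using 1(3) Union_upper[OF U(1)] by (rule order_trans)
    with 1(1,2) show "\<exists>K e. compact K \<and> e > 0 \<and> {g. \<forall>x\<in>K. dist (g x) (f x) < e} \<subseteq> \<Union>\<K>"
      by (intro exI conjI)
  qed
  have "istopology P"
    unfolding istopology_def by (intro conjI allI impI int union)
  then have "openin (topology P) U \<longleftrightarrow> P U" by (rule fun_cong[OF topology_inverse'])
  then show ?thesis
    unfolding compact_uniform_topology_def P_def .
qed

lemma in_closure_compact_uniform_topology: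
  "f \<in> compact_uniform_topology closure_of A \<longleftrightarrow>
    (\<forall>K e. compact K \<and> e > 0 \<longrightarrow> (\<exists>g\<in>A. \<forall>x\<in>K. dist (g x) (f x) < e))" (is "?l \<longleftrightarrow> ?r")
proof
  assume l: ?l
  show ?r
  proof (intro allI impI)
    fix K :: "'a set" and e :: real assume K: "compact K \<and> e > 0"
    let ?U = "{g. \<exists>d<e. \<forall>x\<in>K. dist (g x) (f x) \<le> d}"
    have "openin compact_uniform_topology ?U"
      unfolding openin_compact_uniform_topology
    proof
      fix h assume "h \<in> ?U"
      then obtain d where d: "d < e" "\<And>x. x \<in> K \<Longrightarrow> dist (h x) (f x) \<le> d" by fast
      have "{g. \<forall>x\<in>K. dist (g x) (h x) < (e - d) / 2} \<subseteq> ?U"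
      proof
        fix g assume g: "g \<in> {g. \<forall>x\<in>K. dist (g x) (h x) < (e - d) / 2}"
        have "dist (g x) (f x) \<le> (e - d) / 2 + d" if "x \<in> K" for x
        proof -
          have "dist (g x) (h x) < (e - d) / 2" using g that by simp
          then show ?thesis using d(2)[OF that] dist_triangle[of "g x" "f x" "h x"] by linarith
        qed
        moreover have "(e - d) / 2 + d < e" using d(1) by (simp add: field_simps)
        ultimately show "g \<in> ?U" by blast
      qed
      moreover have "(e - d) / 2 > 0" using d(1) by simp
      ultimately show "\<exists>K e. compact K \<and> e > 0 \<and> {g. \<forall>x\<in>K. dist (g x) (h x) < e} \<subseteq> ?U"
        using conjunct1[OF K] by (intro exI conjI)
    qed
    moreover have "f \<in> ?U" using K by (simp add: exI[of _ 0])
    ultimately obtain g where g: "g \<in> A" "g \<in> ?U"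
      using l unfolding in_closure_of by meson
    then obtain d where "d < e" "\<forall>x\<in>K. dist (g x) (f x) \<le> d" by fast
    with g(1) show "\<exists>g\<in>A. \<forall>x\<in>K. dist (g x) (f x) < e"
      by (meson le_less_trans)
  qed
next
  assume r: ?r
  have "openin compact_uniform_topology (UNIV :: ('a \<Rightarrow> 'b) set)"
    unfolding openin_compact_uniform_topology
    by (intro ballI exI conjI, rule compact_empty, rule zero_less_one, rule subset_UNIV)
  then have "f \<in> topspace compact_uniform_topology"
    by (rule subsetD[OF openin_subset UNIV_I])
  moreover have "\<exists>g. g \<in> A \<and> g \<in> U" if fU: "f \<in> U \<and> openin compact_uniform_topology U" for U
  proof -
    obtain K e where K: "compact K" "e > 0" and U: "{g. \<forall>x\<in>K. dist (g x) (f x) < e} \<subseteq> U"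
      using bspec[OF conjunct2[OF fU, unfolded openin_compact_uniform_topology] conjunct1[OF fU]]
      by (elim exE conjE)
    obtain g where g: "g \<in> A" "\<forall>x\<in>K. dist (g x) (f x) < e" using r K by meson
    from g(2) have "g \<in> U" by (intro subsetD[OF U] CollectI)
    with g(1) show ?thesis by (intro exI conjI)
  qed
  ultimately show ?l unfolding in_closure_of by (intro conjI allI impI)
qed

definition K_BAP :: "'z::banach itself \<Rightarrow> bool" where
  "K_BAP _ \<longleftrightarrow> (\<exists>r\<ge>1. (id :: 'z \<Rightarrow> 'z) \<in> compact_uniform_topology closure_of
      (blinfun_apply ` compact_ops r))"

definition Lip_K_BAP :: "'z::banach itself \<Rightarrow> bool" where
  "Lip_K_BAP _ \<longleftrightarrow> (\<exists>r\<ge>1. (id :: 'z \<Rightarrow> 'z) \<in> compact_uniform_topology closure_of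
      (lip_apply ` lip_compact_maps r))"


section \<open>Subspaces, quotients and ideals\<close>

definition linear_isometry_onto ::
    "('m::real_normed_vector \<Rightarrow> 'z::real_normed_vector) \<Rightarrow> 'z set \<Rightarrow> bool" where
  "linear_isometry_onto j M \<longleftrightarrow> linear j \<and> (\<forall>x. norm (j x) = norm x) \<and> range j = M"

text \<open>The map \<open>q\<close> exhibits its codomain as the quotient by \<open>N\<close>: the quotient norm of a coset is
  the distance of its representatives to \<open>N\<close>.\<close>

definition metric_quotient_map ::
    "('z::real_normed_vector \<Rightarrow> 'q::real_normed_vector) \<Rightarrow> 'z set \<Rightarrow> bool" where
  "metric_quotient_map q N \<longleftrightarrow>
    linear q \<and> surj q \<and> {u. q u = 0} = N \<and> (\<forall>u. norm (q u) = infdist u N)"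

definition annihilator :: "'z::real_normed_vector set \<Rightarrow> ('z \<Rightarrow>\<^sub>L real) set" where
  "annihilator N = {\<phi>. \<forall>y\<in>N. blinfun_apply \<phi> y = 0}"

text \<open>The norm condition is \<open>norm P \<le> 1\<close>: a nonzero projection has norm at least one, so this says
  "norm one" unless \<open>P = 0\<close>, i.e. unless \<open>N = 0\<close>, and the zero subspace counts as an ideal
  (as it does in the description by extension operators).\<close>

definition is_ideal :: "'z::banach set \<Rightarrow> bool" where
  "is_ideal N \<longleftrightarrow> subspace N \<and> closed N \<and>
    (\<exists>P :: ('z \<Rightarrow>\<^sub>L real) \<Rightarrow>\<^sub>L ('z \<Rightarrow>\<^sub>L real).
      P o\<^sub>L P = P \<and> norm P \<le> 1 \<and> {\<phi>. blinfun_apply P \<phi> = 0} = annihilator N)"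


section \<open>The projective tensor product and weak-star density\<close>

text \<open>Bounded bilinear forms on \<open>'a \<times> 'b\<close> are represented as \<open>'a \<Rightarrow>\<^sub>L ('b \<Rightarrow>\<^sub>L real)\<close>, and tensors
  as functionals on bilinear forms.\<close>

lift_definition elem_tensor ::
    "'a::real_normed_vector \<Rightarrow> 'b::real_normed_vector \<Rightarrow> (('a \<Rightarrow>\<^sub>L ('b \<Rightarrow>\<^sub>L real)) \<Rightarrow>\<^sub>L real)"
  is "\<lambda>x y B. blinfun_apply (blinfun_apply B x) y"
proof (rule bounded_linear_intro)
  fix x :: 'a and y :: 'b and B B' :: "'a \<Rightarrow>\<^sub>L ('b \<Rightarrow>\<^sub>L real)" and r :: real
  show "blinfun_apply (blinfun_apply (B + B') x) y = blinfun_apply (blinfun_apply B x) y + blinfun_apply (blinfun_apply B' x) y"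
    by (simp add: blinfun.add_left)
  show "blinfun_apply (blinfun_apply (r *\<^sub>R B) x) y = r *\<^sub>R blinfun_apply (blinfun_apply B x) y"
    by (simp add: blinfun.scaleR_left)
  have "norm (blinfun_apply (blinfun_apply B x) y) \<le> norm (blinfun_apply B x) * norm y"
    by (rule norm_blinfun)
  also have "\<dots> \<le> norm B * norm x * norm y"
    by (intro mult_right_mono norm_blinfun norm_ge_zero)
  finally show "norm (blinfun_apply (blinfun_apply B x) y) \<le> norm B * (norm x * norm y)"
    by (simp add: mult.assoc)
qed

definition alg_tensor_product ::
    "(('a::real_normed_vector \<Rightarrow>\<^sub>L ('b::real_normed_vector \<Rightarrow>\<^sub>L real)) \<Rightarrow>\<^sub>L real) set" where
  "alg_tensor_product = span {elem_tensor x y | x y. True}"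

definition projective_norm ::
    "(('a::real_normed_vector \<Rightarrow>\<^sub>L ('b::real_normed_vector \<Rightarrow>\<^sub>L real)) \<Rightarrow>\<^sub>L real) \<Rightarrow> real" where
  "projective_norm u =
    Inf {\<Sum>(x, y)\<leftarrow>ps. norm x * norm y | ps. u = (\<Sum>(x, y)\<leftarrow>ps. elem_tensor x y)}"

text \<open>The completion of the algebraic tensor product in the projective norm, whose elements are
  given by Cauchy sequences. Since the norm of \<open>(('a \<Rightarrow>\<^sub>L 'b \<Rightarrow>\<^sub>L real) \<Rightarrow>\<^sub>L real)\<close> is dominated by the
  projective norm, every such sequence has a limit there, which represents its class.\<close>

definition projective_tensor_product ::
    "(('a::real_normed_vector \<Rightarrow>\<^sub>L ('b::real_normed_vector \<Rightarrow>\<^sub>L real)) \<Rightarrow>\<^sub>L real) set" where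
  "projective_tensor_product = {u. \<exists>s :: nat \<Rightarrow> _. range s \<subseteq> alg_tensor_product \<and>
      (\<forall>e>0. \<exists>N. \<forall>m\<ge>N. \<forall>n\<ge>N. projective_norm (s m - s n) < e) \<and> s \<longlonglongrightarrow> u}"

text \<open>The weak-star topology of the operator space as the dual of the projective tensor product:
  the coarsest one making the pairings with all of its elements continuous. An operator from
  \<open>'a\<close> to the dual of \<open>'b\<close> is literally a bilinear form on \<open>'a \<times> 'b\<close>; for
  \<open>'a = 'z \<Rightarrow>\<^sub>L real\<close> and \<open>'b = 'z\<close> one gets the operators on the dual of \<open>'z\<close>.\<close>

definition tensor_weak_star_topology ::
    "('a::real_normed_vector \<Rightarrow>\<^sub>L ('b::real_normed_vector \<Rightarrow>\<^sub>L real)) topology" where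
  "tensor_weak_star_topology = topology_generated_by
    {{T. blinfun_apply u T \<in> V} | u V. u \<in> projective_tensor_product \<and> open V}"

text \<open>For scalar-valued operators the strong operator topology, being the topology of pointwise
  convergence, is the weak-star topology of the dual space.\<close>

abbreviation weak_star_topology :: "('z::real_normed_vector \<Rightarrow>\<^sub>L real) topology" where
  "weak_star_topology \<equiv> strong_operator_topology"

definition weak_star_compact_ops ::
    "real \<Rightarrow> (('z::real_normed_vector \<Rightarrow>\<^sub>L real) \<Rightarrow>\<^sub>L ('z \<Rightarrow>\<^sub>L real)) set" where
  "weak_star_compact_ops r =
    {T \<in> compact_ops r. continuous_map weak_star_topology weak_star_topology (blinfun_apply T)}"

text \<open>The dual of \<open>'z\<close> has the bounded weak-star density for compact operators.\<close>

definition dual_BWD :: "'z::banach itself \<Rightarrow> bool" where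
  "dual_BWD _ \<longleftrightarrow> (\<exists>r\<ge>1.
    (compact_ops 1 :: (('z \<Rightarrow>\<^sub>L real) \<Rightarrow>\<^sub>L ('z \<Rightarrow>\<^sub>L real)) set)
      \<subseteq> tensor_weak_star_topology closure_of (weak_star_compact_ops r))"

end

theory Submission
  imports Defs
begin

text \<open>Write \<open>F\<close> for the free space over \<open>X\<close> and \<open>N\<close> for its subspace \<open>free_sub M\<close>.

Bounded compact \<^emph>\<open>linear\<close> operators on \<open>X\<close> that approximate the identity are enough:
the barycenter map from \<open>F\<close> to \<open>X\<close> sends \<open>\<delta>\<^sub>x\<close> to \<open>x\<close>, so a compact \<open>s\<close> composed with it is the
linearization of \<open>s\<close>. Moreover such operators of norm at most \<open>r\<close> form a convex set, hence by
separation in a space of sequences it is enough to approximate the identity in the weak sense, that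
is, on finitely many pairs \<open>(\<phi>, x)\<close> of a functional and a point
(\<open>convex_weak_approximation_imp_strong\<close>). On such pairs the weak-star density hypothesis
replaces compact operators on the dual of \<open>X\<close> by weak-star continuous ones, which are adjoints of
compact operators on \<open>X\<close> (\<open>weak_star_compact_op_is_adjoint\<close>). So everything reduces to bounded
compact operators on the dual of \<open>X\<close> that approximate its identity on finitely many pairs.

These are compositions \<open>\<Lambda> \<circ> W\<close> through the dual of \<open>F\<close>.

\<^item> \<open>W\<close> is compact from the dual of \<open>X\<close> to the dual of \<open>F\<close> and approximates the natural embedding,
which regards a functional as a Lipschitz function
(\<open>compact_approximation_of_dual_embedding\<close>). This is a three-space argument. The projection that
makes \<open>N\<close> an ideal gives a linear extension operator from functionals on the free space over \<open>M\<close> to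
functionals on \<open>F\<close>; applied to adjoints of the compact approximations for \<open>M\<close>, it gives compact
operators \<open>U\<^sub>L\<close> that approximate the embedding on \<open>N\<close>. In the limit \<open>U\<^sub>0\<close> the embedding is attained
on \<open>N\<close>, so the difference between the embedding and \<open>U\<^sub>0\<close> factors through the dual of the quotient,
where the compact approximations of the quotient apply.

\<^item> \<open>\<Lambda>\<close> maps the dual of \<open>F\<close> to the dual of \<open>X\<close> with norm at most one, and for prescribed points
\<open>x\<^sub>1, \<dots>, x\<^sub>n\<close> there is a compact set such that \<open>\<Lambda>\<close> turns Lipschitz functions that are close to a
functional \<open>\<psi>\<close> on this set into functionals that are close to \<open>\<psi>\<close> at every \<open>x\<^sub>i\<close>
(\<open>approximate_lifting\<close>). It arises by averaging increments of Lipschitz functions, first over small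
steps in the directions \<open>x\<^sub>i\<close>, and then over all directions.\<close>

section \<open>The Hahn-Banach theorem\<close>

definition sublinear :: "('a::real_vector \<Rightarrow> real) \<Rightarrow> bool" where
  "sublinear p \<longleftrightarrow> (\<forall>x y. p (x + y) \<le> p x + p y) \<and> (\<forall>c x. c \<ge> 0 \<longrightarrow> p (c *\<^sub>R x) = c * p x)"

lemma sublinear_add: "sublinear p \<Longrightarrow> p (x + y) \<le> p x + p y"
  and sublinear_scaleR: "sublinear p \<Longrightarrow> c \<ge> 0 \<Longrightarrow> p (c *\<^sub>R x) = c * p x"
  by (auto simp: sublinear_def)

lemma sublinear_zero: "sublinear p \<Longrightarrow> p 0 = 0"
  using sublinear_scaleR[of p 0 0] by simp

lemma sublinear_minus: "sublinear p \<Longrightarrow> - p (- x) \<le> p x"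
  using sublinear_add[of p x "- x"] sublinear_zero[of p] by simp

lemma sublinearI:
  assumes "\<And>x y. p (x + y) \<le> p x + p y" and "\<And>c x. c > 0 \<Longrightarrow> p (c *\<^sub>R x) \<le> c * p x" and "p 0 = 0"
  shows "sublinear p"
  unfolding sublinear_def
proof (intro conjI allI impI)
  fix c :: real and x :: 'a assume "c \<ge> 0"
  show "p (c *\<^sub>R x) = c * p x"
  proof (cases "c = 0")
    case False
    with \<open>c \<ge> 0\<close> have c: "c > 0" by simp
    have "p x \<le> inverse c * p (c *\<^sub>R x)" using assms(2)[of "inverse c" "c *\<^sub>R x"] c by simp
    then have "c * p x \<le> p (c *\<^sub>R x)" using c by (simp add: field_simps)
    with assms(2)[OF c, of x] show ?thesis by simp
  qed (simp add: assms(3))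
qed (rule assms(1))

text \<open>The largest sublinear functional below \<open>p\<close> that is at most \<open>- \<delta>\<close> at the negatives of \<open>D\<close>. With
\<open>D = {x}\<close> and \<open>\<delta> = p x\<close> it shows that minimal sublinear functionals are linear; with a convex set
away from the origin it produces separating functionals.\<close>

lemma sublinear_inf_cone:
  fixes p :: "'a::real_vector \<Rightarrow> real" and a :: "'a \<Rightarrow> real"
  assumes p: "sublinear p" and D: "convex D" "D \<noteq> {}" and le: "\<And>d. d \<in> D \<Longrightarrow> \<delta> \<le> p d"
  defines "m \<equiv> \<lambda>w. INF (t, d) \<in> {0..} \<times> D. p (w + t *\<^sub>R d) - t * \<delta>"
  shows "sublinear m" and "m w \<le> p w" and "d \<in> D \<Longrightarrow> m (- d) \<le> - \<delta>"
proof -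
  have low: "- p (- w) \<le> p (w + t *\<^sub>R d) - t * \<delta>" if "t \<ge> 0" "d \<in> D" for w t d
  proof -
    have "t * \<delta> \<le> p (t *\<^sub>R d)" using le[OF that(2)] that(1) by (simp add: sublinear_scaleR[OF p] mult_left_mono)
    also have "\<dots> \<le> p (w + t *\<^sub>R d) + p (- w)"
      using sublinear_add[OF p, of "w + t *\<^sub>R d" "- w"] by simp
    finally show ?thesis by simp
  qed
  have up: "m w \<le> p (w + t *\<^sub>R d) - t * \<delta>" if "t \<ge> 0" "d \<in> D" for w t d
    unfolding m_def
  proof (rule cINF_lower2[where x = "(t, d)"])
    show "bdd_below ((\<lambda>(t, d). p (w + t *\<^sub>R d) - t * \<delta>) ` ({0..} \<times> D))"
      using low by (intro bdd_belowI2[where m = "- p (- w)"]) auto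
  qed (use that in auto)
  have greatest: "b \<le> m w" if "\<And>t d. t \<ge> 0 \<Longrightarrow> d \<in> D \<Longrightarrow> b \<le> p (w + t *\<^sub>R d) - t * \<delta>" for b w
    unfolding m_def using that D(2) by (intro cINF_greatest) auto
  obtain d0 where d0: "d0 \<in> D" using D(2) by blast
  show mp: "m w \<le> p w" for w using up[OF _ d0, of 0 w] by simp
  show "m (- d) \<le> - \<delta>" if "d \<in> D" for d using up[OF _ that, of 1 "- d"] by (simp add: sublinear_zero[OF p])
  show "sublinear m"
  proof (rule sublinearI)
    fix w w'
    have 1: "m (w + w') \<le> (p (w + t *\<^sub>R d) - t * \<delta>) + (p (w' + t' *\<^sub>R d') - t' * \<delta>)"
      if t: "t \<ge> 0" "d \<in> D" "t' \<ge> 0" "d' \<in> D" for t d t' d'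
    proof -
      obtain d'' where d'': "d'' \<in> D" "(t + t') *\<^sub>R d'' = t *\<^sub>R d + t' *\<^sub>R d'"
      proof (cases "t + t' = 0")
        case True
        then have "t = 0" "t' = 0" using t by auto
        then show ?thesis using that[of d0] d0 by simp
      next
        case False
        then have pos: "t + t' > 0" using t by simp
        have "(t / (t + t')) *\<^sub>R d + (t' / (t + t')) *\<^sub>R d' \<in> D"
          using t pos by (intro convexD[OF D(1)]) (auto simp flip: add_divide_distrib)
        moreover have "(t + t') *\<^sub>R ((t / (t + t')) *\<^sub>R d + (t' / (t + t')) *\<^sub>R d') = t *\<^sub>R d + t' *\<^sub>R d'"
          using pos by (simp add: scaleR_add_right)
        ultimately show ?thesis using that by blast
      qed
      have "m (w + w') \<le> p (w + w' + (t + t') *\<^sub>R d'') - (t + t') * \<delta>"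
        using up[of "t + t'" d''] t d'' by simp
      also have "w + w' + (t + t') *\<^sub>R d'' = (w + t *\<^sub>R d) + (w' + t' *\<^sub>R d')"
        by (simp add: d'')
      also have "p \<dots> \<le> p (w + t *\<^sub>R d) + p (w' + t' *\<^sub>R d')" by (rule sublinear_add[OF p])
      finally show ?thesis by (simp add: algebra_simps)
    qed
    have "m (w + w') - (p (w + t *\<^sub>R d) - t * \<delta>) \<le> m w'" if "t \<ge> 0" "d \<in> D" for t d
      by (rule greatest) (use 1[OF that] in \<open>simp add: algebra_simps\<close>)
    then have "m (w + w') - m w' \<le> m w" by (intro greatest) (simp add: algebra_simps)
    then show "m (w + w') \<le> m w + m w'" by simp
  next
    fix c :: real and w assume c: "c > 0"
    have "inverse c * m (c *\<^sub>R w) \<le> m w"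
    proof (rule greatest)
      fix t d assume t: "t \<ge> (0::real)" "d \<in> D"
      have "m (c *\<^sub>R w) \<le> p (c *\<^sub>R w + (c * t) *\<^sub>R d) - (c * t) * \<delta>"
        using up[of "c * t" d "c *\<^sub>R w"] t c by simp
      also have "c *\<^sub>R w + (c * t) *\<^sub>R d = c *\<^sub>R (w + t *\<^sub>R d)" by (simp add: scaleR_add_right)
      finally have "m (c *\<^sub>R w) \<le> c * (p (w + t *\<^sub>R d) - t * \<delta>)"
        using c by (simp only: sublinear_scaleR[OF p less_imp_le[OF c]]) (simp add: algebra_simps)
      then show "inverse c * m (c *\<^sub>R w) \<le> p (w + t *\<^sub>R d) - t * \<delta>" using c by (simp add: field_simps)
    qed
    then show "m (c *\<^sub>R w) \<le> c * m w" using c by (simp add: field_simps)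
  next
    show "m 0 = 0"
    proof (rule antisym)
      show "m 0 \<le> 0" using mp[of 0] sublinear_zero[OF p] by simp
      show "0 \<le> m 0" using low[of _ _ 0] sublinear_zero[OF p] by (intro greatest) auto
    qed
  qed
qed

text \<open>Lowering \<open>m\<close> along the ray of \<open>x\<close> cannot change \<open>m\<close>, which forces \<open>m (- x) = - m x\<close>; together with
subadditivity this is additivity.\<close>

lemma minimal_sublinear_linear:
  fixes m :: "'a::real_vector \<Rightarrow> real"
  assumes m: "sublinear m" and min: "\<And>n. sublinear n \<Longrightarrow> (\<And>x. n x \<le> m x) \<Longrightarrow> n = m"
  shows "linear m"
proof -
  have ge: "m y + m x \<le> m (y + x)" for x y
  proof -
    \<comment> \<open>the functional \<open>n\<close> lies below \<open>m\<close>, hence equals it, and \<open>n (- x) \<le> - m x\<close>\<close>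
    define n where "n = (\<lambda>w. INF (t, d) \<in> {0..} \<times> {x}. m (w + t *\<^sub>R d) - t * m x)"
    have "sublinear n" "\<And>w. n w \<le> m w" "n (- x) \<le> - m x"
      unfolding n_def using sublinear_inf_cone[OF m, of "{x}" "m x"] by auto
    then have "m (- x) \<le> - m x" using min by metis
    then show ?thesis using sublinear_add[OF m, of "y + x" "- x"] by simp
  qed
  have add: "m (x + y) = m x + m y" for x y using ge[of x y] sublinear_add[OF m, of x y] by simp
  have neg: "m (- x) = - m x" for x using add[of x "- x"] sublinear_zero[OF m] by simp
  show ?thesis
  proof (rule linearI)
    fix c x
    show "m (c *\<^sub>R x) = c *\<^sub>R m x"
    proof (cases "c \<ge> 0")
      case False
      then have "m ((- c) *\<^sub>R x) = (- c) * m x" by (intro sublinear_scaleR[OF m]) simp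
      then show ?thesis using neg[of "c *\<^sub>R x"] by simp
    qed (simp add: sublinear_scaleR[OF m])
  qed (rule add)
qed

text \<open>By Zorn's lemma there is a minimal sublinear functional below \<open>p\<close>: a pointwise infimum of a chain is
finite since every sublinear \<open>a \<le> p\<close> satisfies \<open>- p (- x) \<le> a x\<close>.\<close>

theorem sublinear_dominates_linear:
  fixes p :: "'a::real_vector \<Rightarrow> real"
  assumes p: "sublinear p"
  obtains f where "linear f" "\<And>x. f x \<le> p x"
proof -
  define A where "A = {m. sublinear m \<and> (\<forall>x. m x \<le> p x)}"
  define P where "P m n \<longleftrightarrow> (\<forall>x. n x \<le> m x)" for m n :: "'a \<Rightarrow> real"
  have P_trans: "P m k" if "P m n" "P n k" for m n k
    using that unfolding P_def by (meson order_trans)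
  have P_antisym: "m = n" if "P m n" "P n m" for m n
    using that unfolding P_def by (meson ext order.antisym)
  have po: "partial_order_on A (relation_of P A)"
    unfolding partial_order_on_def preorder_on_def
  proof (intro conjI)
    show "refl_on A (relation_of P A)" by (auto simp: refl_on_def relation_of_def P_def)
    show "trans (relation_of P A)" unfolding trans_def relation_of_def using P_trans by blast
    show "antisym (relation_of P A)" unfolding antisym_def relation_of_def using P_antisym by blast
  qed (auto simp: relation_of_def)
  have "\<exists>m\<in>A. \<forall>n\<in>A. P m n \<longrightarrow> n = m"
  proof (rule predicate_Zorn[OF po])
    fix C assume C: "C \<in> Chains (relation_of P A)"
    show "\<exists>u\<in>A. \<forall>a\<in>C. P a u"
    proof (cases "C = {}")
      case True
      then show ?thesis using p by (auto simp: A_def)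
    next
      case False
      have CA: "a \<in> A" and tot: "P a b \<or> P b a" if "a \<in> C" "b \<in> C" for a b
        using C that by (auto simp: Chains_def relation_of_def)
      have low: "- p (- x) \<le> a x" if "a \<in> C" for a x
      proof -
        have "- a (- x) \<le> a x" "a (- x) \<le> p (- x)"
          using CA[OF that that] by (auto simp: A_def intro: sublinear_minus)
        then show ?thesis by linarith
      qed
      define u where "u = (\<lambda>x. INF a\<in>C. a x)"
      have up: "u x \<le> a x" if "a \<in> C" for a x
        unfolding u_def using that low by (intro cINF_lower bdd_belowI2) auto
      have greatest: "b \<le> u x" if "\<And>a. a \<in> C \<Longrightarrow> b \<le> a x" for b x
        unfolding u_def using that False by (intro cINF_greatest) auto
      obtain a0 where a0: "a0 \<in> C" using False by blast
      have sub: "sublinear a" if "a \<in> C" for a using CA[OF that that] by (simp add: A_def)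
      have "sublinear u"
      proof (rule sublinearI)
        fix x y
        have 1: "u (x + y) \<le> a x + b y" if ab: "a \<in> C" "b \<in> C" for a b
        proof -
          \<comment> \<open>the smaller of the two functionals controls both values\<close>
          obtain c where c: "c \<in> C" "c x \<le> a x" "c y \<le> b y"
            using tot[OF ab] ab unfolding P_def by blast
          then show ?thesis using up[OF c(1), of "x + y"] sublinear_add[OF sub[OF c(1)], of x y] by linarith
        qed
        have "u (x + y) - b y \<le> u x" if "b \<in> C" for b
          by (rule greatest) (use 1[OF _ that] in \<open>simp add: algebra_simps\<close>)
        then have "u (x + y) - u x \<le> u y" by (intro greatest) (simp add: algebra_simps)
        then show "u (x + y) \<le> u x + u y" by simp
      next
        fix c :: real and x assume c: "c > 0"
        have "inverse c * u (c *\<^sub>R x) \<le> u x"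
        proof (rule greatest)
          fix a assume a: "a \<in> C"
          have "u (c *\<^sub>R x) \<le> c * a x" using up[OF a, of "c *\<^sub>R x"] c by (simp add: sublinear_scaleR[OF sub[OF a]])
          then show "inverse c * u (c *\<^sub>R x) \<le> a x" using c by (simp add: field_simps)
        qed
        then show "u (c *\<^sub>R x) \<le> c * u x" using c by (simp add: field_simps)
      next
        have zero: "a 0 = 0" if "a \<in> C" for a using sublinear_zero[OF sub[OF that]] .
        show "u 0 = 0"
        proof (rule order.antisym)
          show "u 0 \<le> 0" using up[OF a0, of 0] zero[OF a0] by simp
          show "0 \<le> u 0" by (rule greatest) (simp add: zero)
        qed
      qed
      moreover have "u x \<le> p x" for x
        using order_trans[OF up[OF a0, of x]] CA[OF a0 a0] by (simp add: A_def)
      ultimately have "u \<in> A" by (simp add: A_def)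
      then show ?thesis using up by (auto simp: P_def)
    qed
  qed
  then obtain m where m: "m \<in> A" and min: "\<And>n. n \<in> A \<Longrightarrow> P m n \<Longrightarrow> n = m" by blast
  have "linear m"
  proof (rule minimal_sublinear_linear)
    show "n = m" if "sublinear n" "\<And>x. n x \<le> m x" for n
      using that order_trans[OF that(2)] m by (intro min) (simp_all add: A_def P_def)
  qed (use m in \<open>simp add: A_def\<close>)
  then show ?thesis using that m by (auto simp: A_def)
qed

text \<open>A linear functional below the sublinear functional of \<open>sublinear_inf_cone\<close> for the norm is bounded by
the norm and, being at most \<open>- \<delta>\<close> at \<open>- d\<close>, at least \<open>\<delta>\<close> at \<open>d\<close>.\<close>

lemma convex_separation:
  fixes D :: "'a::real_normed_vector set"
  assumes D: "convex D" and far: "\<And>d. d \<in> D \<Longrightarrow> \<delta> \<le> norm d"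
  obtains \<phi> :: "'a \<Rightarrow>\<^sub>L real" where "norm \<phi> \<le> 1" "\<And>d. d \<in> D \<Longrightarrow> \<delta> \<le> \<phi> d"
proof (cases "D = {}")
  case True
  show ?thesis by (rule that[of 0]) (use True in auto)
next
  case False
  have sub: "sublinear (norm :: 'a \<Rightarrow> real)" by (rule sublinearI) (auto intro: norm_triangle_ineq)
  define m where "m = (\<lambda>w. INF (t, d) \<in> {0..} \<times> D. norm (w + t *\<^sub>R d) - t * \<delta>)"
  have m: "sublinear m" "m w \<le> norm w" "d \<in> D \<Longrightarrow> m (- d) \<le> - \<delta>" for w d
    unfolding m_def by (rule sublinear_inf_cone[OF sub D False far]; assumption)+
  obtain f where f: "linear f" "\<And>x. f x \<le> m x"
    using sublinear_dominates_linear[OF m(1)] by blast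
  have le: "f x \<le> norm x" for x using order_trans[OF f(2) m(2)] .
  have abs: "norm (f x) \<le> norm x" for x
    using le[of x] le[of "- x"] linear_neg[OF f(1), of x] by simp
  have bl: "bounded_linear f"
    using f(1) abs by (intro bounded_linear_intro[where K = 1]) (auto simp: linear_add linear_scale)
  show ?thesis
  proof (rule that[of "Blinfun f"])
    show "norm (Blinfun f) \<le> 1"
      by (rule norm_blinfun_bound) (use abs bl in \<open>auto simp: bounded_linear_Blinfun_apply\<close>)
    fix d assume "d \<in> D"
    then have "f (- d) \<le> - \<delta>" using order_trans[OF f(2) m(3)] by blast
    then show "\<delta> \<le> Blinfun f d"
      using linear_neg[OF f(1), of d] by (simp add: bounded_linear_Blinfun_apply[OF bl])
  qed
qed

corollary norming_functional:
  fixes x :: "'a::real_normed_vector"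
  obtains \<phi> :: "'a \<Rightarrow>\<^sub>L real" where "norm \<phi> \<le> 1" "\<phi> x = norm x"
proof -
  obtain \<phi> :: "'a \<Rightarrow>\<^sub>L real" where \<phi>: "norm \<phi> \<le> 1" "norm x \<le> \<phi> x"
    using convex_separation[of "{x}" "norm x"] by auto
  have "\<phi> x \<le> norm x"
    using norm_blinfun[of \<phi> x] mult_right_mono[OF \<phi>(1), of "norm x"] by simp
  then show ?thesis using that \<phi> by force
qed

corollary norm_le_by_functionals:
  fixes x :: "'a::real_normed_vector"
  assumes "\<And>\<phi> :: 'a \<Rightarrow>\<^sub>L real. norm \<phi> \<le> 1 \<Longrightarrow> blinfun_apply \<phi> x \<le> b"
  shows "norm x \<le> b"
  by (rule norming_functional[of x]) (use assms in metis)

section \<open>Limits along filters\<close>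

lemma compact_function_box:
  "compact {c :: 'a \<Rightarrow> real. \<forall>i. c i \<in> {- b i .. b i}}"
proof -
  have "compactin (product_topology (\<lambda>i. euclidean) (UNIV :: 'a set)) (PiE UNIV (\<lambda>i. {- b i .. b i}))"
    unfolding compactin_PiE by simp
  then show ?thesis by (simp add: PiE_UNIV_domain Pi_def euclidean_product_topology)
qed

text \<open>A substitute for ultrafilters: the values of all bounded functions at an index form a point of a
compact product of intervals, and along the refined filter these points converge to a cluster point.\<close>

lemma refine_filter_to_converge:
  fixes F :: "'i filter"
  assumes "F \<noteq> bot"
  obtains F' where "F' \<le> F" "F' \<noteq> bot" "\<And>h :: 'i \<Rightarrow> real. bounded (range h) \<Longrightarrow> \<exists>l. (h \<longlongrightarrow> l) F'"
proof -
  \<comment> \<open>unbounded functions are replaced by zero, so that all values lie in a box\<close>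
  define e where "e = (\<lambda>i (h :: 'i \<Rightarrow> real). if bounded (range h) then h i else 0)"
  define b where "b = (\<lambda>h :: 'i \<Rightarrow> real. SUP i. \<bar>e i h\<bar>)"
  have eb: "\<bar>e i h\<bar> \<le> b h" for i h
  proof -
    have "bounded (range (\<lambda>i. e i h))" unfolding e_def by (cases "bounded (range h)") auto
    then obtain B where "\<And>i. \<bar>e i h\<bar> \<le> B" by (auto simp: bounded_iff)
    then show ?thesis unfolding b_def by (intro cSUP_upper bdd_aboveI2) auto
  qed
  define U where "U = {c :: ('i \<Rightarrow> real) \<Rightarrow> real. \<forall>h. c h \<in> {- b h .. b h}}"
  have "compact U" unfolding U_def by (rule compact_function_box)
  moreover have "filtermap e F \<noteq> bot" using assms by (simp add: filtermap_bot_iff)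
  moreover have "eventually (\<lambda>c. c \<in> U) (filtermap e F)"
    unfolding eventually_filtermap U_def using eb by (auto intro!: always_eventually simp: abs_le_iff minus_le_iff)
  ultimately obtain c where c: "inf (nhds c) (filtermap e F) \<noteq> bot" unfolding compact_filter by blast
  define F' where "F' = inf (filtercomap e (nhds c)) F"
  have "F' \<noteq> bot"
  proof
    assume "F' = bot"
    then have "eventually (\<lambda>i. False) F'" by simp
    then obtain P Q where P: "eventually P (filtercomap e (nhds c))" and Q: "eventually Q F"
      and PQ: "\<And>i. P i \<Longrightarrow> Q i \<Longrightarrow> False"
      unfolding F'_def eventually_inf by blast
    from P obtain R where R: "eventually R (nhds c)" "\<And>i. R (e i) \<Longrightarrow> P i"
      unfolding eventually_filtercomap by blast
    have "eventually (\<lambda>d. \<not> R d) (filtermap e F)"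
      unfolding eventually_filtermap using Q by eventually_elim (use R PQ in blast)
    with R(1) have "eventually (\<lambda>d. False) (inf (nhds c) (filtermap e F))"
      unfolding eventually_inf by blast
    with c show False by (simp add: trivial_limit_def)
  qed
  moreover have "F' \<le> F" by (simp add: F'_def)
  moreover have "\<exists>l. (h \<longlongrightarrow> l) F'" if "bounded (range h)" for h :: "'i \<Rightarrow> real"
  proof -
    have lim: "filterlim e (nhds c) F'"
      unfolding F'_def filterlim_iff_le_filtercomap by simp
    have "((\<lambda>i. e i h) \<longlongrightarrow> c h) F'"
      unfolding tendsto_def
    proof (intro allI impI)
      fix V :: "real set" assume V: "open V" "c h \<in> V"
      have "open ((\<lambda>d. d h) -` V)"
        using open_vimage[OF V(1) continuous_on_product_coordinates[of h]] by simp
      then have "eventually (\<lambda>d. d h \<in> V) (nhds c)"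
        unfolding eventually_nhds using V(2) by (intro exI[of _ "(\<lambda>d. d h) -` V"]) auto
      then show "eventually (\<lambda>i. e i h \<in> V) F'" using lim by (rule eventually_compose_filterlim)
    qed
    then show ?thesis using that by (auto simp: e_def)
  qed
  ultimately show ?thesis using that by blast
qed

text \<open>Turns an approximation property, stated for finite sets and positive errors, into a limit: if
\<open>d i x\<close> is the error of the approximation \<open>i\<close> at \<open>x\<close>, all errors tend to zero along \<open>F\<close>, and all
quantities that are bounded over the approximations have a limit.\<close>

lemma net_along_finite_sets:
  fixes d :: "'i \<Rightarrow> 'a \<Rightarrow> real"
  assumes "\<And>A e. finite A \<Longrightarrow> e > 0 \<Longrightarrow> \<exists>i\<in>S. \<forall>x\<in>A. \<bar>d i x\<bar> < e"
  obtains F where "F \<noteq> bot" "F \<le> principal S" "\<And>x. ((\<lambda>i. d i x) \<longlongrightarrow> 0) F"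
    "\<And>h :: 'i \<Rightarrow> real. bounded (h ` S) \<Longrightarrow> \<exists>l. (h \<longlongrightarrow> l) F"
proof -
  have "\<exists>i. finite (fst An) \<longrightarrow> i \<in> S \<and> (\<forall>x\<in>fst An. \<bar>d i x\<bar> < inverse (real (Suc (snd An))))" for An :: "'a set \<times> nat"
    using assms[of "fst An" "inverse (real (Suc (snd An)))"] by (cases "finite (fst An)") auto
  then obtain I :: "'a set \<times> nat \<Rightarrow> 'i" where I: "\<And>A n. finite A \<Longrightarrow> I (A, n) \<in> S"
      "\<And>A n x. finite A \<Longrightarrow> x \<in> A \<Longrightarrow> \<bar>d (I (A, n)) x\<bar> < inverse (real (Suc n))"
    by (metis fst_conv snd_conv)
  define G where "G = finite_subsets_at_top (UNIV :: 'a set) \<times>\<^sub>F sequentially"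
  have "G \<noteq> bot" unfolding G_def by (simp add: prod_filter_eq_bot)
  have fin: "eventually (\<lambda>An. finite (fst An) \<and> A \<subseteq> fst An \<and> n \<le> snd An) G" if "finite A" for A n
  proof -
    have "eventually (\<lambda>B. finite B \<and> A \<subseteq> B) (finite_subsets_at_top UNIV)"
      using that unfolding eventually_finite_subsets_at_top by blast
    from eventually_prodI[OF this eventually_ge_at_top[of n]]
    show ?thesis unfolding G_def by (auto elim: eventually_mono)
  qed
  define F0 where "F0 = filtermap I G"
  have "F0 \<noteq> bot" using \<open>G \<noteq> bot\<close> by (simp add: F0_def filtermap_bot_iff)
  then obtain F where F: "F \<le> F0" "F \<noteq> bot"
      "\<And>h :: 'i \<Rightarrow> real. bounded (range h) \<Longrightarrow> \<exists>l. (h \<longlongrightarrow> l) F"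
    by (rule refine_filter_to_converge) blast
  have "F0 \<le> principal S"
    unfolding F0_def le_principal eventually_filtermap
    using fin[of "{}" 0] by (auto elim!: eventually_mono intro: I(1))
  then have FS: "F \<le> principal S" using F(1) by simp
  have "((\<lambda>i. d i x) \<longlongrightarrow> 0) F0" for x
  proof (rule tendstoI)
    fix e :: real assume "e > 0"
    then obtain n where n: "inverse (real (Suc n)) < e" using reals_Archimedean by blast
    show "eventually (\<lambda>i. dist (d i x) 0 < e) F0"
      unfolding F0_def eventually_filtermap
    proof (rule eventually_mono)
      show "eventually (\<lambda>An. finite (fst An) \<and> {x} \<subseteq> fst An \<and> n \<le> snd An) G"
        by (rule fin) simp
      fix An assume elim: "finite (fst An) \<and> {x} \<subseteq> fst An \<and> n \<le> snd An"
      obtain A m where An: "An = (A, m)" by fastforce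
      have "\<bar>d (I (A, m)) x\<bar> < inverse (real (Suc m))" using I(2)[of A x m] elim by (simp add: An)
      also have "\<dots> \<le> inverse (real (Suc n))" using elim by (simp add: An field_simps)
      finally show "dist (d (I An) x) 0 < e" using n by (simp add: An)
    qed
  qed
  then have "((\<lambda>i. d i x) \<longlongrightarrow> 0) F" for x using F(1) tendsto_mono by blast
  moreover have "\<exists>l. (h \<longlongrightarrow> l) F" if h: "bounded (h ` S)" for h :: "'i \<Rightarrow> real"
  proof -
    obtain B where B: "\<And>i. i \<in> S \<Longrightarrow> \<bar>h i\<bar> \<le> B" using h by (auto simp: bounded_iff)
    have "bounded (range (\<lambda>i. if i \<in> S then h i else 0))"
      unfolding bounded_iff using B by (intro exI[of _ "max B 0"]) (auto simp: le_max_iff_disj)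
    then obtain l where "((\<lambda>i. if i \<in> S then h i else 0) \<longlongrightarrow> l) F" using F(3) by blast
    moreover have "eventually (\<lambda>i. (if i \<in> S then h i else 0) = h i) F"
      using FS unfolding le_principal by eventually_elim simp
    ultimately have "(h \<longlongrightarrow> l) F" by (rule Lim_transform_eventually)
    then show ?thesis ..
  qed
  ultimately show ?thesis using that F(2) FS by blast
qed

section \<open>Compact operators and their adjoints\<close>

text \<open>Total boundedness of the image of \<open>A\<close>, with the finitely many centres taken from the image itself.\<close>

definition totally_bounded_image :: "('a \<Rightarrow> 'b::metric_space) \<Rightarrow> 'a set \<Rightarrow> bool" where
  "totally_bounded_image f A \<longleftrightarrow> (\<forall>e>0. \<exists>A0\<subseteq>A. finite A0 \<and> (\<forall>a\<in>A. \<exists>a0\<in>A0. dist (f a) (f a0) < e))"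

lemma compact_operator_iff_totally_bounded:
  fixes T :: "'a::real_normed_vector \<Rightarrow>\<^sub>L 'b::banach"
  shows "compact_operator T \<longleftrightarrow> totally_bounded_image T (cball 0 1)"
proof
  assume T: "compact_operator T"
  show "totally_bounded_image T (cball 0 1)"
    unfolding totally_bounded_image_def
  proof (intro allI impI)
    fix e :: real assume e: "e > 0"
    have "\<exists>k. finite k \<and> closure (T ` cball 0 1) \<subseteq> (\<Union>x\<in>k. ball x (e/2))"
      using T e unfolding compact_operator_def compact_eq_totally_bounded by simp
    then obtain k where k: "finite k" "closure (T ` cball 0 1) \<subseteq> (\<Union>x\<in>k. ball x (e/2))" by blast
    define k' where "k' = {x\<in>k. \<exists>a\<in>cball 0 1. dist x (T a) < e/2}"
    have "\<forall>x\<in>k'. \<exists>a. a \<in> cball 0 1 \<and> dist x (T a) < e/2" by (auto simp: k'_def)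
    then obtain g where g: "\<And>x. x \<in> k' \<Longrightarrow> g x \<in> cball 0 1 \<and> dist x (T (g x)) < e/2" by metis
    show "\<exists>A0\<subseteq>cball 0 1. finite A0 \<and> (\<forall>a\<in>cball 0 1. \<exists>a0\<in>A0. dist (T a) (T a0) < e)"
    proof (intro exI conjI ballI)
      show "g ` k' \<subseteq> cball 0 1" using g by blast
      show "finite (g ` k')" using k(1) by (simp add: k'_def)
      fix a :: 'a assume a: "a \<in> cball 0 1"
      then have "T a \<in> closure (T ` cball 0 1)" by (intro subsetD[OF closure_subset] imageI)
      then obtain x where x: "x \<in> k" "dist x (T a) < e/2" using k(2) by auto
      then have xk: "x \<in> k'" using a by (auto simp: k'_def)
      have "dist (T a) (T (g x)) < e"
        by (rule dist_triangle_half_r[OF x(2)]) (use g[OF xk] in simp)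
      then show "\<exists>a0\<in>g ` k'. dist (T a) (T a0) < e" using xk by blast
    qed
  qed
next
  assume T: "totally_bounded_image T (cball 0 1)"
  show "compact_operator T"
    unfolding compact_operator_def compact_eq_totally_bounded
  proof (intro conjI allI impI)
    show "complete (closure (T ` cball 0 1))" by (simp add: complete_eq_closed)
    fix e :: real assume e: "e > 0"
    then obtain A0 where A0: "finite A0" "\<And>a. a \<in> cball 0 1 \<Longrightarrow> \<exists>a0\<in>A0. dist (T a) (T a0) < e/2"
      using T[unfolded totally_bounded_image_def, rule_format, of "e/2"] by auto
    have "closure (T ` cball 0 1) \<subseteq> (\<Union>x\<in>T ` A0. ball x e)"
    proof
      fix y assume "y \<in> closure (T ` cball 0 1)"
      then obtain y' where y': "y' \<in> T ` cball 0 1" "dist y' y < e/2"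
        unfolding closure_approachable using half_gt_zero[OF e] by blast
      then obtain a where a: "a \<in> cball 0 1" "dist (T a) y < e/2" by blast
      obtain a0 where "a0 \<in> A0" "dist (T a) (T a0) < e/2" using A0(2)[OF a(1)] by blast
      then show "y \<in> (\<Union>x\<in>T ` A0. ball x e)"
        using a(2) dist_triangle_half_r[of "T a" "T a0" e y] by auto
    qed
    then show "\<exists>k. finite k \<and> closure (T ` cball 0 1) \<subseteq> (\<Union>x\<in>k. ball x e)"
      using A0(1) by blast
  qed
qed

text \<open>The common core of Schauder's theorem and its converse. The sets \<open>A\<close> and \<open>C\<close> are paired by \<open>b\<close>; the
distance of values of \<open>S\<close> is controlled by the largest difference over \<open>C\<close>, and differences over \<open>A\<close>
are controlled by the distance of values of \<open>T\<close>. Elements of \<open>A\<close> whose pairings with a finite net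
of \<open>C\<close> nearly coincide then have nearby values of \<open>S\<close>.\<close>

lemma totally_bounded_dual_pair:
  fixes S :: "'a \<Rightarrow> 'y::metric_space" and T :: "'c \<Rightarrow> 'z::metric_space" and b :: "'a \<Rightarrow> 'c \<Rightarrow> real"
  assumes T: "totally_bounded_image T C"
    and S: "\<And>a a' d. a \<in> A \<Longrightarrow> a' \<in> A \<Longrightarrow> (\<And>c. c \<in> C \<Longrightarrow> \<bar>b a c - b a' c\<bar> \<le> d) \<Longrightarrow> dist (S a) (S a') \<le> d"
    and b: "\<And>a c c'. a \<in> A \<Longrightarrow> c \<in> C \<Longrightarrow> c' \<in> C \<Longrightarrow> \<bar>b a c - b a c'\<bar> \<le> dist (T c) (T c')"
    and bd: "\<And>a c. a \<in> A \<Longrightarrow> c \<in> C \<Longrightarrow> \<bar>b a c\<bar> \<le> B"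
  shows "totally_bounded_image S A"
  unfolding totally_bounded_image_def
proof (intro allI impI)
  fix e :: real assume e: "e > 0"
  define \<epsilon> where "\<epsilon> = e / 4"
  have \<epsilon>: "\<epsilon> > 0" using e by (simp add: \<epsilon>_def)
  obtain C0 where C0: "C0 \<subseteq> C" "finite C0" "\<And>c. c \<in> C \<Longrightarrow> \<exists>c0\<in>C0. dist (T c) (T c0) < \<epsilon>"
    using T[unfolded totally_bounded_image_def, rule_format, OF \<epsilon>] by auto
  \<comment> \<open>the values on the finite set, rounded to multiples of \<open>\<epsilon>\<close>, take finitely many configurations\<close>
  define V where "V a = (\<lambda>c\<in>C0. \<lfloor>b a c / \<epsilon>\<rfloor>)" for a
  have "V ` A \<subseteq> PiE C0 (\<lambda>_. {\<lfloor>- (B / \<epsilon>)\<rfloor> .. \<lfloor>B / \<epsilon>\<rfloor>})"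
  proof
    fix v assume "v \<in> V ` A"
    then obtain a where a: "a \<in> A" "v = V a" by blast
    have "- (B / \<epsilon>) \<le> b a c / \<epsilon>" "b a c / \<epsilon> \<le> B / \<epsilon>" if "c \<in> C0" for c
      using bd[OF a(1), of c] C0(1) that \<epsilon> by (auto simp: field_simps abs_le_iff)
    then show "v \<in> PiE C0 (\<lambda>_. {\<lfloor>- (B / \<epsilon>)\<rfloor> .. \<lfloor>B / \<epsilon>\<rfloor>})"
      unfolding a(2) V_def by (auto intro!: floor_mono)
  qed
  then have "finite (V ` A)" by (rule finite_subset) (simp add: finite_PiE C0(2))
  then obtain A0 where A0: "A0 \<subseteq> A" "finite A0" "V ` A = V ` A0"
    using finite_subset_image[OF _ subset_refl] by metis
  have "\<exists>a0\<in>A0. dist (S a) (S a0) < e" if a: "a \<in> A" for a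
  proof -
    obtain a0 where a0: "a0 \<in> A0" "V a = V a0" using a A0(3) by (metis image_iff)
    have a0A: "a0 \<in> A" using a0 A0 by blast
    have "dist (S a) (S a0) \<le> 3 * \<epsilon>"
    proof (rule S[OF a a0A])
      fix c assume c: "c \<in> C"
      obtain c0 where c0: "c0 \<in> C0" "dist (T c) (T c0) < \<epsilon>" using C0(3)[OF c] by blast
      have c0C: "c0 \<in> C" using c0 C0 by blast
      have "\<lfloor>b a c0 / \<epsilon>\<rfloor> = \<lfloor>b a0 c0 / \<epsilon>\<rfloor>" using fun_cong[OF a0(2), of c0] c0(1) by (simp add: V_def)
      then have "\<bar>b a c0 / \<epsilon> - b a0 c0 / \<epsilon>\<bar> < 1" by linarith
      then have "\<bar>b a c0 - b a0 c0\<bar> < \<epsilon>" using \<epsilon> by (simp add: field_simps flip: diff_divide_distrib)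
      with b[OF a c c0C] b[OF a0A c c0C] c0(2) show "\<bar>b a c - b a0 c\<bar> \<le> 3 * \<epsilon>" by linarith
    qed
    then show ?thesis using a0(1) e by (intro bexI[of _ a0]) (auto simp: \<epsilon>_def)
  qed
  then show "\<exists>A0\<subseteq>A. finite A0 \<and> (\<forall>a\<in>A. \<exists>a0\<in>A0. dist (S a) (S a0) < e)"
    using A0 by blast
qed

lemma norm_blinfun_le_unit_ball:
  fixes T :: "'a::real_normed_vector \<Rightarrow>\<^sub>L 'b::real_normed_vector"
  assumes "\<And>x. norm x \<le> 1 \<Longrightarrow> norm (blinfun_apply T x) \<le> d"
  shows "norm T \<le> d"
proof (rule norm_blinfun_bound)
  show "0 \<le> d" using assms[of 0] by simp
  show "norm (T x) \<le> d * norm x" for x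
  proof (cases "x = 0")
    case False
    then have "norm (T ((1 / norm x) *\<^sub>R x)) \<le> d" by (intro assms) simp
    then show ?thesis using False by (simp add: blinfun.scaleR_right field_simps)
  qed simp
qed

definition adjoint_op :: "('a::real_normed_vector \<Rightarrow>\<^sub>L 'b::real_normed_vector) \<Rightarrow> ('b \<Rightarrow>\<^sub>L real) \<Rightarrow>\<^sub>L ('a \<Rightarrow>\<^sub>L real)" where
  "adjoint_op T = Blinfun (\<lambda>\<phi>. \<phi> o\<^sub>L T)"

lemma adjoint_op_apply [simp]: "adjoint_op T \<phi> = \<phi> o\<^sub>L T"
proof -
  have "bounded_linear (\<lambda>\<phi> :: 'b \<Rightarrow>\<^sub>L real. \<phi> o\<^sub>L T)"
    by (rule bounded_linear_intro[where K = "norm T"])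
      (simp_all add: blinfun_eqI blinfun.add_left blinfun.scaleR_left norm_blinfun_compose)
  then show ?thesis by (simp add: adjoint_op_def bounded_linear_Blinfun_apply)
qed

lemma norm_adjoint_op: "norm (adjoint_op T) \<le> norm T"
  by (rule norm_blinfun_bound) (simp_all add: norm_blinfun_compose mult.commute[of "norm T"])

text \<open>Schauder's theorem, with the unit balls of the dual of the codomain and of the domain paired by
\<open>\<phi> (T x)\<close>.\<close>

lemma compact_operator_adjoint:
  fixes T :: "'a::real_normed_vector \<Rightarrow>\<^sub>L 'b::banach"
  assumes "compact_operator T"
  shows "compact_operator (adjoint_op T)"
  unfolding compact_operator_iff_totally_bounded
proof (rule totally_bounded_dual_pair[where b = "\<lambda>\<phi> x. blinfun_apply \<phi> (T x)" and T = T and B = "norm T"])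
  show "totally_bounded_image T (cball 0 1)"
    using assms by (simp add: compact_operator_iff_totally_bounded)
next
  fix \<phi> \<psi> :: "'b \<Rightarrow>\<^sub>L real" and d
  assume "\<And>c. c \<in> cball 0 1 \<Longrightarrow> \<bar>\<phi> (T c) - \<psi> (T c)\<bar> \<le> d"
  then show "dist (adjoint_op T \<phi>) (adjoint_op T \<psi>) \<le> d"
    unfolding dist_norm by (intro norm_blinfun_le_unit_ball) (simp add: blinfun.diff_left)
next
  fix \<phi> :: "'b \<Rightarrow>\<^sub>L real" and x x' assume "\<phi> \<in> cball 0 1"
  then have "\<bar>\<phi> y\<bar> \<le> norm y" for y
    using norm_blinfun[of \<phi> y] mult_right_mono[of "norm \<phi>" 1 "norm y"] by simp
  then show "\<bar>\<phi> (T x) - \<phi> (T x')\<bar> \<le> dist (T x) (T x')"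
    by (simp add: dist_norm flip: blinfun.diff_right)
next
  fix \<phi> :: "'b \<Rightarrow>\<^sub>L real" and x :: 'a assume "\<phi> \<in> cball 0 1" "x \<in> cball 0 1"
  then have "norm (\<phi> (T x)) \<le> 1 * (norm T * 1)"
    by (intro order_trans[OF norm_blinfun] mult_mono order_trans[OF norm_blinfun[of T]]) auto
  then show "\<bar>\<phi> (T x)\<bar> \<le> norm T" by simp
qed

lemma compact_operator_iff_image_subset:
  fixes T :: "'a::real_normed_vector \<Rightarrow>\<^sub>L 'b::real_normed_vector"
  shows "compact_operator T \<longleftrightarrow> (\<exists>K. compact K \<and> T ` cball 0 1 \<subseteq> K)"
proof
  assume "compact_operator T"
  then show "\<exists>K. compact K \<and> T ` cball 0 1 \<subseteq> K"
    unfolding compact_operator_def by (intro exI[of _ "closure (T ` cball 0 1)"] conjI closure_subset)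
next
  assume "\<exists>K. compact K \<and> T ` cball 0 1 \<subseteq> K"
  then obtain K where K: "compact K" "T ` cball 0 1 \<subseteq> K" by blast
  then have "closure (T ` cball 0 1) \<subseteq> K" by (intro closure_minimal compact_imp_closed)
  then have "compact (K \<inter> closure (T ` cball 0 1))" using K by (intro compact_Int_closed) auto
  with \<open>closure (T ` cball 0 1) \<subseteq> K\<close> show "compact_operator T"
    by (simp add: compact_operator_def Int_absorb1)
qed

lemma compact_operator_compose_right:
  assumes "compact_operator T"
  shows "compact_operator (T o\<^sub>L S)"
proof -
  obtain K where K: "compact K" "T ` cball 0 1 \<subseteq> K"
    using assms by (auto simp: compact_operator_iff_image_subset)
  define c where "c = norm S + 1"
  have c: "c > 0" "norm S \<le> c" by (simp_all add: c_def add_nonneg_pos)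
  have "(T o\<^sub>L S) ` cball 0 1 \<subseteq> (*\<^sub>R) c ` K"
  proof
    fix y assume "y \<in> (T o\<^sub>L S) ` cball 0 1"
    then obtain x where x: "norm x \<le> 1" "y = T (S x)" by auto
    have "norm (S x) \<le> norm S * norm x" by (rule norm_blinfun)
    also have "\<dots> \<le> c * 1" using x c by (intro mult_mono) auto
    finally have "norm (inverse c *\<^sub>R S x) \<le> 1" using c by (simp add: field_simps)
    then have "T (inverse c *\<^sub>R S x) \<in> K" using K(2) by (auto simp: image_subset_iff)
    moreover have "y = c *\<^sub>R T (inverse c *\<^sub>R S x)" using x c by (simp add: blinfun.scaleR_right)
    ultimately show "y \<in> (*\<^sub>R) c ` K" by blast
  qed
  then show ?thesis
    using compact_scaling[OF K(1)] by (auto simp: compact_operator_iff_image_subset)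
qed

lemma compact_operator_compose_left:
  assumes "compact_operator T"
  shows "compact_operator (S o\<^sub>L T)"
proof -
  obtain K where K: "compact K" "T ` cball 0 1 \<subseteq> K"
    using assms by (auto simp: compact_operator_iff_image_subset)
  have "compact (S ` K)"
    by (intro compact_continuous_image K linear_continuous_on blinfun.bounded_linear_right)
  moreover have "(S o\<^sub>L T) ` cball 0 1 \<subseteq> S ` K" using K(2) by auto
  ultimately show ?thesis by (auto simp: compact_operator_iff_image_subset)
qed

lemma compact_operator_scaleR:
  assumes "compact_operator T"
  shows "compact_operator (c *\<^sub>R T)"
proof -
  have "c *\<^sub>R T = (c *\<^sub>R id_blinfun) o\<^sub>L T" by (rule blinfun_eqI) (simp add: blinfun.scaleR_left)
  then show ?thesis using compact_operator_compose_left[OF assms] by metis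
qed

lemma compact_operator_add:
  assumes "compact_operator S" "compact_operator T"
  shows "compact_operator (S + T)"
proof -
  obtain K L where K: "compact K" "S ` cball 0 1 \<subseteq> K" and L: "compact L" "T ` cball 0 1 \<subseteq> L"
    using assms by (auto simp: compact_operator_iff_image_subset)
  have "(S + T) ` cball 0 1 \<subseteq> {x + y |x y. x \<in> K \<and> y \<in> L}"
    using K(2) L(2) by (auto simp: blinfun.add_left image_subset_iff)
  then show ?thesis using compact_sums[OF K(1) L(1)] by (auto simp: compact_operator_iff_image_subset)
qed

section \<open>Functionals on the free space\<close>

text \<open>The free space is a predual of the space of real Lipschitz functions; this is the functional that
belongs to a Lipschitz function.\<close>

lift_definition lip_functional :: "('a::real_normed_vector, real) lip0 \<Rightarrow> ('a lipfree \<Rightarrow>\<^sub>L real)"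
  is "\<lambda>f u. blinfun_apply (free_functional u) f"
proof (rule bounded_linear_intro)
  fix f :: "('a, real) lip0" and u v :: "'a lipfree" and r :: real
  show "free_functional (u + v) f = free_functional u f + free_functional v f"
    by transfer (simp add: blinfun.add_left)
  show "free_functional (r *\<^sub>R u) f = r *\<^sub>R free_functional u f"
    by transfer (simp add: blinfun.scaleR_left)
  show "norm (free_functional u f) \<le> norm u * norm f"
    by transfer (rule norm_blinfun)
qed

lemma lip_functional_delta [simp]: "lip_functional f (lip_delta x) = lip_apply f x"
  by (simp add: lip_functional.rep_eq lip_delta.rep_eq lip_eval.rep_eq)

lemma norm_lip_functional_apply: "\<bar>lip_functional f u\<bar> \<le> norm u * norm f"
  unfolding lip_functional.rep_eq norm_lipfree.rep_eq using norm_blinfun[of "free_functional u" f] by simp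

lemma norm_lip_functional: "norm (lip_functional f) \<le> norm f"
  by (rule norm_blinfun_bound) (use norm_lip_functional_apply in \<open>auto simp: mult.commute\<close>)

lemma lip_functional_add: "lip_functional (f + g) = lip_functional f + lip_functional g"
  by (rule blinfun_eqI) (simp add: lip_functional.rep_eq blinfun.add_left blinfun.add_right)

lemma lip_functional_scaleR: "lip_functional (c *\<^sub>R f) = c *\<^sub>R lip_functional f"
  by (rule blinfun_eqI) (simp add: lip_functional.rep_eq blinfun.scaleR_left blinfun.scaleR_right)

lemma norm_delta_diff: "norm (lip_delta x - lip_delta y) \<le> norm (x - y)"
proof -
  have "norm (lip_eval x - lip_eval y) \<le> norm (x - y)"
  proof (rule norm_blinfun_bound)
    fix f
    show "norm ((lip_eval x - lip_eval y) f) \<le> norm (x - y) * norm f"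
      using lip0_norm_bound[of f x y] by (simp add: blinfun.diff_left lip_eval.rep_eq mult.commute)
  qed simp
  then show ?thesis by transfer
qed

lemma delta_zero: "lip_delta (0 :: 'a::real_normed_vector) = 0"
proof -
  have "lip_eval (0::'a) = 0" by (rule blinfun_eqI) (simp add: lip_eval.rep_eq lip0_zero)
  then show ?thesis by transfer
qed

lemma functional_delta_lipschitz:
  fixes \<phi> :: "'a::real_normed_vector lipfree \<Rightarrow>\<^sub>L 'b::real_normed_vector"
  shows "norm (\<phi> (lip_delta x) - \<phi> (lip_delta y)) \<le> norm \<phi> * norm (x - y)"
proof -
  have "norm (\<phi> (lip_delta x) - \<phi> (lip_delta y)) \<le> norm \<phi> * norm (lip_delta x - lip_delta y)"
    by (simp add: norm_blinfun flip: blinfun.diff_right)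
  also have "\<dots> \<le> norm \<phi> * norm (x - y)" by (intro mult_left_mono norm_delta_diff) simp
  finally show ?thesis .
qed

lemma Abs_lip0_apply:
  assumes "f 0 = 0" "\<And>x y. norm (f x - f y) \<le> C * norm (x - y)"
  shows "lip_apply (Abs_lip0 f) = f"
proof (rule Abs_lip0_inverse)
  have "(max C 0)-lipschitz_on UNIV f"
  proof (rule lipschitz_onI)
    show "dist (f x) (f y) \<le> max C 0 * dist x y" for x y
      unfolding dist_norm using assms(2)[of x y]
      by (rule order_trans) (intro mult_right_mono, auto)
  qed simp
  then show "f \<in> {f. f 0 = 0 \<and> (\<exists>C. C-lipschitz_on UNIV f)}" using assms(1) by blast
qed

lemma norm_Abs_lip0:
  assumes "f 0 = 0" "\<And>x y. norm (f x - f y) \<le> C * norm (x - y)" "C \<ge> 0"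
  shows "norm (Abs_lip0 f) \<le> C"
  unfolding norm_lip0.rep_eq Abs_lip0_apply[OF assms(1,2)] by (rule lip_norm_least) (rule assms)+

lemma lip0_eqI: "(\<And>x. lip_apply f x = lip_apply g x) \<Longrightarrow> f = g"
  by (metis ext lip_apply_inject)

definition lip_of_linear :: "('a::real_normed_vector \<Rightarrow>\<^sub>L 'b::real_normed_vector) \<Rightarrow> ('a, 'b) lip0" where
  "lip_of_linear T = Abs_lip0 (blinfun_apply T)"

lemma lip_of_linear_apply [simp]: "lip_apply (lip_of_linear T) x = T x"
  and norm_lip_of_linear: "norm (lip_of_linear T) \<le> norm T"
proof -
  have *: "T 0 = 0" "\<And>x y. norm (T x - T y) \<le> norm T * norm (x - y)"
    by (simp_all add: norm_blinfun flip: blinfun.diff_right)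
  show "lip_apply (lip_of_linear T) x = T x" "norm (lip_of_linear T) \<le> norm T"
    unfolding lip_of_linear_def using Abs_lip0_apply[OF *] norm_Abs_lip0[OF *] by simp_all
qed

text \<open>The adjoint of the barycenter map: a functional, regarded as a Lipschitz function, acts on the free
space.\<close>

definition dual_embedding :: "('a::real_normed_vector \<Rightarrow>\<^sub>L real) \<Rightarrow>\<^sub>L ('a lipfree \<Rightarrow>\<^sub>L real)" where
  "dual_embedding = Blinfun (\<lambda>\<phi>. lip_functional (lip_of_linear \<phi>))"

lemma dual_embedding_eq: "dual_embedding \<phi> = lip_functional (lip_of_linear \<phi>)"
proof -
  have add: "lip_of_linear (\<phi> + \<psi>) = lip_of_linear \<phi> + lip_of_linear \<psi>" for \<phi> \<psi> :: "'a \<Rightarrow>\<^sub>L real"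
    by (rule lip0_eqI) (simp add: plus_lip0.rep_eq blinfun.add_left)
  have scale: "lip_of_linear (c *\<^sub>R \<phi>) = c *\<^sub>R lip_of_linear \<phi>" for \<phi> :: "'a \<Rightarrow>\<^sub>L real" and c
    by (rule lip0_eqI) (simp add: scaleR_lip0.rep_eq blinfun.scaleR_left)
  have "bounded_linear (\<lambda>\<phi> :: 'a \<Rightarrow>\<^sub>L real. lip_functional (lip_of_linear \<phi>))"
    by (rule bounded_linear_intro[where K = 1])
      (auto simp: add scale lip_functional_add lip_functional_scaleR
        intro: order_trans[OF norm_lip_functional norm_lip_of_linear])
  then show ?thesis by (simp add: dual_embedding_def bounded_linear_Blinfun_apply)
qed

lemma dual_embedding_delta [simp]: "dual_embedding \<phi> (lip_delta x) = \<phi> x"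
  by (simp add: dual_embedding_eq)

text \<open>The barycenter of \<open>u\<close> is the point that represents the functional \<open>\<phi> \<mapsto> dual_embedding \<phi> u\<close>. The
elements \<open>u\<close> that have one form a subspace containing every \<open>\<delta>\<^sub>x\<close>, and it is closed, because taking
barycenters does not increase distances and the space is complete.\<close>

lemma barycenter_exists:
  obtains \<beta> :: "'a::banach lipfree \<Rightarrow>\<^sub>L 'a" where "\<And>x. \<beta> (lip_delta x) = x"
proof -
  define R where "R u y \<longleftrightarrow> (\<forall>\<phi>. dual_embedding \<phi> u = \<phi> y)" for u and y :: 'a
  have R_lip: "norm (y - y') \<le> norm (u - u')" if "R u y" "R u' y'" for u u' and y y' :: 'a
  proof (rule norm_le_by_functionals)
    fix \<phi> :: "'a \<Rightarrow>\<^sub>L real" assume \<phi>: "norm \<phi> \<le> 1"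
    have "\<phi> (y - y') = dual_embedding \<phi> (u - u')"
      using that by (simp add: R_def blinfun.diff_right)
    also have "\<dots> \<le> norm (u - u') * norm (lip_of_linear \<phi>)"
      unfolding dual_embedding_eq using norm_lip_functional_apply by (rule abs_le_D1)
    also have "\<dots> \<le> norm (u - u') * 1"
      using order_trans[OF norm_lip_of_linear \<phi>] by (intro mult_left_mono) auto
    finally show "\<phi> (y - y') \<le> norm (u - u')" by simp
  qed
  have R_add: "R (u + u') (y + y')" if "R u y" "R u' y'" for u u' y y'
    using that by (simp add: R_def blinfun.add_right)
  have R_scale: "R (c *\<^sub>R u) (c *\<^sub>R y)" if "R u y" for c u y
    using that by (simp add: R_def blinfun.scaleR_right)
  have R_delta: "R (lip_delta x) x" for x by (simp add: R_def)
  have R_zero: "R 0 0" by (simp add: R_def)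
  have R_span: "\<exists>y. R u y" if "u \<in> span (range lip_delta)" for u
    using that by (induction rule: span_induct_alt) (use R_zero R_add R_scale R_delta in blast)+
  have "\<exists>y. R u y" for u
  proof -
    have "u \<in> closure (span (range lip_delta))" by (simp add: span_delta_dense)
    then obtain s where s: "\<And>n. s n \<in> span (range lip_delta)" "s \<longlonglongrightarrow> u"
      unfolding closure_sequential by blast
    have "\<forall>n. \<exists>y. R (s n) y" using R_span[OF s(1)] by blast
    then obtain y where y: "\<And>n. R (s n) (y n)" by metis
    have "Cauchy s" using s(2) by (simp add: LIMSEQ_imp_Cauchy)
    have "Cauchy y"
    proof (rule metric_CauchyI)
      fix e :: real assume "e > 0"
      then obtain N where "\<And>m n. m \<ge> N \<Longrightarrow> n \<ge> N \<Longrightarrow> dist (s m) (s n) < e"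
        using \<open>Cauchy s\<close> unfolding Cauchy_def by meson
      then show "\<exists>N. \<forall>m\<ge>N. \<forall>n\<ge>N. dist (y m) (y n) < e"
        using R_lip[OF y y] unfolding dist_norm by (meson order_le_less_trans)
    qed
    then obtain z where z: "y \<longlonglongrightarrow> z" using Cauchy_convergent_iff convergent_def by blast
    have "R u z"
      unfolding R_def
    proof
      fix \<phi>
      have "(\<lambda>n. dual_embedding \<phi> (s n)) \<longlonglongrightarrow> dual_embedding \<phi> u" using s(2) by (intro tendsto_intros)
      moreover have "(\<lambda>n. dual_embedding \<phi> (s n)) \<longlonglongrightarrow> \<phi> z"
        using y z unfolding R_def by (auto intro!: tendsto_intros)
      ultimately show "dual_embedding \<phi> u = \<phi> z" by (rule LIMSEQ_unique)
    qed
    then show ?thesis ..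
  qed
  then obtain b where b: "\<And>u. R u (b u)" by metis
  have uniq: "b u = y" if "R u y" for u y using R_lip[OF b[of u] that] by simp
  have "bounded_linear b"
  proof (rule bounded_linear_intro[where K = 1])
    show "b (u + v) = b u + b v" "b (r *\<^sub>R u) = r *\<^sub>R b u" for u v r
      by (rule uniq, rule R_add R_scale, (rule b)+)+
    show "norm (b u) \<le> norm u * 1" for u using R_lip[OF b R_zero, of u] by simp
  qed
  then show ?thesis
    using that[of "Blinfun b"] uniq[OF R_delta] by (simp add: bounded_linear_Blinfun_apply)
qed

lemma functional_eq_on_free_sub:
  fixes \<phi> \<psi> :: "'a::real_normed_vector lipfree \<Rightarrow>\<^sub>L 'b::real_normed_vector"
  assumes eq: "\<And>x. x \<in> M \<Longrightarrow> \<phi> (lip_delta x) = \<psi> (lip_delta x)" and u: "u \<in> free_sub M"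
  shows "\<phi> u = \<psi> u"
proof -
  have lin: "linear (blinfun_apply \<phi>)" "linear (blinfun_apply \<psi>)"
    by (rule bounded_linear.linear[OF blinfun.bounded_linear_right])+
  have "closed {v. \<phi> v = \<psi> v}"
    by (rule closed_Collect_eq) (rule linear_continuous_on[OF blinfun.bounded_linear_right])+
  moreover have "span (lip_delta ` M) \<subseteq> {v. \<phi> v = \<psi> v}"
    using linear_eq_on[OF lin, of _ "lip_delta ` M"] eq by blast
  ultimately have "closure (span (lip_delta ` M)) \<subseteq> {v. \<phi> v = \<psi> v}"
    by (rule closure_minimal[rotated])
  then show ?thesis using u unfolding free_sub_def by blast
qed

text \<open>McShane's formula: the infimum of the cones of slope \<open>C\<close> with apex on the graph of the function.\<close>

lemma mcshane_extension:
  fixes j :: "'m::real_normed_vector \<Rightarrow> 'x::real_normed_vector" and g :: "'m \<Rightarrow> real"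
  assumes j: "linear j" "\<And>x. norm (j x) = norm x"
    and g: "g 0 = 0" "\<And>x y. \<bar>g x - g y\<bar> \<le> C * norm (x - y)" and C: "C \<ge> 0"
  obtains f :: "('x, real) lip0" where "\<And>m. lip_apply f (j m) = g m" "norm f \<le> C"
proof -
  have jd: "norm (j x - j y) = norm (x - y)" for x y using j by (simp flip: linear_diff)
  define f where "f x = (INF m. g m + C * norm (x - j m))" for x
  have low: "g m' - C * norm (x - j m') \<le> g m + C * norm (x - j m)" for x m m'
  proof -
    have "norm (m' - m) \<le> norm (x - j m') + norm (x - j m)"
      unfolding jd[symmetric] using norm_triangle_ineq4[of "x - j m" "x - j m'"] by (simp add: norm_minus_commute)
    then have "C * norm (m' - m) \<le> C * (norm (x - j m') + norm (x - j m))" using C by (rule mult_left_mono)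
    then show ?thesis using g(2)[of m' m] by (simp add: algebra_simps abs_le_iff)
  qed
  have up: "f x \<le> g m + C * norm (x - j m)" for x m
    unfolding f_def by (intro cINF_lower bdd_belowI2[OF low[of 0]]) simp
  have great: "b \<le> f x" if "\<And>m. b \<le> g m + C * norm (x - j m)" for b x
    unfolding f_def by (rule cINF_greatest) (use that in auto)
  have ext: "f (j m) = g m" for m
    using up[of "j m" m] great[of "g m" "j m"] low[of m "j m"] by force
  have le: "f x - f y \<le> C * norm (x - y)" for x y
  proof -
    have "f x - C * norm (x - y) \<le> f y"
    proof (rule great)
      fix m
      have "C * norm (x - j m) \<le> C * (norm (x - y) + norm (y - j m))"
        using C norm_triangle_ineq[of "x - y" "y - j m"] by (intro mult_left_mono) auto
      then show "f x - C * norm (x - y) \<le> g m + C * norm (y - j m)"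
        using up[of x m] by (simp add: algebra_simps)
    qed
    then show ?thesis by simp
  qed
  have lip: "norm (f x - f y) \<le> C * norm (x - y)" for x y
    using le[of x y] le[of y x] by (simp add: norm_minus_commute abs_le_iff)
  have "f 0 = 0" using ext[of 0] g(1) j(1) by (simp add: linear_0)
  show ?thesis
    using that[of "Abs_lip0 f"] Abs_lip0_apply[of f C] norm_Abs_lip0[of f C] \<open>f 0 = 0\<close> lip C ext by simp
qed

section \<open>Limits of operators into a dual space\<close>

lemma blinfun_of_bilinear:
  fixes b :: "'a::real_normed_vector \<Rightarrow> 'b::real_normed_vector \<Rightarrow> real"
  assumes add_left: "\<And>x x' y. b (x + x') y = b x y + b x' y"
    and scale_left: "\<And>c x y. b (c *\<^sub>R x) y = c * b x y"
    and add_right: "\<And>x y y'. b x (y + y') = b x y + b x y'"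
    and scale_right: "\<And>c x y. b x (c *\<^sub>R y) = c * b x y"
    and bound: "\<And>x y. \<bar>b x y\<bar> \<le> C * norm x * norm y" and C: "C \<ge> 0"
  obtains B :: "'a \<Rightarrow>\<^sub>L ('b \<Rightarrow>\<^sub>L real)" where "\<And>x y. B x y = b x y" "norm B \<le> C"
proof -
  have "bounded_linear (b x)" for x
    by (rule bounded_linear_intro[where K = "C * norm x"])
      (use bound in \<open>simp_all add: add_right scale_right mult_ac\<close>)
  then have B1: "blinfun_apply (Blinfun (b x)) = b x" for x by (rule bounded_linear_Blinfun_apply)
  have n1: "norm (Blinfun (b x)) \<le> C * norm x" for x
    by (rule norm_blinfun_bound) (use bound C in \<open>simp_all add: B1\<close>)
  have "bounded_linear (\<lambda>x. Blinfun (b x))"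
    by (rule bounded_linear_intro[where K = C])
      (use n1 in \<open>simp_all add: blinfun_eqI blinfun.add_left blinfun.scaleR_left B1 add_left scale_left mult.commute\<close>)
  then have B2: "blinfun_apply (Blinfun (\<lambda>x. Blinfun (b x))) = (\<lambda>x. Blinfun (b x))"
    by (rule bounded_linear_Blinfun_apply)
  show ?thesis
  proof (rule that[of "Blinfun (\<lambda>x. Blinfun (b x))"])
    show "norm (Blinfun (\<lambda>x. Blinfun (b x))) \<le> C"
      by (rule norm_blinfun_bound) (use n1 C in \<open>simp_all add: B2\<close>)
  qed (simp add: B1 B2)
qed

lemma limit_of_bilinear_forms:
  fixes B :: "'i \<Rightarrow> 'a::real_normed_vector \<Rightarrow>\<^sub>L ('b::real_normed_vector \<Rightarrow>\<^sub>L real)"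
  assumes F: "F \<noteq> bot" and ev: "eventually (\<lambda>i. norm (B i) \<le> C) F"
    and lim: "\<And>x y. \<exists>l. ((\<lambda>i. B i x y) \<longlongrightarrow> l) F"
  obtains B0 :: "'a \<Rightarrow>\<^sub>L ('b \<Rightarrow>\<^sub>L real)" where "norm B0 \<le> C" "\<And>x y. ((\<lambda>i. B i x y) \<longlongrightarrow> B0 x y) F"
proof -
  from lim obtain b where b: "\<And>x y. ((\<lambda>i. B i x y) \<longlongrightarrow> b x y) F" by metis
  have uniq: "b x y = l" if "((\<lambda>i. B i x y) \<longlongrightarrow> l) F" for x y l
    using tendsto_unique[OF F b that] .
  obtain i where i: "norm (B i) \<le> C" using eventually_happens'[OF F ev] by blast
  then have C: "C \<ge> 0" using norm_ge_zero order_trans by blast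
  have bound: "\<bar>b x y\<bar> \<le> C * norm x * norm y" for x y
  proof (rule tendsto_le[OF F])
    show "((\<lambda>i. C * norm x * norm y) \<longlongrightarrow> C * norm x * norm y) F" by simp
    show "((\<lambda>i. \<bar>B i x y\<bar>) \<longlongrightarrow> \<bar>b x y\<bar>) F" by (intro tendsto_rabs b)
    show "eventually (\<lambda>i. \<bar>B i x y\<bar> \<le> C * norm x * norm y) F"
      using ev
    proof eventually_elim
      case (elim i)
      have "\<bar>B i x y\<bar> \<le> norm (B i x) * norm y" using norm_blinfun[of "B i x" y] by simp
      also have "\<dots> \<le> norm (B i) * norm x * norm y" by (intro mult_right_mono norm_blinfun) simp
      also have "\<dots> \<le> C * norm x * norm y" using elim by (intro mult_right_mono) auto
      finally show ?case .
    qed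
  qed
  obtain B0 :: "'a \<Rightarrow>\<^sub>L ('b \<Rightarrow>\<^sub>L real)" where "\<And>x y. B0 x y = b x y" "norm B0 \<le> C"
  proof (rule blinfun_of_bilinear[where b = b and C = C])
    show "b (x + x') y = b x y + b x' y" for x x' y
      by (rule uniq) (simp add: blinfun.add_left blinfun.add_right b tendsto_add)
    show "b (c *\<^sub>R x) y = c * b x y" for c x y
      by (rule uniq) (simp add: blinfun.scaleR_left blinfun.scaleR_right b tendsto_mult_left)
    show "b x (y + y') = b x y + b x y'" for x y y'
      by (rule uniq) (simp add: blinfun.add_right b tendsto_add)
    show "b x (c *\<^sub>R y) = c * b x y" for c x y
      by (rule uniq) (simp add: blinfun.scaleR_right b tendsto_mult_left)
  qed (use bound C in auto)
  then show ?thesis using that[of B0] b by simp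
qed

section \<open>Operators extending functionals from an ideal\<close>

text \<open>Extend the functional to the free space over \<open>X\<close> in any way, by McShane's formula, and apply the
ideal projection \<open>P\<close>. Two extensions differ by an element of the annihilator, which is the kernel of
\<open>P\<close>, so the result does not depend on the choice and is linear in the functional; and \<open>P \<phi> - \<phi>\<close>
lies in that kernel too, so the result is still an extension.\<close>

lemma ideal_extension_operator:
  fixes j :: "'m::real_normed_vector \<Rightarrow> 'x::banach"
  assumes j: "linear_isometry_onto j M" and ideal: "is_ideal (free_sub M)"
  obtains E :: "('m lipfree \<Rightarrow>\<^sub>L real) \<Rightarrow>\<^sub>L ('x lipfree \<Rightarrow>\<^sub>L real)"
    where "norm E \<le> 1" "\<And>\<psi> m. E \<psi> (lip_delta (j m)) = blinfun_apply \<psi> (lip_delta m)"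
proof -
  have jl: "linear j" "\<And>x. norm (j x) = norm x" and jM: "range j = M"
    using j by (auto simp: linear_isometry_onto_def)
  obtain P :: "('x lipfree \<Rightarrow>\<^sub>L real) \<Rightarrow>\<^sub>L ('x lipfree \<Rightarrow>\<^sub>L real)"
    where P: "P o\<^sub>L P = P" "norm P \<le> 1" "{\<phi>. P \<phi> = 0} = annihilator (free_sub M)"
    using ideal by (auto simp: is_ideal_def)
  have ann: "\<phi> \<in> annihilator (free_sub M)" if "\<And>m. \<phi> (lip_delta (j m)) = 0" for \<phi> :: "'x lipfree \<Rightarrow>\<^sub>L real"
    unfolding annihilator_def
    using functional_eq_on_free_sub[of M \<phi> 0] that jM by auto
  have P_eq: "P \<phi> = P \<psi>" if "\<And>m. \<phi> (lip_delta (j m)) = \<psi> (lip_delta (j m))" for \<phi> \<psi> :: "'x lipfree \<Rightarrow>\<^sub>L real"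
  proof -
    have "\<phi> - \<psi> \<in> {\<phi>. P \<phi> = 0}" unfolding P(3) using that by (intro ann) (simp add: blinfun.diff_left)
    then show ?thesis by (simp add: blinfun.diff_right)
  qed
  have P_delta: "P \<phi> (lip_delta (j m)) = \<phi> (lip_delta (j m))" for \<phi> :: "'x lipfree \<Rightarrow>\<^sub>L real" and m
  proof -
    have "P (P \<phi>) = P \<phi>" using arg_cong[OF P(1), of "\<lambda>T. T \<phi>"] by simp
    then have "P \<phi> - \<phi> \<in> {\<phi>. P \<phi> = 0}" by (simp add: blinfun.diff_right)
    moreover have "lip_delta (j m) \<in> free_sub M"
      unfolding free_sub_def using jM by (intro subsetD[OF closure_subset] span_base) blast
    ultimately show ?thesis unfolding P(3) annihilator_def by (auto simp: blinfun.diff_left)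
  qed
  have "\<exists>\<phi> :: 'x lipfree \<Rightarrow>\<^sub>L real. (\<forall>m. blinfun_apply \<phi> (lip_delta (j m)) = \<psi> (lip_delta m)) \<and> norm \<phi> \<le> norm \<psi>"
    for \<psi> :: "'m lipfree \<Rightarrow>\<^sub>L real"
  proof -
    have z: "\<psi> (lip_delta 0) = 0" by (simp add: delta_zero)
    have l: "\<bar>\<psi> (lip_delta x) - \<psi> (lip_delta y)\<bar> \<le> norm \<psi> * norm (x - y)" for x y
      using functional_delta_lipschitz[of \<psi> x y] by simp
    obtain f :: "('x, real) lip0" where "\<And>m. lip_apply f (j m) = \<psi> (lip_delta m)" "norm f \<le> norm \<psi>"
      using mcshane_extension[OF jl z l norm_ge_zero] by blast
    then show ?thesis
      using norm_lip_functional[of f] by (intro exI[of _ "lip_functional f"]) (auto intro: order_trans)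
  qed
  then obtain e :: "('m lipfree \<Rightarrow>\<^sub>L real) \<Rightarrow> ('x lipfree \<Rightarrow>\<^sub>L real)"
    where e: "\<And>\<psi> m. e \<psi> (lip_delta (j m)) = blinfun_apply \<psi> (lip_delta m)" "\<And>\<psi>. norm (e \<psi>) \<le> norm \<psi>" by metis
  have "bounded_linear (\<lambda>\<psi>. P (e \<psi>))"
  proof (rule bounded_linear_intro[where K = 1])
    fix \<psi> \<psi>' and c :: real
    show "P (e (\<psi> + \<psi>')) = P (e \<psi>) + P (e \<psi>')"
      unfolding blinfun.add_right[symmetric] by (rule P_eq) (simp add: e blinfun.add_left)
    show "P (e (c *\<^sub>R \<psi>)) = c *\<^sub>R P (e \<psi>)"
      unfolding blinfun.scaleR_right[symmetric] by (rule P_eq) (simp add: e blinfun.scaleR_left)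
    have "norm (P (e \<psi>)) \<le> norm P * norm (e \<psi>)" by (rule norm_blinfun)
    also have "\<dots> \<le> 1 * norm \<psi>" using P(2) e(2) by (intro mult_mono) auto
    finally show "norm (P (e \<psi>)) \<le> norm \<psi> * 1" by simp
  qed
  note E = bounded_linear_Blinfun_apply[OF this]
  show ?thesis
  proof (rule that[of "Blinfun (\<lambda>\<psi>. P (e \<psi>))"])
    show "norm (Blinfun (\<lambda>\<psi>. P (e \<psi>))) \<le> 1"
    proof (rule norm_blinfun_bound)
      fix \<psi>
      have "norm (P (e \<psi>)) \<le> norm P * norm (e \<psi>)" by (rule norm_blinfun)
      also have "\<dots> \<le> 1 * norm \<psi>" using P(2) e(2) by (intro mult_mono) auto
      finally show "norm (Blinfun (\<lambda>\<psi>. P (e \<psi>)) \<psi>) \<le> 1 * norm \<psi>" by (simp add: E)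
    qed simp
  qed (simp add: E P_delta e)
qed

text \<open>For every functional \<open>\<phi>\<close> of norm at most one, \<open>\<phi> \<circ> L\<close> belongs to the Lipschitz function \<open>\<phi> \<circ> f\<close>.\<close>

lemma norm_linearization_le:
  fixes L :: "'a::real_normed_vector lipfree \<Rightarrow>\<^sub>L 'b::real_normed_vector"
  assumes "\<And>x. L (lip_delta x) = lip_apply f x"
  shows "norm L \<le> norm f"
proof (rule norm_blinfun_bound)
  fix u
  show "norm (L u) \<le> norm f * norm u"
  proof (rule norm_le_by_functionals)
    fix \<phi> :: "'b \<Rightarrow>\<^sub>L real" assume \<phi>: "norm \<phi> \<le> 1"
    define g where "g = (\<lambda>x. \<phi> (lip_apply f x))"
    have g: "g 0 = 0" "\<And>x y. norm (g x - g y) \<le> norm f * norm (x - y)"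
    proof -
      show "g 0 = 0" by (simp add: g_def lip0_zero)
      fix x y
      have "norm (g x - g y) \<le> norm \<phi> * norm (lip_apply f x - lip_apply f y)"
        unfolding g_def blinfun.diff_right[symmetric] by (rule norm_blinfun)
      also have "\<dots> \<le> 1 * (norm f * norm (x - y))"
        using \<phi> by (intro mult_mono lip0_norm_bound) auto
      finally show "norm (g x - g y) \<le> norm f * norm (x - y)" by simp
    qed
    have "\<phi> o\<^sub>L L = lip_functional (Abs_lip0 g)"
      by (rule linearization_unique) (simp add: Abs_lip0_apply[OF g] assms, simp add: g_def)
    then have "\<phi> (L u) = lip_functional (Abs_lip0 g) u" by (metis blinfun_apply_blinfun_compose)
    also have "\<dots> \<le> norm u * norm (Abs_lip0 g)" using norm_lip_functional_apply by (rule abs_le_D1)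
    also have "\<dots> \<le> norm u * norm f" using norm_Abs_lip0[OF g] by (intro mult_left_mono) auto
    finally show "\<phi> (L u) \<le> norm f * norm u" by (simp add: mult.commute)
  qed
qed simp

section \<open>Compact approximation of the dual embedding\<close>

lemma Lip_K_BAP_approximation:
  assumes "Lip_K_BAP TYPE('m::banach)"
  obtains r where "r \<ge> 0" "\<And>(A :: 'm set) e. finite A \<Longrightarrow> e > 0 \<Longrightarrow>
    \<exists>L :: 'm lipfree \<Rightarrow>\<^sub>L 'm. compact_operator L \<and> norm L \<le> r \<and> (\<forall>x\<in>A. norm (L (lip_delta x) - x) < e)"
proof -
  obtain r where r: "r \<ge> 1" "(id :: 'm \<Rightarrow> 'm) \<in> compact_uniform_topology closure_of (lip_apply ` lip_compact_maps r)"
    using assms by (auto simp: Lip_K_BAP_def)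
  show ?thesis
  proof (rule that[of r])
    fix A :: "'m set" and e :: real assume A: "finite A" "e > 0"
    then obtain f where f: "f \<in> lip_compact_maps r" "\<forall>x\<in>A. dist (lip_apply f x) x < e"
      using r(2) finite_imp_compact[OF A(1)] unfolding in_closure_compact_uniform_topology by fastforce
    then obtain L :: "'m lipfree \<Rightarrow>\<^sub>L 'm" where L: "\<And>x. L (lip_delta x) = lip_apply f x" "compact_operator L" "norm f \<le> r"
      by (auto simp: lip_compact_maps_def)
    have "norm L \<le> r" using norm_linearization_le[of L f] L by simp
    then show "\<exists>L :: 'm lipfree \<Rightarrow>\<^sub>L 'm. compact_operator L \<and> norm L \<le> r \<and> (\<forall>x\<in>A. norm (L (lip_delta x) - x) < e)"
      using L f(2) by (auto simp: dist_norm)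
  qed (use r in simp)
qed

lemma K_BAP_approximation:
  assumes "K_BAP TYPE('q::banach)"
  obtains r where "r \<ge> 0" "\<And>(A :: 'q set) e. finite A \<Longrightarrow> e > 0 \<Longrightarrow>
    \<exists>B :: 'q \<Rightarrow>\<^sub>L 'q. compact_operator B \<and> norm B \<le> r \<and> (\<forall>x\<in>A. norm (B x - x) < e)"
proof -
  obtain r where r: "r \<ge> 1" "(id :: 'q \<Rightarrow> 'q) \<in> compact_uniform_topology closure_of (blinfun_apply ` compact_ops r)"
    using assms by (auto simp: K_BAP_def)
  show ?thesis
  proof (rule that[of r])
    fix A :: "'q set" and e :: real assume A: "finite A" "e > 0"
    then obtain B where "B \<in> compact_ops r" "\<forall>x\<in>A. dist (blinfun_apply B x) x < e"
      using r(2) finite_imp_compact[OF A(1)] unfolding in_closure_compact_uniform_topology by fastforce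
    then show "\<exists>B :: 'q \<Rightarrow>\<^sub>L 'q. compact_operator B \<and> norm B \<le> r \<and> (\<forall>x\<in>A. norm (B x - x) < e)"
      by (auto simp: compact_ops_def dist_norm)
  qed (use r in simp)
qed

lemma factor_through_quotient:
  fixes q :: "'z::real_normed_vector \<Rightarrow> 'q::real_normed_vector" and D :: "'a::real_normed_vector \<Rightarrow>\<^sub>L ('z \<Rightarrow>\<^sub>L real)"
  assumes q: "metric_quotient_map q N" and D: "\<And>\<phi> u. u \<in> N \<Longrightarrow> D \<phi> u = 0"
  obtains H :: "'a \<Rightarrow>\<^sub>L ('q \<Rightarrow>\<^sub>L real)" where "\<And>\<phi> u. blinfun_apply (blinfun_apply H \<phi>) (q u) = D \<phi> u"
proof -
  have ql: "linear q" and qs: "surj q" and ker: "{u. q u = 0} = N" and nq: "\<And>u. norm (q u) = infdist u N"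
    using q by (auto simp: metric_quotient_map_def)
  have "0 \<in> N" using ker linear_0[OF ql] by blast
  have D_eq: "D \<phi> u = D \<phi> v" if "q u = q v" for \<phi> u v
  proof -
    have "u - v \<in> N" using that ker by (auto simp: linear_diff[OF ql])
    then show ?thesis using D[of "u - v" \<phi>] by (simp add: blinfun.diff_right)
  qed
  have D_bound: "\<bar>D \<phi> u\<bar> \<le> norm D * norm \<phi> * norm (q u)" for \<phi> u
  proof (rule field_le_epsilon)
    fix e :: real assume e: "e > 0"
    define c where "c = norm D * norm \<phi>"
    have c: "c \<ge> 0" by (simp add: c_def)
    define \<delta> where "\<delta> = e / (c + 1)"
    have \<delta>: "\<delta> > 0" using e c by (simp add: \<delta>_def)
    have "\<exists>n\<in>N. dist u n < infdist u N + \<delta>"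
    proof (rule ccontr)
      assume "\<not> ?thesis"
      then have "infdist u N + \<delta> \<le> (INF n\<in>N. dist u n)"
        using \<open>0 \<in> N\<close> by (intro cINF_greatest) (auto simp: not_less)
      moreover have "infdist u N = (INF n\<in>N. dist u n)" using \<open>0 \<in> N\<close> by (intro infdist_notempty) auto
      ultimately show False using \<delta> by simp
    qed
    then obtain n where n: "n \<in> N" "norm (u - n) \<le> norm (q u) + \<delta>" by (force simp: nq dist_norm)
    have "c * \<delta> \<le> (c + 1) * \<delta>" using \<delta> by simp
    also have "(c + 1) * \<delta> = e" using c by (simp add: \<delta>_def)
    finally have c\<delta>: "c * \<delta> \<le> e" .
    have "D \<phi> u = D \<phi> (u - n)" using D[OF n(1), of \<phi>] by (simp add: blinfun.diff_right)
    also have "\<bar>\<dots>\<bar> \<le> norm (D \<phi>) * norm (u - n)" using norm_blinfun[of "D \<phi>" "u - n"] by simp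
    also have "\<dots> \<le> c * (norm (q u) + \<delta>)"
      unfolding c_def using n(2) by (intro mult_mono norm_blinfun) auto
    also have "\<dots> \<le> c * norm (q u) + e" using c\<delta> by (simp add: distrib_left)
    finally show "\<bar>D \<phi> u\<bar> \<le> norm D * norm \<phi> * norm (q u) + e" by (simp add: c_def)
  qed
  define s where "s = inv q"
  have s: "q (s y) = y" for y using qs by (simp add: s_def surj_f_inv_f)
  obtain H :: "'a \<Rightarrow>\<^sub>L ('q \<Rightarrow>\<^sub>L real)" where H: "\<And>\<phi> y. H \<phi> y = D \<phi> (s y)"
  proof (rule blinfun_of_bilinear[where b = "\<lambda>\<phi> y. D \<phi> (s y)" and C = "norm D"])
    show "D (\<phi> + \<psi>) (s y) = D \<phi> (s y) + D \<psi> (s y)" "D (c *\<^sub>R \<phi>) (s y) = c * D \<phi> (s y)" for \<phi> \<psi> c y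
      by (simp_all add: blinfun.add_left blinfun.add_right blinfun.scaleR_left blinfun.scaleR_right)
    show "D \<phi> (s (y + y')) = D \<phi> (s y) + D \<phi> (s y')" for \<phi> y y'
      unfolding blinfun.add_right[symmetric] by (rule D_eq) (simp add: s linear_add[OF ql])
    show "D \<phi> (s (c *\<^sub>R y)) = c * D \<phi> (s y)" for \<phi> c y
    proof -
      have "D \<phi> (s (c *\<^sub>R y)) = D \<phi> (c *\<^sub>R s y)" by (rule D_eq) (simp add: s linear_scale[OF ql])
      then show ?thesis by (simp add: blinfun.scaleR_right)
    qed
    show "\<bar>D \<phi> (s y)\<bar> \<le> norm D * norm \<phi> * norm y" for \<phi> y using D_bound[of \<phi> "s y"] by (simp add: s)
  qed auto
  show ?thesis
    by (rule that[of H]) (simp add: H, rule D_eq, simp add: s)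
qed

text \<open>The three-space argument. It works with operators into the dual of the free space, where bounded
nets have limits, so that the limit \<open>U0\<close> of the approximations for \<open>M\<close> exists as an operator.\<close>

lemma compact_approximation_of_dual_embedding:
  fixes j :: "'m::banach \<Rightarrow> 'x::banach" and q :: "'x lipfree \<Rightarrow> 'q::banach"
  assumes j: "linear_isometry_onto j M" and q: "metric_quotient_map q (free_sub M)"
    and ideal: "is_ideal (free_sub M)" and bapM: "Lip_K_BAP TYPE('m)" and bapQ: "K_BAP TYPE('q)"
  obtains C where "C \<ge> 0" "\<And>(A :: (('x \<Rightarrow>\<^sub>L real) \<times> 'x lipfree) set) e. finite A \<Longrightarrow> e > 0 \<Longrightarrow>
    \<exists>W :: ('x \<Rightarrow>\<^sub>L real) \<Rightarrow>\<^sub>L ('x lipfree \<Rightarrow>\<^sub>L real). compact_operator W \<and> norm W \<le> C \<and>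
      (\<forall>a\<in>A. \<bar>blinfun_apply (blinfun_apply W (fst a)) (snd a) - blinfun_apply (blinfun_apply dual_embedding (fst a)) (snd a)\<bar> < e)"
proof -
  have jl: "linear j" "\<And>x. norm (j x) = norm x" and jM: "range j = M"
    using j by (auto simp: linear_isometry_onto_def)
  have "bounded_linear j"
    by (rule bounded_linear_intro[where K = 1]) (simp_all add: jl linear_add linear_scale)
  then obtain J :: "'m \<Rightarrow>\<^sub>L 'x" where J: "\<And>x. J x = j x" using bounded_linear_Blinfun_apply by metis
  have nJ: "norm J \<le> 1" by (rule norm_blinfun_bound) (simp_all add: J jl)
  have ql: "linear q" and nq: "\<And>u. norm (q u) = infdist u (free_sub M)"
    using q by (auto simp: metric_quotient_map_def)
  have "0 \<in> free_sub M" unfolding free_sub_def by (rule subsetD[OF closure_subset span_zero])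
  then have nq': "norm (q u) \<le> norm u" for u using infdist_le[of 0 "free_sub M" u] by (simp add: nq)
  have "bounded_linear q"
    by (rule bounded_linear_intro[where K = 1]) (simp_all add: ql linear_add linear_scale nq')
  then obtain Q :: "'x lipfree \<Rightarrow>\<^sub>L 'q" where Q: "\<And>x. Q x = q x" using bounded_linear_Blinfun_apply by metis
  have nQ: "norm Q \<le> 1" by (rule norm_blinfun_bound) (simp_all add: Q nq')
  obtain E :: "('m lipfree \<Rightarrow>\<^sub>L real) \<Rightarrow>\<^sub>L ('x lipfree \<Rightarrow>\<^sub>L real)"
    where E: "norm E \<le> 1" "\<And>\<psi> m. E \<psi> (lip_delta (j m)) = \<psi> (lip_delta m)"
    using ideal_extension_operator[OF j ideal] by blast
  obtain r where r: "r \<ge> 0" "\<And>(A :: 'm set) e. finite A \<Longrightarrow> e > 0 \<Longrightarrow>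
    \<exists>L :: 'm lipfree \<Rightarrow>\<^sub>L 'm. compact_operator L \<and> norm L \<le> r \<and> (\<forall>x\<in>A. norm (L (lip_delta x) - x) < e)"
    using Lip_K_BAP_approximation[OF bapM] by blast
  obtain s where s: "s \<ge> 0" "\<And>(A :: 'q set) e. finite A \<Longrightarrow> e > 0 \<Longrightarrow>
    \<exists>B :: 'q \<Rightarrow>\<^sub>L 'q. compact_operator B \<and> norm B \<le> s \<and> (\<forall>x\<in>A. norm (B x - x) < e)"
    using K_BAP_approximation[OF bapQ] by blast

  define S where "S = {L :: 'm lipfree \<Rightarrow>\<^sub>L 'm. compact_operator L \<and> norm L \<le> r}"
  \<comment> \<open>restrict to \<open>M\<close>, apply the adjoint of \<open>L\<close>, and extend to the free space over \<open>X\<close>\<close>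
  define U where "U L = E o\<^sub>L (adjoint_op L o\<^sub>L adjoint_op J)" for L :: "'m lipfree \<Rightarrow>\<^sub>L 'm"
  have U_compact: "compact_operator (U L)" if "L \<in> S" for L
    unfolding U_def using that
    by (intro compact_operator_compose_left compact_operator_compose_right compact_operator_adjoint) (simp add: S_def)
  have U_norm: "norm (U L) \<le> r" if "L \<in> S" for L
  proof -
    have "norm (U L) \<le> norm E * (norm (adjoint_op L) * norm (adjoint_op J))"
      unfolding U_def by (intro order_trans[OF norm_blinfun_compose] mult_left_mono norm_blinfun_compose) auto
    also have "\<dots> \<le> 1 * (r * 1)"
      using E(1) that r(1) order_trans[OF norm_adjoint_op[of J] nJ] order_trans[OF norm_adjoint_op[of L], of r]
      by (intro mult_mono) (auto simp: S_def)
    finally show ?thesis by simp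
  qed
  have U_delta: "U L \<phi> (lip_delta (j m)) = \<phi> (J (L (lip_delta m)))" for L \<phi> m
    by (simp add: U_def E(2))
  have small: "\<exists>L\<in>S. \<forall>m\<in>A. \<bar>norm (L (lip_delta m) - m)\<bar> < e" if "finite A" "e > 0" for A e
    using r(2)[OF that] by (auto simp: S_def)
  obtain F where F: "F \<noteq> bot" "F \<le> principal S" and Fd: "\<And>m. ((\<lambda>L. norm (blinfun_apply L (lip_delta m) - m)) \<longlongrightarrow> 0) F"
    and conv: "\<And>h :: ('m lipfree \<Rightarrow>\<^sub>L 'm) \<Rightarrow> real. bounded (h ` S) \<Longrightarrow> \<exists>l. (h \<longlongrightarrow> l) F"
    using net_along_finite_sets[of S "\<lambda>L m. norm (blinfun_apply L (lip_delta m) - m)", OF small] by blast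
  have FS: "eventually (\<lambda>L. L \<in> S) F" using F(2) by (simp add: le_principal)
  have "eventually (\<lambda>L. norm (U L) \<le> r) F" using FS by eventually_elim (rule U_norm)
  moreover have "\<exists>l. ((\<lambda>L. U L \<phi> u) \<longlongrightarrow> l) F" for \<phi> u
  proof (rule conv)
    have "norm (U L \<phi> u) \<le> r * norm \<phi> * norm u" if "L \<in> S" for L
    proof -
      have "norm (U L \<phi> u) \<le> norm (U L) * norm \<phi> * norm u"
        by (intro order_trans[OF norm_blinfun] mult_right_mono norm_blinfun) auto
      also have "\<dots> \<le> r * norm \<phi> * norm u" by (intro mult_right_mono U_norm that) auto
      finally show ?thesis .
    qed
    then show "bounded ((\<lambda>L. U L \<phi> u) ` S)" unfolding bounded_iff by blast
  qed
  ultimately obtain U0 :: "('x \<Rightarrow>\<^sub>L real) \<Rightarrow>\<^sub>L ('x lipfree \<Rightarrow>\<^sub>L real)"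
    where U0: "\<And>\<phi> u. ((\<lambda>L. U L \<phi> u) \<longlongrightarrow> U0 \<phi> u) F"
    using limit_of_bilinear_forms[OF F(1), of U r] by blast
  have U0_delta: "U0 \<phi> (lip_delta (j m)) = \<phi> (j m)" for \<phi> m
  proof -
    have "((\<lambda>L. blinfun_apply L (lip_delta m)) \<longlongrightarrow> m) F" using Fd[of m] by (simp add: tendsto_norm_zero_iff LIM_zero_iff)
    then have "((\<lambda>L. \<phi> (J (blinfun_apply L (lip_delta m)))) \<longlongrightarrow> \<phi> (J m)) F" by (intro tendsto_intros)
    then show ?thesis using tendsto_unique[OF F(1) U0[of \<phi> "lip_delta (j m)"]] by (simp add: U_delta J)
  qed
  \<comment> \<open>on \<open>free_sub M\<close> nothing is left, so the rest is carried by the quotient\<close>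
  have D: "(dual_embedding - U0) \<phi> u = 0" if "u \<in> free_sub M" for \<phi> u
  proof -
    have "(dual_embedding - U0) \<phi> u = blinfun_apply 0 u"
      by (rule functional_eq_on_free_sub[OF _ that]) (auto simp: blinfun.diff_left U0_delta jM[symmetric])
    then show ?thesis by simp
  qed
  obtain H :: "('x \<Rightarrow>\<^sub>L real) \<Rightarrow>\<^sub>L ('q \<Rightarrow>\<^sub>L real)" where H: "\<And>\<phi> u. H \<phi> (q u) = (dual_embedding - U0) \<phi> u"
    using factor_through_quotient[OF q D] by blast

  show ?thesis
  proof (rule that[of "r + s * norm H"])
    show "r + s * norm H \<ge> 0" using r(1) s(1) by simp
    fix A :: "(('x \<Rightarrow>\<^sub>L real) \<times> 'x lipfree) set" and e :: real assume A: "finite A" and e: "e > 0"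
    have "eventually (\<lambda>L. \<forall>a\<in>A. \<bar>U L (fst a) (snd a) - U0 (fst a) (snd a)\<bar> < e / 2) F"
    proof (rule eventually_ball_finite[OF A], rule ballI)
      fix a assume "a \<in> A"
      show "eventually (\<lambda>L. \<bar>U L (fst a) (snd a) - U0 (fst a) (snd a)\<bar> < e / 2) F"
        using tendstoD[OF U0[of "fst a" "snd a"], of "e / 2"] e by (simp add: dist_real_def)
    qed
    with FS have "eventually (\<lambda>L. L \<in> S \<and> (\<forall>a\<in>A. \<bar>U L (fst a) (snd a) - U0 (fst a) (snd a)\<bar> < e / 2)) F"
      by (rule eventually_conj)
    then obtain L where L: "L \<in> S" "\<And>a. a \<in> A \<Longrightarrow> \<bar>U L (fst a) (snd a) - U0 (fst a) (snd a)\<bar> < e / 2"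
      using eventually_happens'[OF F(1)] by blast
    \<comment> \<open>a positive bound for all \<open>norm (H \<phi>)\<close> in question\<close>
    define c where "c = (\<Sum>a\<in>A. norm (H (fst a))) + 1"
    have c: "c > 0" "\<And>a. a \<in> A \<Longrightarrow> norm (H (fst a)) \<le> c"
      unfolding c_def using sum_nonneg[of A "\<lambda>a. norm (H (fst a))"] member_le_sum[OF _ _ A, of _ "\<lambda>a. norm (H (fst a))"]
      by (auto intro: add_increasing2 simp: add_nonneg_pos)
    obtain B :: "'q \<Rightarrow>\<^sub>L 'q" where B: "compact_operator B" "norm B \<le> s"
        "\<And>a. a \<in> A \<Longrightarrow> norm (B (q (snd a)) - q (snd a)) < e / (2 * c)"
      using s(2)[of "(\<lambda>a. q (snd a)) ` A" "e / (2 * c)"] A e c(1) by auto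
    define V where "V = adjoint_op Q o\<^sub>L (adjoint_op B o\<^sub>L H)"
    have "norm V \<le> norm (adjoint_op Q) * (norm (adjoint_op B) * norm H)"
      unfolding V_def by (intro order_trans[OF norm_blinfun_compose] mult_left_mono norm_blinfun_compose) auto
    also have "\<dots> \<le> 1 * (s * norm H)"
      using order_trans[OF norm_adjoint_op[of Q] nQ] order_trans[OF norm_adjoint_op[of B] B(2)] s(1)
      by (intro mult_mono) auto
    finally have nV: "norm V \<le> s * norm H" by simp
    have V: "\<bar>V (fst a) (snd a) - (dual_embedding - U0) (fst a) (snd a)\<bar> < e / 2" if "a \<in> A" for a
    proof -
      have "V (fst a) (snd a) - (dual_embedding - U0) (fst a) (snd a) = H (fst a) (B (q (snd a)) - q (snd a))"
        unfolding H[symmetric] by (simp add: V_def Q blinfun.diff_right)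
      also have "\<bar>\<dots>\<bar> \<le> c * norm (B (q (snd a)) - q (snd a))"
        using norm_blinfun[of "H (fst a)" "B (q (snd a)) - q (snd a)"]
          mult_right_mono[OF c(2)[OF that], of "norm (B (q (snd a)) - q (snd a))"] by simp
      also have "\<dots> < c * (e / (2 * c))" using B(3)[OF that] c(1) by (intro mult_strict_left_mono)
      also have "\<dots> = e / 2" using c(1) by simp
      finally show ?thesis .
    qed
    show "\<exists>W :: ('x \<Rightarrow>\<^sub>L real) \<Rightarrow>\<^sub>L ('x lipfree \<Rightarrow>\<^sub>L real). compact_operator W \<and> norm W \<le> r + s * norm H \<and>
      (\<forall>a\<in>A. \<bar>blinfun_apply (blinfun_apply W (fst a)) (snd a) - blinfun_apply (blinfun_apply dual_embedding (fst a)) (snd a)\<bar> < e)"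
    proof (intro exI conjI ballI)
      show "compact_operator (U L + V)"
        unfolding V_def using L(1) B(1)
        by (intro compact_operator_add U_compact compact_operator_compose_left compact_operator_compose_right
            compact_operator_adjoint)
      show "norm (U L + V) \<le> r + s * norm H"
        using norm_triangle_ineq[of "U L" V] U_norm[OF L(1)] nV by linarith
      fix a assume a: "a \<in> A"
      have "(U L + V) (fst a) (snd a) - dual_embedding (fst a) (snd a)
        = (U L (fst a) (snd a) - U0 (fst a) (snd a)) + (V (fst a) (snd a) - (dual_embedding - U0) (fst a) (snd a))"
        by (simp add: blinfun.add_left blinfun.diff_left)
      then show "\<bar>(U L + V) (fst a) (snd a) - dual_embedding (fst a) (snd a)\<bar> < e"
        using L(2)[OF a] V[OF a] by linarith
    qed
  qed
qed

section \<open>A norm-one lifting of the free space by averaging\<close>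

text \<open>The average of \<open>g\<close> over the points \<open>x + t\<^sub>1 y\<^sub>1 + \<dots> + t\<^sub>n y\<^sub>n\<close>, where \<open>y\<^sub>1, \<dots>, y\<^sub>n\<close> are the entries of
the list and every \<open>t\<^sub>i\<close> runs through \<open>{0..<R}\<close>. A list is used because the directions may be
linearly dependent or repeated.\<close>

fun grid_mean :: "nat \<Rightarrow> 'a::real_vector list \<Rightarrow> ('a \<Rightarrow> real) \<Rightarrow> 'a \<Rightarrow> real" where
  "grid_mean R [] g x = g x"
| "grid_mean R (y # L) g x = (\<Sum>t<R. grid_mean R L g (x + real t *\<^sub>R y)) / real R"

text \<open>All points \<open>t\<^sub>1 y\<^sub>1 + \<dots> + t\<^sub>n y\<^sub>n\<close> with \<open>0 \<le> t\<^sub>i \<le> c\<close>, a compact set that contains the grid.\<close>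

fun zonotope :: "real \<Rightarrow> 'a::real_vector list \<Rightarrow> 'a set" where
  "zonotope c [] = {0}"
| "zonotope c (y # L) = (\<lambda>(t, z). t *\<^sub>R y + z) ` ({0..c} \<times> zonotope c L)"

lemma compact_zonotope: "compact (zonotope c (L :: 'a::real_normed_vector list))"
proof (induction L)
  case (Cons y L)
  then show ?case
    by (auto intro!: compact_continuous_image compact_Times continuous_intros simp: case_prod_unfold)
qed simp

lemma zonotope_scale:
  assumes "c > 0"
  shows "zonotope c (map (\<lambda>y. y /\<^sub>R c) L) = zonotope 1 L"
proof (induction L)
  case (Cons y L)
  have eq: "{0..c} = (\<lambda>t. c * t) ` {0..1::real}"
    using assms by (auto simp: image_iff field_simps intro!: bexI[where x = "_ / c"])
  have "zonotope c (map (\<lambda>y. y /\<^sub>R c) (y # L))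
      = (\<lambda>(t, z). t *\<^sub>R (y /\<^sub>R c) + z) ` (((\<lambda>t. c * t) ` {0..1}) \<times> zonotope 1 L)"
    by (simp add: Cons.IH eq[symmetric])
  also have "\<dots> = (\<lambda>(t, z). t *\<^sub>R y + z) ` ({0..1} \<times> zonotope 1 L)"
  proof -
    have "((\<lambda>t. c * t) ` {0..1}) \<times> zonotope 1 L = (\<lambda>(t, z). (c * t, z)) ` ({0..1} \<times> zonotope 1 L)"
      by force
    moreover have cancel: "c * s * inverse c = s" for s using assms by simp
    ultimately show ?thesis by (simp only: image_image case_prod_unfold fst_conv snd_conv scaleR_scaleR cancel)
  qed
  finally show ?case by simp
qed simp

lemma average_bound:
  fixes f :: "nat \<Rightarrow> real"
  assumes "R > 0" "\<And>t. t < R \<Longrightarrow> \<bar>f t\<bar> \<le> B"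
  shows "\<bar>(\<Sum>t<R. f t) / real R\<bar> \<le> B"
proof -
  have "\<bar>\<Sum>t<R. f t\<bar> \<le> real R * B"
    using order_trans[OF sum_abs sum_bounded_above[of "{..<R}" "\<lambda>t. \<bar>f t\<bar>" B]] assms(2) by simp
  then show ?thesis using assms(1) by (simp add: field_simps)
qed

lemma grid_mean_add: "grid_mean R L (\<lambda>x. g x + h x) x = grid_mean R L g x + grid_mean R L h x"
  by (induction L arbitrary: x) (simp_all add: sum.distrib add_divide_distrib)

lemma grid_mean_scale: "grid_mean R L (\<lambda>x. c * g x) x = c * grid_mean R L g x"
  by (induction L arbitrary: x) (simp_all add: sum_distrib_left)

lemma grid_mean_shift:
  assumes "R > 0" "\<And>x. g (x + v) - g x = c"
  shows "grid_mean R L g (x + v) - grid_mean R L g x = c"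
proof (induction L arbitrary: x)
  case (Cons y L)
  have "grid_mean R L g (x + v + real t *\<^sub>R y) - grid_mean R L g (x + real t *\<^sub>R y) = c" for t
    using Cons.IH[of "x + real t *\<^sub>R y"] by (simp add: add_ac)
  then show ?case using assms(1) by (simp flip: diff_divide_distrib sum_subtractf)
qed (simp add: assms)

lemma grid_mean_lipschitz:
  fixes g :: "'a::real_normed_vector \<Rightarrow> real"
  assumes "R > 0" "\<And>x y. \<bar>g x - g y\<bar> \<le> C * norm (x - y)"
  shows "\<bar>grid_mean R L g x - grid_mean R L g x'\<bar> \<le> C * norm (x - x')"
proof (induction L arbitrary: x x')
  case (Cons y L)
  have "\<bar>grid_mean R L g (x + real t *\<^sub>R y) - grid_mean R L g (x' + real t *\<^sub>R y)\<bar> \<le> C * norm (x - x')" for t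
    using Cons.IH[of "x + real t *\<^sub>R y" "x' + real t *\<^sub>R y"] by simp
  then show ?case using average_bound[OF assms(1)] by (simp flip: diff_divide_distrib sum_subtractf)
qed (simp add: assms)

lemma grid_mean_bound:
  assumes "R > 0" "\<And>z. z \<in> zonotope (real R) L \<Longrightarrow> \<bar>h (x + z)\<bar> \<le> \<epsilon>"
  shows "\<bar>grid_mean R L h x\<bar> \<le> \<epsilon>"
  using assms(2)
proof (induction L arbitrary: x)
  case (Cons y L)
  have "\<bar>grid_mean R L h (x + real t *\<^sub>R y)\<bar> \<le> \<epsilon>" if "t < R" for t
  proof (rule Cons.IH)
    fix z assume "z \<in> zonotope (real R) L"
    then have "real t *\<^sub>R y + z \<in> zonotope (real R) (y # L)" using that by force
    then show "\<bar>h (x + real t *\<^sub>R y + z)\<bar> \<le> \<epsilon>" using Cons.prems by (simp only: add.assoc)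
  qed
  then show ?case using average_bound[OF assms(1)] by simp
qed simp

lemma grid_mean_telescope:
  "grid_mean R (y # L) g (x + y) - grid_mean R (y # L) g x
     = (grid_mean R L g (x + real R *\<^sub>R y) - grid_mean R L g x) / real R"
proof -
  have "(\<Sum>t<R. grid_mean R L g (x + y + real t *\<^sub>R y)) - (\<Sum>t<R. grid_mean R L g (x + real t *\<^sub>R y))
      = (\<Sum>t<R. grid_mean R L g (x + real (Suc t) *\<^sub>R y) - grid_mean R L g (x + real t *\<^sub>R y))"
    by (simp add: sum_subtractf scaleR_left_distrib add_ac)
  also have "\<dots> = grid_mean R L g (x + real R *\<^sub>R y) - grid_mean R L g x"
    using sum_lessThan_telescope[of "\<lambda>t. grid_mean R L g (x + real t *\<^sub>R y)" R] by simp
  finally show ?thesis by (simp flip: diff_divide_distrib)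
qed

text \<open>Averaging in the direction \<open>y\<close> makes the increment by \<open>y\<close> telescope to the increment by \<open>R y\<close>
divided by \<open>R\<close>. Moving the base point by \<open>e\<close> changes both end terms by at most \<open>C * norm e\<close>, so the
increment by \<open>y\<close> becomes nearly independent of the base point.\<close>

lemma grid_mean_almost_additive:
  fixes g :: "'a::real_normed_vector \<Rightarrow> real"
  assumes R: "R > 0" and g: "\<And>x y. \<bar>g x - g y\<bar> \<le> C * norm (x - y)" and y: "y \<in> set L"
  shows "\<bar>(grid_mean R L g (x + e + y) - grid_mean R L g (x + e))
    - (grid_mean R L g (x + y) - grid_mean R L g x)\<bar> \<le> 2 * C * norm e / real R"
  using y
proof (induction L arbitrary: x)
  case (Cons y' L)
  show ?case
  proof (cases "y' = y")
    case True
    have "\<bar>grid_mean R L g (x + e + real R *\<^sub>R y) - grid_mean R L g (x + real R *\<^sub>R y)\<bar> \<le> C * norm e"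
      "\<bar>grid_mean R L g (x + e) - grid_mean R L g x\<bar> \<le> C * norm e"
      using grid_mean_lipschitz[OF R g, of L "x + e + real R *\<^sub>R y" "x + real R *\<^sub>R y"]
        grid_mean_lipschitz[OF R g, of L "x + e" x] by simp_all
    then have "\<bar>(grid_mean R L g (x + e + real R *\<^sub>R y) - grid_mean R L g (x + e))
        - (grid_mean R L g (x + real R *\<^sub>R y) - grid_mean R L g x)\<bar> \<le> 2 * C * norm e" by linarith
    then show ?thesis
      unfolding True grid_mean_telescope using R
      by (simp only: diff_divide_distrib[symmetric] abs_divide) (simp add: divide_right_mono)
  next
    case False
    then have "y \<in> set L" using Cons.prems by simp
    from Cons.IH[OF this]
    have IH: "\<bar>(grid_mean R L g (x + real t *\<^sub>R y' + e + y) - grid_mean R L g (x + real t *\<^sub>R y' + e))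
      - (grid_mean R L g (x + real t *\<^sub>R y' + y) - grid_mean R L g (x + real t *\<^sub>R y'))\<bar> \<le> 2 * C * norm e / real R" for t .
    have "\<bar>(\<Sum>t<R. (grid_mean R L g (x + real t *\<^sub>R y' + e + y) - grid_mean R L g (x + real t *\<^sub>R y' + e))
      - (grid_mean R L g (x + real t *\<^sub>R y' + y) - grid_mean R L g (x + real t *\<^sub>R y'))) / real R\<bar>
      \<le> 2 * C * norm e / real R" by (rule average_bound[OF R IH])
    then show ?thesis by (simp add: sum_subtractf diff_divide_distrib add_ac)
  qed
qed simp

text \<open>The same telescoping: the two end terms are averages over the zonotope, and only they remain.\<close>

lemma grid_mean_increment_bound:
  assumes R: "R > 0" and h: "\<And>z. z \<in> zonotope (real R) L \<Longrightarrow> \<bar>h (x + z)\<bar> \<le> \<epsilon>" and y: "y \<in> set L"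
  shows "\<bar>grid_mean R L h (x + y) - grid_mean R L h x\<bar> \<le> 2 * \<epsilon> / real R"
  using y h
proof (induction L arbitrary: x)
  case (Cons y' L)
  have h': "\<bar>h (x + t *\<^sub>R y' + z)\<bar> \<le> \<epsilon>" if "0 \<le> t" "t \<le> real R" "z \<in> zonotope (real R) L" for t z
  proof -
    have "t *\<^sub>R y' + z \<in> zonotope (real R) (y' # L)" using that by force
    then show ?thesis using Cons.prems(2) by (simp only: add.assoc)
  qed
  show ?case
  proof (cases "y' = y")
    case True
    have "\<bar>grid_mean R L h (x + real R *\<^sub>R y)\<bar> \<le> \<epsilon>"
      using h'[of "real R"] True by (intro grid_mean_bound[OF R]) simp
    moreover have "\<bar>grid_mean R L h x\<bar> \<le> \<epsilon>" using h'[of 0] by (intro grid_mean_bound[OF R]) simp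
    ultimately have "\<bar>grid_mean R L h (x + real R *\<^sub>R y) - grid_mean R L h x\<bar> \<le> 2 * \<epsilon>" by linarith
    then show ?thesis
      unfolding True grid_mean_telescope using R by (simp add: abs_divide divide_right_mono)
  next
    case False
    then have yL: "y \<in> set L" using Cons.prems by simp
    have IH: "\<bar>grid_mean R L h (x + real t *\<^sub>R y' + y) - grid_mean R L h (x + real t *\<^sub>R y')\<bar> \<le> 2 * \<epsilon> / real R"
      if "t < R" for t
      using that by (intro Cons.IH[OF yL] h') auto
    have "\<bar>(\<Sum>t<R. grid_mean R L h (x + real t *\<^sub>R y' + y) - grid_mean R L h (x + real t *\<^sub>R y')) / real R\<bar>
      \<le> 2 * \<epsilon> / real R" by (rule average_bound[OF R IH])
    then show ?thesis by (simp add: sum_subtractf diff_divide_distrib add_ac)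
  qed
qed simp

lemma additive_bounded_imp_homogeneous:
  fixes f :: "'a::real_normed_vector \<Rightarrow> real"
  assumes add: "\<And>x y. f (x + y) = f x + f y" and bound: "\<And>x. \<bar>f x\<bar> \<le> C * norm x"
  shows "f (c *\<^sub>R x) = c * f x"
proof -
  have nat: "f (real n *\<^sub>R x) = real n * f x" for n x
    using bound[of 0] by (induction n) (simp_all add: add scaleR_left_distrib distrib_right)
  have C: "0 \<le> C * norm x" using bound[of x] by linarith
  have neg: "f (- x) = - f x" for x using add[of x "- x"] bound[of 0] by simp
  have int: "f (of_int k *\<^sub>R x) = of_int k * f x" for k x
  proof (cases "k \<ge> 0")
    case True
    then show ?thesis using nat[of "nat k" x] by simp
  next
    case False
    then show ?thesis using nat[of "nat (- k)" x] neg[of "of_int k *\<^sub>R x"] by simp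
  qed
  \<comment> \<open>the defect is additive in the scalar and vanishes on the integers, so it is bounded\<close>
  define h where "h s = f (s *\<^sub>R x) - s * f x" for s :: real
  have h_add: "h (s + t) = h s + h t" for s t by (simp add: h_def scaleR_left_distrib add algebra_simps)
  have h_bound: "\<bar>h s\<bar> \<le> 2 * (C * norm x)" for s
  proof -
    have "h s = h (of_int \<lfloor>s\<rfloor>) + h (frac s)" using h_add[of "of_int \<lfloor>s\<rfloor>" "frac s"] by (simp add: frac_def)
    then have "h s = h (frac s)" using int by (simp add: h_def)
    moreover have fr: "0 \<le> frac s" "frac s \<le> 1" using frac_lt_1[of s] by auto
    then have "frac s * (C * norm x) \<le> C * norm x" "frac s * \<bar>f x\<bar> \<le> \<bar>f x\<bar>"
      using C by (auto intro: mult_left_le_one_le)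
    moreover have "\<bar>f (frac s *\<^sub>R x)\<bar> \<le> frac s * (C * norm x)" using bound[of "frac s *\<^sub>R x"] fr by (simp add: mult_ac)
    moreover have "\<bar>frac s * f x\<bar> = frac s * \<bar>f x\<bar>" using fr by (simp add: abs_mult)
    ultimately show ?thesis using bound[of x] unfolding h_def by linarith
  qed
  have h_nat: "h (real n * c) = real n * h c" for n
    using h_add[of 0 0] by (induction n) (simp_all add: distrib_right h_add)
  have "h c = 0"
  proof (rule ccontr)
    assume "h c \<noteq> 0"
    then obtain n where "2 * (C * norm x) < real n * \<bar>h c\<bar>"
      using reals_Archimedean3[of "\<bar>h c\<bar>"] by auto
    then show False using h_bound[of "real n * c"] by (simp add: h_nat abs_mult)
  qed
  then show ?thesis by (simp add: h_def)
qed

text \<open>A linearization in the directions of \<open>L\<close> only. Averaging difference quotients of step \<open>1 / N\<close> over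
a grid of the same step makes them additive in these directions up to \<open>O (1 / N)\<close>; all evaluation
points for the increments in the directions of \<open>L\<close> stay in one fixed zonotope, because there are
\<open>N\<close> steps per direction. The limit \<open>D \<phi>\<close> is Lipschitz on the whole space, additive with respect to
\<open>L\<close>, and controlled there by \<open>\<phi>\<close> on the zonotope.\<close>

lemma derivative_limit:
  fixes L :: "'a::real_normed_vector list"
  obtains D :: "('a lipfree \<Rightarrow>\<^sub>L real) \<Rightarrow> 'a \<Rightarrow> real" where
    "\<And>\<phi> \<psi> x. D (\<phi> + \<psi>) x = D \<phi> x + D \<psi> x" "\<And>c \<phi> x. D (c *\<^sub>R \<phi>) x = c * D \<phi> x"
    "\<And>\<phi> x y. \<bar>D \<phi> x - D \<phi> y\<bar> \<le> norm \<phi> * norm (x - y)"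
    "\<And>\<phi> x y. y \<in> set L \<Longrightarrow> D \<phi> (x + y) - D \<phi> x = D \<phi> y"
    "\<And>\<phi> \<psi> \<epsilon> y. y \<in> set L \<Longrightarrow> (\<And>z. z \<in> zonotope 1 L \<Longrightarrow> \<bar>blinfun_apply \<phi> (lip_delta z) - blinfun_apply \<psi> z\<bar> \<le> \<epsilon>) \<Longrightarrow>
      \<bar>D \<phi> y - blinfun_apply \<psi> y\<bar> \<le> 2 * \<epsilon>"
proof -
  define \<Delta> where "\<Delta> N \<phi> x = real N * (grid_mean N (map (\<lambda>y. y /\<^sub>R real N) L) (\<lambda>z. blinfun_apply \<phi> (lip_delta z)) (x /\<^sub>R real N)
      - grid_mean N (map (\<lambda>y. y /\<^sub>R real N) L) (\<lambda>z. blinfun_apply \<phi> (lip_delta z)) 0)"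
    for N and \<phi> :: "'a lipfree \<Rightarrow>\<^sub>L real" and x
  have \<phi>_lip: "\<bar>\<phi> (lip_delta x) - \<phi> (lip_delta y)\<bar> \<le> norm \<phi> * norm (x - y)" for \<phi> :: "'a lipfree \<Rightarrow>\<^sub>L real" and x y
    using functional_delta_lipschitz[of \<phi> x y] by simp
  have \<Delta>_add: "\<Delta> N (\<phi> + \<psi>) x = \<Delta> N \<phi> x + \<Delta> N \<psi> x" for N \<phi> \<psi> x
    by (simp add: \<Delta>_def blinfun.add_left grid_mean_add algebra_simps)
  have \<Delta>_scale: "\<Delta> N (c *\<^sub>R \<phi>) x = c * \<Delta> N \<phi> x" for N \<phi> c x
    by (simp add: \<Delta>_def blinfun.scaleR_left grid_mean_scale algebra_simps)
  have \<Delta>_lip: "\<bar>\<Delta> N \<phi> x - \<Delta> N \<phi> y\<bar> \<le> norm \<phi> * norm (x - y)" for N \<phi> x y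
  proof (cases "N = 0")
    case False
    then have N: "N > 0" by simp
    have "\<Delta> N \<phi> x - \<Delta> N \<phi> y = real N * (grid_mean N (map (\<lambda>y. y /\<^sub>R real N) L) (\<lambda>z. \<phi> (lip_delta z)) (x /\<^sub>R real N)
      - grid_mean N (map (\<lambda>y. y /\<^sub>R real N) L) (\<lambda>z. \<phi> (lip_delta z)) (y /\<^sub>R real N))"
      by (simp add: \<Delta>_def right_diff_distrib)
    also have "\<bar>\<dots>\<bar> \<le> real N * (norm \<phi> * norm (x /\<^sub>R real N - y /\<^sub>R real N))"
      unfolding abs_mult using grid_mean_lipschitz[OF N \<phi>_lip] by (simp add: mult_left_mono)
    also have "x /\<^sub>R real N - y /\<^sub>R real N = (x - y) /\<^sub>R real N" by (simp add: scaleR_diff_right)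
    also have "real N * (norm \<phi> * norm ((x - y) /\<^sub>R real N)) = norm \<phi> * norm (x - y)"
      using N by simp
    finally show ?thesis .
  qed (simp add: \<Delta>_def)
  have \<Delta>_zero: "\<Delta> N \<phi> 0 = 0" for N \<phi> by (simp add: \<Delta>_def)
  have \<Delta>_additive: "\<bar>(\<Delta> N \<phi> (x + y) - \<Delta> N \<phi> x) - \<Delta> N \<phi> y\<bar> \<le> 2 * norm \<phi> * norm x / real N"
    if y: "y \<in> set L" and N: "N > 0" for N \<phi> x y
  proof -
    define G where "G = grid_mean N (map (\<lambda>y. y /\<^sub>R real N) L) (\<lambda>z. \<phi> (lip_delta z))"
    have "y /\<^sub>R real N \<in> set (map (\<lambda>y. y /\<^sub>R real N) L)" using y by auto
    from grid_mean_almost_additive[OF N \<phi>_lip this, of \<phi> 0 "x /\<^sub>R real N"]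
    have "\<bar>(G (x /\<^sub>R real N + y /\<^sub>R real N) - G (x /\<^sub>R real N)) - (G (y /\<^sub>R real N) - G 0)\<bar>
      \<le> 2 * norm \<phi> * norm (x /\<^sub>R real N) / real N" by (simp add: G_def)
    then have "real N * \<bar>(G (x /\<^sub>R real N + y /\<^sub>R real N) - G (x /\<^sub>R real N)) - (G (y /\<^sub>R real N) - G 0)\<bar>
      \<le> real N * (2 * norm \<phi> * norm (x /\<^sub>R real N) / real N)" by (intro mult_left_mono) simp_all
    also have "real N * (2 * norm \<phi> * norm (x /\<^sub>R real N) / real N) = 2 * norm \<phi> * norm x / real N"
      using N by (simp add: field_simps)
    also have "real N * \<bar>(G (x /\<^sub>R real N + y /\<^sub>R real N) - G (x /\<^sub>R real N)) - (G (y /\<^sub>R real N) - G 0)\<bar>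
      = \<bar>real N * ((G (x /\<^sub>R real N + y /\<^sub>R real N) - G (x /\<^sub>R real N)) - (G (y /\<^sub>R real N) - G 0))\<bar>"
      by (simp add: abs_mult)
    also have "real N * ((G (x /\<^sub>R real N + y /\<^sub>R real N) - G (x /\<^sub>R real N)) - (G (y /\<^sub>R real N) - G 0))
      = (\<Delta> N \<phi> (x + y) - \<Delta> N \<phi> x) - \<Delta> N \<phi> y"
      unfolding \<Delta>_def G_def[symmetric] by (simp add: scaleR_add_right algebra_simps)
    finally show ?thesis .
  qed
  have \<Delta>_close: "\<bar>\<Delta> N \<phi> y - \<psi> y\<bar> \<le> 2 * \<epsilon>"
    if y: "y \<in> set L" and N: "N > 0" and close: "\<And>z. z \<in> zonotope 1 L \<Longrightarrow> \<bar>\<phi> (lip_delta z) - \<psi> z\<bar> \<le> \<epsilon>"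
    for N y \<epsilon> and \<phi> :: "'a lipfree \<Rightarrow>\<^sub>L real" and \<psi> :: "'a \<Rightarrow>\<^sub>L real"
  proof -
    define L' where "L' = map (\<lambda>y. y /\<^sub>R real N) L"
    define g where "g = (\<lambda>z. \<phi> (lip_delta z))"
    define h where "h = (\<lambda>z. g z + (- 1) * \<psi> z)"
    have y': "y /\<^sub>R real N \<in> set L'" using y by (auto simp: L'_def)
    have "zonotope (real N) L' = zonotope 1 L" unfolding L'_def using N by (intro zonotope_scale) simp
    then have "\<bar>grid_mean N L' h (0 + y /\<^sub>R real N) - grid_mean N L' h 0\<bar> \<le> 2 * \<epsilon> / real N"
      using close by (intro grid_mean_increment_bound[OF N _ y']) (simp add: h_def g_def)
    moreover have "grid_mean N L' \<psi> (0 + y /\<^sub>R real N) - grid_mean N L' \<psi> 0 = \<psi> (y /\<^sub>R real N)"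
      by (rule grid_mean_shift[OF N]) (simp add: blinfun.add_right)
    moreover have "grid_mean N L' h x = grid_mean N L' g x - grid_mean N L' \<psi> x" for x
      unfolding h_def grid_mean_add grid_mean_scale by simp
    ultimately have "\<bar>(grid_mean N L' g (y /\<^sub>R real N) - grid_mean N L' g 0) - \<psi> y / real N\<bar> \<le> 2 * \<epsilon> / real N"
      by (simp add: blinfun.scaleR_right field_simps)
    then have "real N * \<bar>(grid_mean N L' g (y /\<^sub>R real N) - grid_mean N L' g 0) - \<psi> y / real N\<bar> \<le> 2 * \<epsilon>"
      using N by (simp add: field_simps)
    also have "real N * \<bar>(grid_mean N L' g (y /\<^sub>R real N) - grid_mean N L' g 0) - \<psi> y / real N\<bar>
      = \<bar>real N * ((grid_mean N L' g (y /\<^sub>R real N) - grid_mean N L' g 0) - \<psi> y / real N)\<bar>"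
      by (simp add: abs_mult)
    also have "real N * ((grid_mean N L' g (y /\<^sub>R real N) - grid_mean N L' g 0) - \<psi> y / real N) = \<Delta> N \<phi> y - \<psi> y"
      using N unfolding \<Delta>_def L'_def g_def by (simp add: right_diff_distrib)
    finally show ?thesis .
  qed
  obtain F where F: "F \<le> sequentially" "F \<noteq> bot"
      "\<And>h :: nat \<Rightarrow> real. bounded (range h) \<Longrightarrow> \<exists>l. (h \<longlongrightarrow> l) F"
    using refine_filter_to_converge[OF sequentially_bot] by blast
  have pos: "eventually (\<lambda>N. N > 0) F"
    using F(1) eventually_gt_at_top[of "0::nat"] by (rule filter_leD)
  have "\<exists>l. ((\<lambda>N. \<Delta> N \<phi> x) \<longlongrightarrow> l) F" for \<phi> x
    using \<Delta>_lip[of _ \<phi> x 0] by (intro F(3)) (auto simp: bounded_iff \<Delta>_zero)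
  then obtain D where D: "\<And>\<phi> x. ((\<lambda>N. \<Delta> N \<phi> x) \<longlongrightarrow> D \<phi> x) F" by metis
  have uniq: "D \<phi> x = l" if "((\<lambda>N. \<Delta> N \<phi> x) \<longlongrightarrow> l) F" for \<phi> x l
    using tendsto_unique[OF F(2) D that] .
  show ?thesis
  proof (rule that[of D])
    show "D (\<phi> + \<psi>) x = D \<phi> x + D \<psi> x" for \<phi> \<psi> x
      by (rule uniq) (simp add: \<Delta>_add D tendsto_add)
    show "D (c *\<^sub>R \<phi>) x = c * D \<phi> x" for c \<phi> x
      by (rule uniq) (simp add: \<Delta>_scale D tendsto_mult_left)
    show "\<bar>D \<phi> x - D \<phi> y\<bar> \<le> norm \<phi> * norm (x - y)" for \<phi> x y
      by (rule tendsto_le[OF F(2) tendsto_const tendsto_rabs[OF tendsto_diff[OF D D]]]) (simp add: \<Delta>_lip)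
    show "D \<phi> (x + y) - D \<phi> x = D \<phi> y" if y: "y \<in> set L" for \<phi> x y
    proof -
      have "((\<lambda>N. 2 * norm \<phi> * norm x / real N) \<longlongrightarrow> 0) F"
        using F(1) lim_const_over_n by (rule tendsto_mono)
      moreover have "eventually (\<lambda>N. \<bar>(\<Delta> N \<phi> (x + y) - \<Delta> N \<phi> x) - \<Delta> N \<phi> y\<bar> \<le> 2 * norm \<phi> * norm x / real N) F"
        using pos by eventually_elim (rule \<Delta>_additive[OF y])
      ultimately have "\<bar>(D \<phi> (x + y) - D \<phi> x) - D \<phi> y\<bar> \<le> 0"
        by (rule tendsto_le[OF F(2) _ tendsto_rabs[OF tendsto_diff[OF tendsto_diff[OF D D] D]]])
      then show ?thesis by simp
    qed
    show "\<bar>D \<phi> y - \<psi> y\<bar> \<le> 2 * \<epsilon>"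
      if y: "y \<in> set L" and close: "\<And>z. z \<in> zonotope 1 L \<Longrightarrow> \<bar>\<phi> (lip_delta z) - \<psi> z\<bar> \<le> \<epsilon>"
      for \<epsilon> y and \<phi> :: "'a lipfree \<Rightarrow>\<^sub>L real" and \<psi> :: "'a \<Rightarrow>\<^sub>L real"
    proof (rule tendsto_le[OF F(2) tendsto_const tendsto_rabs[OF tendsto_diff[OF D tendsto_const]]])
      show "eventually (\<lambda>N. \<bar>\<Delta> N \<phi> y - \<psi> y\<bar> \<le> 2 * \<epsilon>) F"
        using pos by eventually_elim (rule \<Delta>_close[OF y _ close])
    qed
  qed
qed

text \<open>The function \<open>D \<phi>\<close> of \<open>derivative_limit\<close> is averaged once more, now over grids in arbitrarily many
arbitrary directions. In the limit this gives an additive function of the point, hence a functional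
that depends linearly on \<open>\<phi>\<close>. Since \<open>D \<phi>\<close> is already additive in the directions of \<open>L\<close>, its values there survive the averaging.\<close>

lemma approximate_lifting:
  fixes L :: "'a::real_normed_vector list"
  obtains \<Lambda> :: "('a lipfree \<Rightarrow>\<^sub>L real) \<Rightarrow>\<^sub>L ('a \<Rightarrow>\<^sub>L real)" where
    "norm \<Lambda> \<le> 1"
    "\<And>\<phi> \<psi> \<epsilon> y. y \<in> set L \<Longrightarrow> (\<And>z. z \<in> zonotope 1 L \<Longrightarrow> \<bar>blinfun_apply \<phi> (lip_delta z) - blinfun_apply \<psi> z\<bar> \<le> \<epsilon>) \<Longrightarrow>
      \<bar>blinfun_apply (\<Lambda> \<phi>) y - blinfun_apply \<psi> y\<bar> \<le> 2 * \<epsilon>"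
proof (rule derivative_limit[of L])
  fix D :: "('a lipfree \<Rightarrow>\<^sub>L real) \<Rightarrow> 'a \<Rightarrow> real"
  assume D_add: "\<And>\<phi> \<psi> x. D (\<phi> + \<psi>) x = D \<phi> x + D \<psi> x" and D_scale: "\<And>c \<phi> x. D (c *\<^sub>R \<phi>) x = c * D \<phi> x"
    and D_lip: "\<And>\<phi> x y. \<bar>D \<phi> x - D \<phi> y\<bar> \<le> norm \<phi> * norm (x - y)"
    and D_shift: "\<And>\<phi> x y. y \<in> set L \<Longrightarrow> D \<phi> (x + y) - D \<phi> x = D \<phi> y"
    and D_close: "\<And>\<phi> \<psi> \<epsilon> y. y \<in> set L \<Longrightarrow> (\<And>z. z \<in> zonotope 1 L \<Longrightarrow> \<bar>blinfun_apply \<phi> (lip_delta z) - blinfun_apply \<psi> z\<bar> \<le> \<epsilon>) \<Longrightarrow>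
      \<bar>D \<phi> y - blinfun_apply \<psi> y\<bar> \<le> 2 * \<epsilon>"
  define S where "S = {(R, Y :: 'a list). R > (0::nat)}"
  \<comment> \<open>a value below one says that \<open>y\<close> is among the directions \<open>Y\<close>, and then controls the defect of additivity\<close>
  define d where "d = (\<lambda>(R, Y :: 'a list) y. if y \<in> set Y then inverse (real R) else 1)"
  have small: "\<exists>i\<in>S. \<forall>y\<in>A. \<bar>d i y\<bar> < e" if A: "finite A" and e: "e > 0" for A e
  proof -
    obtain Y where Y: "set Y = A" using finite_list[OF A] by blast
    obtain n where "inverse (real (Suc n)) < e" using reals_Archimedean[OF e] by blast
    then show ?thesis using Y by (intro bexI[of _ "(Suc n, Y)"]) (auto simp: d_def S_def)
  qed
  obtain F where F: "F \<noteq> bot" "F \<le> principal S" and d: "\<And>y. ((\<lambda>i. d i y) \<longlongrightarrow> 0) F"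
    and conv: "\<And>h :: nat \<times> 'a list \<Rightarrow> real. bounded (h ` S) \<Longrightarrow> \<exists>l. (h \<longlongrightarrow> l) F"
    using net_along_finite_sets[of S d, OF small] by blast
  have FS: "eventually (\<lambda>i. i \<in> S) F" using F(2) by (simp add: le_principal)
  define A where "A = (\<lambda>(R, Y) \<phi> x. grid_mean R Y (D \<phi>) x - grid_mean R Y (D \<phi>) 0)"
  have A_lip: "\<bar>A i \<phi> x\<bar> \<le> norm \<phi> * norm x" if "i \<in> S" for i \<phi> x
    using grid_mean_lipschitz[OF _ D_lip, of "fst i" "snd i" \<phi> x 0] that
    by (auto simp: A_def S_def)
  have A_add: "A i (\<phi> + \<psi>) x = A i \<phi> x + A i \<psi> x" for i \<phi> \<psi> x
  proof -
    have "D (\<phi> + \<psi>) = (\<lambda>x. D \<phi> x + D \<psi> x)" by (rule ext) (rule D_add)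
    then show ?thesis by (simp add: A_def grid_mean_add split: prod.split)
  qed
  have A_scale: "A i (c *\<^sub>R \<phi>) x = c * A i \<phi> x" for i \<phi> c x
  proof -
    have "D (c *\<^sub>R \<phi>) = (\<lambda>x. c * D \<phi> x)" by (rule ext) (rule D_scale)
    then show ?thesis by (simp add: A_def grid_mean_scale right_diff_distrib split: prod.split)
  qed
  have A_fixed: "A i \<phi> y = D \<phi> y" if "y \<in> set L" "i \<in> S" for i \<phi> y
    using grid_mean_shift[of "fst i" "D \<phi>" y "D \<phi> y" "snd i" 0] D_shift[OF that(1)] that(2)
    by (auto simp: A_def S_def)
  have A_additive: "\<bar>A i \<phi> (x + y) - A i \<phi> x - A i \<phi> y\<bar> \<le> 2 * norm \<phi> * norm x * d i y"
    if iS: "i \<in> S" and dy: "d i y < 1" for i \<phi> x y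
  proof -
    obtain R Y where i: "i = (R, Y)" "R > 0" using iS by (auto simp: S_def)
    have y: "y \<in> set Y" using dy by (auto simp: i d_def split: if_splits)
    show ?thesis
      using grid_mean_almost_additive[OF i(2) D_lip y, of \<phi> 0 x] y
      by (simp add: i A_def d_def divide_inverse)
  qed
  have "\<exists>l. ((\<lambda>i. A i \<phi> x) \<longlongrightarrow> l) F" for \<phi> x
  proof (rule conv)
    show "bounded ((\<lambda>i. A i \<phi> x) ` S)"
      unfolding bounded_iff using A_lip[of _ \<phi> x] by (intro exI[of _ "norm \<phi> * norm x"]) auto
  qed
  then obtain a where a: "\<And>\<phi> x. ((\<lambda>i. A i \<phi> x) \<longlongrightarrow> a \<phi> x) F" by metis
  have uniq: "a \<phi> x = l" if "((\<lambda>i. A i \<phi> x) \<longlongrightarrow> l) F" for \<phi> x l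
    using tendsto_unique[OF F(1) a that] .
  have a_bound: "\<bar>a \<phi> x\<bar> \<le> norm \<phi> * norm x" for \<phi> x
  proof (rule tendsto_le[OF F(1) tendsto_const tendsto_rabs[OF a]])
    show "eventually (\<lambda>i. \<bar>A i \<phi> x\<bar> \<le> norm \<phi> * norm x) F"
      using FS by eventually_elim (rule A_lip)
  qed
  have a_additive: "a \<phi> (x + y) = a \<phi> x + a \<phi> y" for \<phi> x y
  proof -
    have "((\<lambda>i. 2 * norm \<phi> * norm x * d i y) \<longlongrightarrow> 2 * norm \<phi> * norm x * 0) F"
      by (intro tendsto_mult_left d)
    moreover have "eventually (\<lambda>i. \<bar>A i \<phi> (x + y) - A i \<phi> x - A i \<phi> y\<bar> \<le> 2 * norm \<phi> * norm x * d i y) F"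
      using FS order_tendstoD(2)[OF d zero_less_one, of y] by eventually_elim (rule A_additive)
    ultimately have "\<bar>a \<phi> (x + y) - a \<phi> x - a \<phi> y\<bar> \<le> 2 * norm \<phi> * norm x * 0"
      by (rule tendsto_le[OF F(1) _ tendsto_rabs[OF tendsto_diff[OF tendsto_diff[OF a a] a]]])
    then show ?thesis by simp
  qed
  have a_fixed: "a \<phi> y = D \<phi> y" if "y \<in> set L" for \<phi> y
  proof (rule uniq)
    have "eventually (\<lambda>i. D \<phi> y = A i \<phi> y) F" using FS by eventually_elim (simp add: A_fixed[OF that])
    with tendsto_const show "((\<lambda>i. A i \<phi> y) \<longlongrightarrow> D \<phi> y) F" by (rule Lim_transform_eventually)
  qed
  obtain \<Lambda> :: "('a lipfree \<Rightarrow>\<^sub>L real) \<Rightarrow>\<^sub>L ('a \<Rightarrow>\<^sub>L real)" where \<Lambda>: "\<And>\<phi> x. \<Lambda> \<phi> x = a \<phi> x" "norm \<Lambda> \<le> 1"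
  proof (rule blinfun_of_bilinear[of a 1])
    show "a (\<phi> + \<psi>) x = a \<phi> x + a \<psi> x" for \<phi> \<psi> x by (rule uniq) (simp add: A_add a tendsto_add)
    show "a (c *\<^sub>R \<phi>) x = c * a \<phi> x" for c \<phi> x by (rule uniq) (simp add: A_scale a tendsto_mult_left)
    show "a \<phi> (c *\<^sub>R x) = c * a \<phi> x" for c \<phi> x
      by (rule additive_bounded_imp_homogeneous[OF a_additive a_bound])
  qed (use a_additive a_bound in auto)
  show ?thesis
  proof (rule that[OF \<Lambda>(2)])
    show "\<bar>\<Lambda> \<phi> y - \<psi> y\<bar> \<le> 2 * \<epsilon>"
      if "y \<in> set L" "\<And>z. z \<in> zonotope 1 L \<Longrightarrow> \<bar>\<phi> (lip_delta z) - \<psi> z\<bar> \<le> \<epsilon>"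
      for \<epsilon> y and \<phi> :: "'a lipfree \<Rightarrow>\<^sub>L real" and \<psi> :: "'a \<Rightarrow>\<^sub>L real"
      using D_close[OF that] by (simp add: \<Lambda>(1) a_fixed[OF that(1)])
  qed
qed

text \<open>The operator is \<open>\<Lambda> \<circ> W\<close>. As \<open>\<Lambda>\<close> sees a Lipschitz function only through its values on a compact
zonotope, and the functions \<open>x \<mapsto> W \<phi> \<delta>\<^sub>x\<close> are equi-Lipschitz for the finitely many \<open>\<phi>\<close> in question,
it is enough that \<open>W\<close> is close to the embedding at finitely many points of the free space.\<close>

lemma compact_approximation_of_dual_identity:
  fixes A :: "(('x::banach \<Rightarrow>\<^sub>L real) \<times> 'x) set"
  assumes C: "C \<ge> 0"
    and W: "\<And>(A :: (('x \<Rightarrow>\<^sub>L real) \<times> 'x lipfree) set) e. finite A \<Longrightarrow> e > 0 \<Longrightarrow>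
      \<exists>W :: ('x \<Rightarrow>\<^sub>L real) \<Rightarrow>\<^sub>L ('x lipfree \<Rightarrow>\<^sub>L real). compact_operator W \<and> norm W \<le> C \<and>
        (\<forall>a\<in>A. \<bar>blinfun_apply (blinfun_apply W (fst a)) (snd a) - blinfun_apply (blinfun_apply dual_embedding (fst a)) (snd a)\<bar> < e)"
    and A: "finite A" and e: "e > 0"
  shows "\<exists>T :: ('x \<Rightarrow>\<^sub>L real) \<Rightarrow>\<^sub>L ('x \<Rightarrow>\<^sub>L real). compact_operator T \<and> norm T \<le> C \<and>
    (\<forall>a\<in>A. \<bar>blinfun_apply (blinfun_apply T (fst a)) (snd a) - blinfun_apply (fst a) (snd a)\<bar> < e)"
proof -
  obtain L where L: "set L = snd ` A" using finite_list[OF finite_imageI[OF A, of snd]] by blast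
  obtain \<Lambda> :: "('x lipfree \<Rightarrow>\<^sub>L real) \<Rightarrow>\<^sub>L ('x \<Rightarrow>\<^sub>L real)" where
    \<Lambda>: "norm \<Lambda> \<le> 1" and \<Lambda>_close:
    "\<And>\<phi> \<psi> \<epsilon> y. y \<in> set L \<Longrightarrow> (\<And>z. z \<in> zonotope 1 L \<Longrightarrow> \<bar>blinfun_apply \<phi> (lip_delta z) - blinfun_apply \<psi> z\<bar> \<le> \<epsilon>) \<Longrightarrow>
      \<bar>blinfun_apply (\<Lambda> \<phi>) y - blinfun_apply \<psi> y\<bar> \<le> 2 * \<epsilon>"
    by (rule approximate_lifting[of L]) blast
  \<comment> \<open>bounds the Lipschitz constants of all differences \<open>x \<mapsto> W \<phi> \<delta>\<^sub>x - \<phi> x\<close> in question\<close>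
  define c where "c = (C + 1) * ((\<Sum>a\<in>A. norm (fst a)) + 1)"
  have sum_nn: "0 \<le> (\<Sum>a\<in>A. norm (fst a))" by (rule sum_nonneg) simp
  have c: "c > 0" unfolding c_def using C sum_nn by (intro mult_pos_pos) auto
  have c_bound: "(C + 1) * norm (fst a) \<le> c" if "a \<in> A" for a
    unfolding c_def using member_le_sum[OF that _ A, of "\<lambda>a. norm (fst a)"] C by (intro mult_left_mono) auto
  define \<eta> where "\<eta> = e / (6 * c)"
  have \<eta>: "\<eta> > 0" "c * \<eta> = e / 6" using e c by (simp_all add: \<eta>_def)
  have "\<exists>K. finite K \<and> zonotope 1 L \<subseteq> (\<Union>x\<in>K. ball x \<eta>)"
    using compact_zonotope[of 1 L] \<eta>(1) unfolding compact_eq_totally_bounded by simp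
  then obtain K where K: "finite K" "zonotope 1 L \<subseteq> (\<Union>x\<in>K. ball x \<eta>)" by (elim exE conjE)
  have "finite ((\<lambda>a. fst a) ` A \<times> lip_delta ` K)" "e / 6 > 0" using A K(1) e by auto
  from W[OF this] obtain W :: "('x \<Rightarrow>\<^sub>L real) \<Rightarrow>\<^sub>L ('x lipfree \<Rightarrow>\<^sub>L real)" where
    Wc: "compact_operator W" "norm W \<le> C"
    and W_close: "\<And>a k. a \<in> A \<Longrightarrow> k \<in> K \<Longrightarrow> \<bar>W (fst a) (lip_delta k) - fst a k\<bar> < e / 6"
    by auto
  show ?thesis
  proof (intro exI conjI ballI)
    show "compact_operator (\<Lambda> o\<^sub>L W)" by (rule compact_operator_compose_left[OF Wc(1)])
    have "norm (\<Lambda> o\<^sub>L W) \<le> norm \<Lambda> * norm W" by (rule norm_blinfun_compose)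
    also have "\<dots> \<le> 1 * C" using \<Lambda> Wc(2) by (intro mult_mono) auto
    finally show "norm (\<Lambda> o\<^sub>L W) \<le> C" by simp
    fix a assume a: "a \<in> A"
    have on_zonotope: "\<bar>W (fst a) (lip_delta z) - fst a z\<bar> \<le> e / 3" if "z \<in> zonotope 1 L" for z
    proof -
      have "z \<in> (\<Union>x\<in>K. ball x \<eta>)" using K(2) that by (rule subsetD)
      then obtain k where k: "k \<in> K" "norm (z - k) < \<eta>" by (auto simp: dist_norm norm_minus_commute)
      have "norm (W (fst a)) \<le> norm W * norm (fst a)" by (rule norm_blinfun)
      also have "\<dots> \<le> C * norm (fst a)" using Wc(2) by (rule mult_right_mono) simp
      finally have nW: "norm (W (fst a)) \<le> C * norm (fst a)" .
      have "\<bar>W (fst a) (lip_delta z) - W (fst a) (lip_delta k)\<bar> \<le> norm (W (fst a)) * norm (z - k)"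
        using functional_delta_lipschitz[of "W (fst a)" z k] by simp
      also have "\<dots> \<le> C * norm (fst a) * norm (z - k)" using nW by (rule mult_right_mono) simp
      finally have 1: "\<bar>W (fst a) (lip_delta z) - W (fst a) (lip_delta k)\<bar> \<le> C * norm (fst a) * norm (z - k)" .
      have 2: "\<bar>fst a z - fst a k\<bar> \<le> norm (fst a) * norm (z - k)"
        using norm_blinfun[of "fst a" "z - k"] by (simp add: blinfun.diff_right)
      have "C * norm (fst a) * norm (z - k) + norm (fst a) * norm (z - k) = ((C + 1) * norm (fst a)) * norm (z - k)"
        by (simp add: algebra_simps)
      also have "\<dots> \<le> c * \<eta>" using c_bound[OF a] k(2) c by (intro mult_mono) auto
      finally have "C * norm (fst a) * norm (z - k) + norm (fst a) * norm (z - k) \<le> e / 6" by (simp add: \<eta>(2))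
      with 1 2 W_close[OF a k(1)] show ?thesis by linarith
    qed
    have "\<bar>\<Lambda> (W (fst a)) (snd a) - fst a (snd a)\<bar> \<le> 2 * (e / 3)"
      by (rule \<Lambda>_close) (use a L on_zonotope in auto)
    then show "\<bar>(\<Lambda> o\<^sub>L W) (fst a) (snd a) - fst a (snd a)\<bar> < e" using e by simp
  qed
qed

section \<open>Weak-star density\<close>

lemma elem_tensor_in_projective: "elem_tensor x y \<in> projective_tensor_product"
  unfolding projective_tensor_product_def
proof (intro CollectI exI[of _ "\<lambda>_. elem_tensor x y"] conjI allI impI)
  show "range (\<lambda>_ :: nat. elem_tensor x y) \<subseteq> alg_tensor_product"
    unfolding alg_tensor_product_def by (auto intro: span_base)
  fix e :: real assume e: "e > 0"
  let ?S = "{\<Sum>(x, y)\<leftarrow>ps. norm x * norm y | ps. (0 :: ('a \<Rightarrow>\<^sub>L ('b \<Rightarrow>\<^sub>L real)) \<Rightarrow>\<^sub>L real) = (\<Sum>(x, y)\<leftarrow>ps. elem_tensor x y)}"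
  have "projective_norm (0 :: ('a \<Rightarrow>\<^sub>L ('b \<Rightarrow>\<^sub>L real)) \<Rightarrow>\<^sub>L real) \<le> 0"
    unfolding projective_norm_def
  proof (rule cInf_lower)
    show "0 \<in> ?S" by (rule CollectI, rule exI[of _ "[]"]) simp
    have "0 \<le> (\<Sum>(x, y)\<leftarrow>ps. norm x * norm y)" for ps :: "('a \<times> 'b) list"
      by (rule sum_list_nonneg) auto
    then show "bdd_below ?S" by (auto simp: bdd_below_def)
  qed
  then show "\<exists>N. \<forall>m\<ge>N. \<forall>n\<ge>N. projective_norm (elem_tensor x y - elem_tensor x y) < e" using e by simp
qed simp

text \<open>Only elementary tensors \<open>\<phi> \<otimes> x\<close> are tested, which gives approximation on finitely many pairs.\<close>

lemma dual_BWD_approximation: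
  assumes "dual_BWD TYPE('x::banach)"
  obtains r where "r \<ge> 1" "\<And>(T :: ('x \<Rightarrow>\<^sub>L real) \<Rightarrow>\<^sub>L ('x \<Rightarrow>\<^sub>L real)) A e. T \<in> compact_ops 1 \<Longrightarrow> finite A \<Longrightarrow> e > 0 \<Longrightarrow>
    \<exists>S \<in> weak_star_compact_ops r. \<forall>a\<in>A. \<bar>blinfun_apply (blinfun_apply S (fst a)) (snd a)
      - blinfun_apply (blinfun_apply T (fst a)) (snd a)\<bar> < e"
proof -
  obtain r where r: "r \<ge> 1" "(compact_ops 1 :: (('x \<Rightarrow>\<^sub>L real) \<Rightarrow>\<^sub>L ('x \<Rightarrow>\<^sub>L real)) set)
      \<subseteq> tensor_weak_star_topology closure_of (weak_star_compact_ops r)"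
    using assms by (auto simp: dual_BWD_def)
  show ?thesis
  proof (rule that[OF r(1)])
    fix T :: "('x \<Rightarrow>\<^sub>L real) \<Rightarrow>\<^sub>L ('x \<Rightarrow>\<^sub>L real)" and A :: "(('x \<Rightarrow>\<^sub>L real) \<times> 'x) set" and e :: real
    assume T: "T \<in> compact_ops 1" and A: "finite A" and e: "e > 0"
    define O' where "O' a = {S. elem_tensor (fst a) (snd a) S \<in> ball (elem_tensor (fst a) (snd a) T) e}"
      for a :: "('x \<Rightarrow>\<^sub>L real) \<times> 'x"
    have O'_open: "openin tensor_weak_star_topology (O' a)" for a
      unfolding tensor_weak_star_topology_def O'_def
      by (rule topology_generated_by_Basis) (use elem_tensor_in_projective open_ball in blast)
    have Tcl: "T \<in> tensor_weak_star_topology closure_of (weak_star_compact_ops r)" using T r(2) by blast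
    have Ttop: "T \<in> topspace tensor_weak_star_topology" 
      using Tcl[unfolded in_closure_of] by (rule conjunct1)
    define U where "U = topspace tensor_weak_star_topology \<inter> (\<Inter>a\<in>A. O' a)"
    have "openin tensor_weak_star_topology U"
      unfolding U_def using A O'_open by (cases "A = {}") (auto intro!: openin_Int openin_INT)
    moreover have "T \<in> U" using Ttop e by (auto simp: U_def O'_def)
    ultimately have "\<exists>S. S \<in> weak_star_compact_ops r \<and> S \<in> U"
      using Tcl[unfolded in_closure_of, THEN conjunct2, THEN spec, of U] by simp
    then obtain S where S: "S \<in> weak_star_compact_ops r" "\<And>a. a \<in> A \<Longrightarrow> S \<in> O' a"
      unfolding U_def by auto
    show "\<exists>S \<in> weak_star_compact_ops r. \<forall>a\<in>A. \<bar>S (fst a) (snd a) - T (fst a) (snd a)\<bar> < e"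
      using S by (intro bexI[of _ S]) (auto simp: O'_def elem_tensor.rep_eq dist_real_def abs_minus_commute)
  qed
qed

text \<open>A functional whose kernel contains the intersection of the kernels of finitely many evaluations is a
linear combination of them, hence an evaluation. In the induction, \<open>\<phi>0\<close> vanishes on \<open>A\<close> and is one at
\<open>a\<close>, and subtracting a multiple of the evaluation at \<open>a\<close> reduces to the set \<open>A\<close>.\<close>

lemma functional_of_finitely_many_evaluations:
  fixes \<psi> :: "('x::real_normed_vector \<Rightarrow>\<^sub>L real) \<Rightarrow>\<^sub>L real"
  assumes "finite A" "\<And>\<phi>. (\<And>a. a \<in> A \<Longrightarrow> blinfun_apply \<phi> a = 0) \<Longrightarrow> \<psi> \<phi> = 0"
  shows "\<exists>y. \<forall>\<phi>. \<psi> \<phi> = blinfun_apply \<phi> y"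
  using assms
proof (induction A arbitrary: \<psi> rule: finite_induct)
  case empty
  then show ?case by (intro exI[of _ 0]) simp
next
  case (insert a A)
  show ?case
  proof (cases "\<forall>\<phi> :: 'x \<Rightarrow>\<^sub>L real. (\<forall>b\<in>A. blinfun_apply \<phi> b = 0) \<longrightarrow> \<phi> a = 0")
    case True
    show ?thesis
    proof (rule insert.IH)
      fix \<phi> :: "'x \<Rightarrow>\<^sub>L real" assume \<phi>: "\<And>b. b \<in> A \<Longrightarrow> \<phi> b = 0"
      have "\<phi> a = 0" by (rule True[rule_format]) (rule \<phi>)
      then show "\<psi> \<phi> = 0" using \<phi> by (intro insert.prems) auto
    qed
  next
    case False
    then obtain \<phi>1 :: "'x \<Rightarrow>\<^sub>L real" where \<phi>1: "\<And>b. b \<in> A \<Longrightarrow> \<phi>1 b = 0" "\<phi>1 a \<noteq> 0" by blast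
    define \<phi>0 where "\<phi>0 = (1 / \<phi>1 a) *\<^sub>R \<phi>1"
    have \<phi>0: "\<And>b. b \<in> A \<Longrightarrow> \<phi>0 b = 0" "\<phi>0 a = 1"
      using \<phi>1 by (simp_all add: \<phi>0_def blinfun.scaleR_left)
    define ev where "ev = Blinfun (\<lambda>\<phi> :: 'x \<Rightarrow>\<^sub>L real. \<phi> a)"
    have ev: "ev \<phi> = \<phi> a" for \<phi>
      unfolding ev_def by (subst bounded_linear_Blinfun_apply) (rule blinfun.bounded_linear_left, simp)
    have "\<exists>y. \<forall>\<phi>. (\<psi> - \<psi> \<phi>0 *\<^sub>R ev) \<phi> = blinfun_apply \<phi> y"
    proof (rule insert.IH)
      fix \<phi> :: "'x \<Rightarrow>\<^sub>L real" assume \<phi>: "\<And>b. b \<in> A \<Longrightarrow> \<phi> b = 0"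
      have "\<psi> (\<phi> - \<phi> a *\<^sub>R \<phi>0) = 0"
        by (rule insert.prems) (auto simp: blinfun.diff_left blinfun.scaleR_left \<phi> \<phi>0)
      then show "(\<psi> - \<psi> \<phi>0 *\<^sub>R ev) \<phi> = 0"
        by (simp add: blinfun.diff_left blinfun.diff_right blinfun.scaleR_left blinfun.scaleR_right ev mult.commute)
    qed
    then obtain y where y: "\<And>\<phi>. (\<psi> - \<psi> \<phi>0 *\<^sub>R ev) \<phi> = blinfun_apply \<phi> y" by blast
    have "\<psi> \<phi> = \<phi> (y + \<psi> \<phi>0 *\<^sub>R a)" for \<phi>
      using y[of \<phi>] by (simp add: blinfun.diff_left blinfun.scaleR_left blinfun.add_right blinfun.scaleR_right ev)
    then show ?thesis by blast
  qed
qed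

text \<open>Continuity bounds the functional on a basic neighbourhood of zero, which restricts only finitely many
coordinates. On the subspace where these vanish the functional is bounded, hence zero.\<close>

lemma weak_star_continuous_functional_is_evaluation:
  fixes \<psi> :: "('x::real_normed_vector \<Rightarrow>\<^sub>L real) \<Rightarrow>\<^sub>L real"
  assumes "continuous_map weak_star_topology euclidean \<psi>"
  shows "\<exists>y. \<forall>\<phi>. \<psi> \<phi> = blinfun_apply \<phi> y"
proof -
  have "openin weak_star_topology {\<phi> :: 'x \<Rightarrow>\<^sub>L real. \<psi> \<phi> \<in> ball 0 1}"
    using openin_continuous_map_preimage[OF assms, of "ball 0 1"] by (simp add: strong_operator_topology_topspace)
  then obtain V where V: "open V" "{\<phi> :: 'x \<Rightarrow>\<^sub>L real. \<psi> \<phi> \<in> ball 0 1} = blinfun_apply -` V"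
    unfolding strong_operator_topology_def openin_pullback_topology by auto
  have "(0 :: 'x \<Rightarrow>\<^sub>L real) \<in> {\<phi>. \<psi> \<phi> \<in> ball 0 1}" by simp
  then have "blinfun_apply (0 :: 'x \<Rightarrow>\<^sub>L real) \<in> V" unfolding V(2) by simp
  moreover have "openin (product_topology (\<lambda>i. euclidean) UNIV) V"
    using V(1) by (simp add: euclidean_product_topology)
  ultimately obtain X where X: "blinfun_apply (0 :: 'x \<Rightarrow>\<^sub>L real) \<in> (\<Pi>\<^sub>E i\<in>UNIV. X i)"
      "finite {i. X i \<noteq> (UNIV :: real set)}" "(\<Pi>\<^sub>E i\<in>UNIV. X i) \<subseteq> V"
    using product_topology_open_contains_basis[of "\<lambda>i. euclidean" UNIV V "blinfun_apply 0"] by auto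
  show ?thesis
  proof (rule functional_of_finitely_many_evaluations[OF X(2)])
    fix \<phi> :: "'x \<Rightarrow>\<^sub>L real" assume \<phi>: "\<And>a. a \<in> {i. X i \<noteq> UNIV} \<Longrightarrow> \<phi> a = 0"
    have small: "\<bar>t * \<psi> \<phi>\<bar> < 1" for t
    proof -
      have "blinfun_apply (t *\<^sub>R \<phi>) \<in> (\<Pi>\<^sub>E i\<in>UNIV. X i)"
      proof (rule PiE_I)
        fix i
        show "(t *\<^sub>R \<phi>) i \<in> X i"
          using \<phi>[of i] PiE_mem[OF X(1), of i] by (cases "X i = UNIV") (auto simp: blinfun.scaleR_left)
      qed simp
      then have "t *\<^sub>R \<phi> \<in> blinfun_apply -` V" using X(3) by blast
      then have "\<psi> (t *\<^sub>R \<phi>) \<in> ball 0 1" unfolding V(2)[symmetric] by simp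
      then show ?thesis by (simp add: blinfun.scaleR_right)
    qed
    show "\<psi> \<phi> = 0" using small[of "inverse (\<psi> \<phi>)"] by (cases "\<psi> \<phi> = 0") auto
  qed
qed

text \<open>For fixed \<open>x\<close> the functional \<open>\<phi> \<mapsto> S \<phi> x\<close> is weak-star continuous, hence the evaluation at a point
\<open>s x\<close>. Compactness of \<open>s\<close> is the converse of Schauder's theorem, by \<open>totally_bounded_dual_pair\<close>.\<close>

lemma weak_star_compact_op_is_adjoint:
  fixes S :: "('x::banach \<Rightarrow>\<^sub>L real) \<Rightarrow>\<^sub>L ('x \<Rightarrow>\<^sub>L real)"
  assumes "S \<in> weak_star_compact_ops r"
  obtains s :: "'x \<Rightarrow>\<^sub>L 'x" where "compact_operator s" "norm s \<le> r" "\<And>\<phi> x. blinfun_apply \<phi> (s x) = S \<phi> x"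
proof -
  have S: "compact_operator S" "norm S \<le> r"
    and cont: "continuous_map weak_star_topology weak_star_topology (blinfun_apply S)"
    using assms by (auto simp: weak_star_compact_ops_def compact_ops_def)
  have "\<exists>y. \<forall>\<phi>. S \<phi> x = blinfun_apply \<phi> y" for x
  proof -
    have "bounded_linear (\<lambda>\<phi>. S \<phi> x)"
      using bounded_linear_compose[OF blinfun.bounded_linear_left blinfun.bounded_linear_right] by blast
    then have B: "blinfun_apply (Blinfun (\<lambda>\<phi>. S \<phi> x)) = (\<lambda>\<phi>. S \<phi> x)" by (rule bounded_linear_Blinfun_apply)
    have "continuous_map weak_star_topology euclidean (\<lambda>\<phi>. S \<phi> x)"
      using cont unfolding continuous_on_strong_operator_topo_iff_coordinatewise by blast
    then show ?thesis using weak_star_continuous_functional_is_evaluation[of "Blinfun (\<lambda>\<phi>. S \<phi> x)"] by (simp add: B)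
  qed
  then obtain s0 where s0: "\<And>\<phi> x. S \<phi> x = blinfun_apply \<phi> (s0 x)" by metis
  have S_bound: "\<bar>S \<phi> x\<bar> \<le> norm S * norm x" if "norm \<phi> \<le> 1" for \<phi> x
  proof -
    have "\<bar>S \<phi> x\<bar> \<le> norm (S \<phi>) * norm x" using norm_blinfun[of "S \<phi>" x] by simp
    also have "\<dots> \<le> (norm S * norm \<phi>) * norm x" by (intro mult_right_mono norm_blinfun) simp
    also have "\<dots> \<le> (norm S * 1) * norm x" using that by (intro mult_right_mono mult_left_mono) auto
    finally show ?thesis by simp
  qed
  have eq: "y = z" if "\<And>\<phi> :: 'x \<Rightarrow>\<^sub>L real. blinfun_apply \<phi> y = blinfun_apply \<phi> z" for y z
    using norm_le_by_functionals[of "y - z" 0] that by (simp add: blinfun.diff_right)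
  have bound: "norm (s0 x) \<le> norm S * norm x" for x
    using S_bound by (intro norm_le_by_functionals) (auto simp: s0[symmetric] dest: abs_le_D1)
  have "bounded_linear s0"
  proof (rule bounded_linear_intro[where K = "norm S"])
    show "s0 (x + y) = s0 x + s0 y" "s0 (c *\<^sub>R x) = c *\<^sub>R s0 x" for x y c
      by (rule eq, simp add: s0[symmetric] blinfun.add_right blinfun.scaleR_right)+
    show "norm (s0 x) \<le> norm x * norm S" for x using bound[of x] by (simp add: mult.commute)
  qed
  note s = bounded_linear_Blinfun_apply[OF this]
  show ?thesis
  proof (rule that[of "Blinfun s0"])
    have "norm (Blinfun s0) \<le> norm S" by (rule norm_blinfun_bound) (simp_all add: s bound)
    then show "norm (Blinfun s0) \<le> r" using S(2) by (rule order_trans)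
    show "\<phi> (Blinfun s0 x) = S \<phi> x" for \<phi> :: "'x \<Rightarrow>\<^sub>L real" and x by (simp add: s s0)
    show "compact_operator (Blinfun s0)"
      unfolding compact_operator_iff_totally_bounded
    proof (rule totally_bounded_dual_pair[where b = "\<lambda>x \<phi>. blinfun_apply (blinfun_apply S \<phi>) x" and T = S and C = "cball 0 1" and B = "norm S"])
      show "totally_bounded_image S (cball 0 1)" using S(1) by (simp add: compact_operator_iff_totally_bounded)
    next
      fix x x' :: 'x and d assume d: "\<And>\<phi>. \<phi> \<in> cball 0 1 \<Longrightarrow> \<bar>S \<phi> x - S \<phi> x'\<bar> \<le> d"
      show "dist (Blinfun s0 x) (Blinfun s0 x') \<le> d"
        unfolding dist_norm s
      proof (rule norm_le_by_functionals)
        fix \<phi> :: "'x \<Rightarrow>\<^sub>L real" assume "norm \<phi> \<le> 1"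
        then have "\<bar>S \<phi> x - S \<phi> x'\<bar> \<le> d" by (intro d) simp
        then show "\<phi> (s0 x - s0 x') \<le> d" unfolding blinfun.diff_right s0[symmetric] by (rule abs_le_D1)
      qed
    next
      fix x :: 'x and \<phi> \<phi>' :: "'x \<Rightarrow>\<^sub>L real" assume x: "x \<in> cball 0 1"
      have "\<bar>S \<phi> x - S \<phi>' x\<bar> \<le> norm (S \<phi> - S \<phi>') * norm x"
        using norm_blinfun[of "S \<phi> - S \<phi>'" x] by (simp add: blinfun.diff_left)
      also have "\<dots> \<le> dist (S \<phi>) (S \<phi>')" using x by (simp add: dist_norm mult_left_le)
      finally show "\<bar>S \<phi> x - S \<phi>' x\<bar> \<le> dist (S \<phi>) (S \<phi>')" .
    next
      fix x :: 'x and \<phi> :: "'x \<Rightarrow>\<^sub>L real" assume "x \<in> cball 0 1" "\<phi> \<in> cball 0 1"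
      then have "norm S * norm x \<le> norm S" "\<bar>S \<phi> x\<bar> \<le> norm S * norm x"
        using S_bound by (auto simp: mult_left_le)
      then show "\<bar>S \<phi> x\<bar> \<le> norm S" by linarith
    qed
  qed
qed

section \<open>From weak to strong approximation\<close>

text \<open>Bounded sequences serve as a normed space that contains all finite powers of \<open>'a\<close>; this is the
inclusion of the coordinate \<open>i\<close>.\<close>

definition coordinate_embedding :: "nat \<Rightarrow> 'a::real_normed_vector \<Rightarrow>\<^sub>L (nat \<Rightarrow>\<^sub>C 'a)" where
  "coordinate_embedding i = Blinfun (\<lambda>y. Bcontfun (\<lambda>k. if k = i then y else 0))"

lemma coordinate_embedding_apply:
  "apply_bcontfun (coordinate_embedding i y) k = (if k = i then y else 0)"
proof -
  have B: "apply_bcontfun (Bcontfun (\<lambda>k. if k = i then y else 0)) = (\<lambda>k. if k = i then y else 0)" for y :: 'a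
    by (rule Bcontfun_inverse) (auto simp: bcontfun_def bounded_iff intro!: exI[of _ "norm y"])
  have "bounded_linear (\<lambda>y :: 'a. Bcontfun (\<lambda>k. if k = i then y else 0))"
  proof (rule bounded_linear_intro[where K = 1])
    show "norm (Bcontfun (\<lambda>k. if k = i then y else 0)) \<le> norm y * 1" for y :: 'a
      by (rule norm_bound) (simp add: B)
  qed (rule bcontfun_eqI, simp add: B)+
  then show ?thesis by (simp add: coordinate_embedding_def bounded_linear_Blinfun_apply B)
qed

text \<open>Mazur's theorem for finitely many points at once. The error vectors \<open>(s x\<^sub>1 - g x\<^sub>1, \<dots>, s x\<^sub>n - g x\<^sub>n)\<close>
form a convex set. If it stayed away from zero, a functional would separate it; the coordinates of
that functional contradict the weak approximation.\<close>

lemma convex_weak_approximation_imp_strong: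
  fixes \<S> :: "('x::real_normed_vector \<Rightarrow>\<^sub>L 'y::real_normed_vector) set" and g :: "'x \<Rightarrow> 'y"
  assumes conv: "convex \<S>"
    and weak: "\<And>(A :: (('y \<Rightarrow>\<^sub>L real) \<times> 'x) set) e. finite A \<Longrightarrow> e > 0 \<Longrightarrow>
      \<exists>s\<in>\<S>. \<forall>a\<in>A. \<bar>blinfun_apply (fst a) (blinfun_apply s (snd a)) - blinfun_apply (fst a) (g (snd a))\<bar> < e"
    and A: "finite A" and e: "e > 0"
  shows "\<exists>s\<in>\<S>. \<forall>x\<in>A. norm (blinfun_apply s x - g x) < e"
proof (rule ccontr)
  assume contra: "\<not> ?thesis"
  obtain xs where xs: "set xs = A" using finite_list[OF A] by blast
  define n where "n = length xs"
  define \<Phi> where "\<Phi> s = (\<Sum>i<n. coordinate_embedding i (blinfun_apply s (xs ! i) - g (xs ! i)))" for s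
  have coord: "apply_bcontfun (\<Phi> s) k = s (xs ! k) - g (xs ! k)" if "k < n" for s k
  proof -
    have sum: "apply_bcontfun (\<Sum>i\<in>I. f i) k = (\<Sum>i\<in>I. apply_bcontfun (f i) k)" if "finite I"
      for I :: "nat set" and f :: "nat \<Rightarrow> nat \<Rightarrow>\<^sub>C 'y"
      using that by (induction I rule: finite_induct) simp_all
    show ?thesis
      unfolding \<Phi>_def using that by (simp add: sum coordinate_embedding_apply)
  qed
  have far: "e \<le> norm d" if d: "d \<in> \<Phi> ` \<S>" for d
  proof -
    obtain s where s: "s \<in> \<S>" "d = \<Phi> s" using d by blast
    obtain x where x: "x \<in> A" "e \<le> norm (s x - g x)" using contra s(1) by (auto simp: not_less)
    obtain k where k: "k < n" "x = xs ! k" using x(1) xs by (auto simp: in_set_conv_nth n_def)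
    have "norm (apply_bcontfun (\<Phi> s) k) \<le> norm (\<Phi> s)" by (rule norm_bounded)
    then show ?thesis using x(2) by (simp add: coord[OF k(1)] k(2) s(2))
  qed
  have "convex (\<Phi> ` \<S>)"
  proof (rule convexI)
    fix d d' and u v :: real assume d: "d \<in> \<Phi> ` \<S>" "d' \<in> \<Phi> ` \<S>" and uv: "0 \<le> u" "0 \<le> v" "u + v = 1"
    obtain s s' where s: "s \<in> \<S>" "d = \<Phi> s" "s' \<in> \<S>" "d' = \<Phi> s'" using d by blast
    have "u *\<^sub>R s + v *\<^sub>R s' \<in> \<S>" using convexD[OF conv s(1,3) uv] .
    moreover have "\<Phi> (u *\<^sub>R s + v *\<^sub>R s') = u *\<^sub>R d + v *\<^sub>R d'"
    proof -
      have "(u *\<^sub>R s + v *\<^sub>R s') x - g x = u *\<^sub>R (s x - g x) + v *\<^sub>R (s' x - g x)" for x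
      proof -
        have "g x = u *\<^sub>R g x + v *\<^sub>R g x" using uv(3) by (simp flip: scaleR_left_distrib)
        then show ?thesis by (simp add: blinfun.add_left blinfun.scaleR_left algebra_simps)
      qed
      then show ?thesis
        by (simp add: \<Phi>_def s blinfun.add_right blinfun.scaleR_right sum.distrib scaleR_sum_right)
    qed
    ultimately show "u *\<^sub>R d + v *\<^sub>R d' \<in> \<Phi> ` \<S>" by (metis imageI)
  qed
  then obtain \<Psi> :: "(nat \<Rightarrow>\<^sub>C 'y) \<Rightarrow>\<^sub>L real" where \<Psi>: "\<And>d. d \<in> \<Phi> ` \<S> \<Longrightarrow> e \<le> \<Psi> d"
    using convex_separation[OF _ far] by blast
  define B where "B = (\<lambda>i. (\<Psi> o\<^sub>L coordinate_embedding i, xs ! i)) ` {..<n}"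
  obtain s where s: "s \<in> \<S>"
    "\<And>a. a \<in> B \<Longrightarrow> \<bar>blinfun_apply (fst a) (s (snd a)) - blinfun_apply (fst a) (g (snd a))\<bar> < e / real (Suc n)"
  proof -
    have "finite B" "e / real (Suc n) > 0" using e by (auto simp: B_def)
    from weak[OF this] that show thesis by blast
  qed
  have "\<Psi> (\<Phi> s) = (\<Sum>i<n. \<Psi> (coordinate_embedding i (s (xs ! i) - g (xs ! i))))"
    by (simp add: \<Phi>_def blinfun.sum_right)
  also have "\<dots> \<le> (\<Sum>i<n. e / real (Suc n))"
  proof (rule sum_mono)
    fix i assume "i \<in> {..<n}"
    then have "\<bar>(\<Psi> o\<^sub>L coordinate_embedding i) (s (xs ! i)) - (\<Psi> o\<^sub>L coordinate_embedding i) (g (xs ! i))\<bar> < e / real (Suc n)"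
      using s(2)[of "(\<Psi> o\<^sub>L coordinate_embedding i, xs ! i)"] by (simp add: B_def)
    then show "\<Psi> (coordinate_embedding i (s (xs ! i) - g (xs ! i))) \<le> e / real (Suc n)"
      by (simp add: blinfun.diff_right)
  qed
  also have "\<dots> < e" using e by (simp add: field_simps)
  finally show False using \<Psi>[of "\<Phi> s"] s(1) by simp
qed

lemma convex_compact_ops: "convex (compact_ops r)"
proof (rule convexI)
  fix S T :: "'a \<Rightarrow>\<^sub>L 'b" and u v :: real
  assume S: "S \<in> compact_ops r" and T: "T \<in> compact_ops r" and uv: "0 \<le> u" "0 \<le> v" "u + v = 1"
  have "norm (u *\<^sub>R S + v *\<^sub>R T) \<le> u * norm S + v * norm T"
    using norm_triangle_ineq[of "u *\<^sub>R S" "v *\<^sub>R T"] uv by simp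
  also have "\<dots> \<le> u * r + v * r" using S T uv by (intro add_mono mult_left_mono) (auto simp: compact_ops_def)
  also have "\<dots> = r" using uv(3) by (simp flip: distrib_right)
  finally show "u *\<^sub>R S + v *\<^sub>R T \<in> compact_ops r"
    using S T by (simp add: compact_ops_def compact_operator_add compact_operator_scaleR)
qed

text \<open>The barycenter map composed with \<open>s\<close> linearizes \<open>s\<close>, and uniform boundedness passes from finite nets
to compact sets.\<close>

lemma Lip_K_BAP_from_compact_ops:
  assumes "\<And>(A :: 'x::banach set) e. finite A \<Longrightarrow> e > 0 \<Longrightarrow>
    \<exists>s \<in> compact_ops r. \<forall>x\<in>A. norm (blinfun_apply s x - x) < e"
  shows "Lip_K_BAP TYPE('x)"
proof -
  define c where "c = max r 1"
  have c: "c \<ge> 1" "r \<le> c" by (simp_all add: c_def)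
  obtain \<beta> :: "'x lipfree \<Rightarrow>\<^sub>L 'x" where \<beta>: "\<And>x. \<beta> (lip_delta x) = x" using barycenter_exists by blast
  have "\<exists>g\<in>lip_apply ` lip_compact_maps c. \<forall>x\<in>K. dist (g x) (id x) < e"
    if K: "compact K" and e: "e > 0" for K :: "'x set" and e
  proof -
    define \<eta> where "\<eta> = e / (2 * (c + 1))"
    have \<eta>: "\<eta> > 0" using e c by (simp add: \<eta>_def)
    obtain k where k: "finite k" "K \<subseteq> (\<Union>x\<in>k. ball x \<eta>)"
      using K \<eta> unfolding compact_eq_totally_bounded by blast
    obtain s where s: "s \<in> compact_ops r" "\<And>x. x \<in> k \<Longrightarrow> norm (blinfun_apply s x - x) < e / 2"
      using assms[OF k(1), of "e / 2"] e by auto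
    have sc: "compact_operator s" "norm s \<le> c" using s(1) c by (auto simp: compact_ops_def)
    show ?thesis
    proof (intro bexI[of _ "lip_apply (lip_of_linear s)"] ballI imageI)
      show "lip_of_linear s \<in> lip_compact_maps c"
        unfolding lip_compact_maps_def
        using order_trans[OF norm_lip_of_linear sc(2)] compact_operator_compose_right[OF sc(1), of \<beta>]
        by (auto intro!: exI[of _ "s o\<^sub>L \<beta>"] simp: \<beta>)
      fix x assume "x \<in> K"
      then obtain y where y: "y \<in> k" "dist y x < \<eta>" using k(2) by auto
      have "norm (s x - x) \<le> norm (s (x - y)) + norm (s y - y) + norm (x - y)"
        using norm_triangle_ineq4[of "s (x - y) + (s y - y)" "x - y"] norm_triangle_ineq[of "s (x - y)" "s y - y"]
        by (simp add: blinfun.diff_right)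
      also have "norm (s (x - y)) \<le> c * norm (x - y)"
        using norm_blinfun[of s "x - y"] mult_right_mono[OF sc(2), of "norm (x - y)"] by simp
      also have "c * norm (x - y) + norm (s y - y) + norm (x - y) = (c + 1) * norm (x - y) + norm (s y - y)"
        by (simp add: algebra_simps)
      also have "\<dots> < (c + 1) * \<eta> + e / 2"
        using y s(2)[OF y(1)] c by (intro add_strict_mono mult_strict_left_mono) (auto simp: dist_norm norm_minus_commute)
      also have "(c + 1) * \<eta> = e / 2"
      proof -
        have "c + 1 \<noteq> 0" using c by simp
        then show ?thesis by (simp only: \<eta>_def) (simp add: divide_simps del: distrib_left_numeral)
      qed
      also have "e / 2 + e / 2 = e" by simp
      finally show "dist (lip_apply (lip_of_linear s) x) (id x) < e" by (simp add: dist_norm)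
    qed
  qed
  then have "(id :: 'x \<Rightarrow> 'x) \<in> compact_uniform_topology closure_of (lip_apply ` lip_compact_maps c)"
    unfolding in_closure_compact_uniform_topology by blast
  then show ?thesis using c unfolding Lip_K_BAP_def by blast
qed

section \<open>Lifting the approximation property from the subspace and the quotient\<close>

theorem proposition4p8:
  fixes M :: "'x::banach set"
    and j :: "'m::banach \<Rightarrow> 'x"
    and q :: "'x lipfree \<Rightarrow> 'q::banach"
  assumes "subspace M" and "closed M"
    and "linear_isometry_onto j M"
    and "metric_quotient_map q (free_sub M)"
    and "is_ideal (free_sub M)"
    and "Lip_K_BAP TYPE('m)"
    and "K_BAP TYPE('q)"
    and "dual_BWD TYPE('x)"
  shows "Lip_K_BAP TYPE('x)"
proof -
  obtain C where C: "C \<ge> 0" and W: "\<And>(A :: (('x \<Rightarrow>\<^sub>L real) \<times> 'x lipfree) set) e. finite A \<Longrightarrow> e > 0 \<Longrightarrow>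
      \<exists>W :: ('x \<Rightarrow>\<^sub>L real) \<Rightarrow>\<^sub>L ('x lipfree \<Rightarrow>\<^sub>L real). compact_operator W \<and> norm W \<le> C \<and>
        (\<forall>a\<in>A. \<bar>blinfun_apply (blinfun_apply W (fst a)) (snd a) - blinfun_apply (blinfun_apply dual_embedding (fst a)) (snd a)\<bar> < e)"
    by (rule compact_approximation_of_dual_embedding[OF assms(3-7)]) blast
  obtain r where r: "r \<ge> 1" and BWD: "\<And>(T :: ('x \<Rightarrow>\<^sub>L real) \<Rightarrow>\<^sub>L ('x \<Rightarrow>\<^sub>L real)) A e. T \<in> compact_ops 1 \<Longrightarrow> finite A \<Longrightarrow> e > 0 \<Longrightarrow>
    \<exists>S \<in> weak_star_compact_ops r. \<forall>a\<in>A. \<bar>blinfun_apply (blinfun_apply S (fst a)) (snd a)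
      - blinfun_apply (blinfun_apply T (fst a)) (snd a)\<bar> < e"
    by (rule dual_BWD_approximation[OF assms(8)]) blast
  \<comment> \<open>\<open>C\<close> may vanish, while the operators must be scaled into the unit ball\<close>
  define c where "c = C + 1"
  have c: "c > 0" "C \<le> c" using C by (simp_all add: c_def)
  have weak: "\<exists>s\<in>compact_ops (c * r). \<forall>a\<in>A. \<bar>blinfun_apply (fst a) (blinfun_apply s (snd a)) - blinfun_apply (fst a) (snd a)\<bar> < e"
    if A: "finite A" and e: "e > 0" for A :: "(('x \<Rightarrow>\<^sub>L real) \<times> 'x) set" and e
  proof -
    have e2: "e / 2 > 0" using e by simp
    obtain T :: "('x \<Rightarrow>\<^sub>L real) \<Rightarrow>\<^sub>L ('x \<Rightarrow>\<^sub>L real)" where T: "compact_operator T" "norm T \<le> C"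
      "\<And>a. a \<in> A \<Longrightarrow> \<bar>T (fst a) (snd a) - fst a (snd a)\<bar> < e / 2"
      using compact_approximation_of_dual_identity[OF C W A e2] by blast
    have "(1 / c) *\<^sub>R T \<in> compact_ops 1"
      using T(1,2) c by (simp add: compact_ops_def compact_operator_scaleR)
    moreover have "e / 2 / c > 0" using e c by simp
    ultimately obtain S where S: "S \<in> weak_star_compact_ops r"
      "\<And>a. a \<in> A \<Longrightarrow> \<bar>S (fst a) (snd a) - ((1 / c) *\<^sub>R T) (fst a) (snd a)\<bar> < e / 2 / c"
      using BWD[OF _ A] by blast
    obtain s :: "'x \<Rightarrow>\<^sub>L 'x" where s: "compact_operator s" "norm s \<le> r" "\<And>\<phi> x. blinfun_apply \<phi> (s x) = S \<phi> x"
      using weak_star_compact_op_is_adjoint[OF S(1)] by blast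
    show ?thesis
    proof (intro bexI[of _ "c *\<^sub>R s"] ballI)
      show "c *\<^sub>R s \<in> compact_ops (c * r)"
        using s(1,2) c by (simp add: compact_ops_def compact_operator_scaleR)
      fix a assume a: "a \<in> A"
      have "\<bar>fst a ((c *\<^sub>R s) (snd a)) - T (fst a) (snd a)\<bar>
          = c * \<bar>S (fst a) (snd a) - ((1 / c) *\<^sub>R T) (fst a) (snd a)\<bar>"
      proof -
        have "fst a ((c *\<^sub>R s) (snd a)) - T (fst a) (snd a) = c * (S (fst a) (snd a) - ((1 / c) *\<^sub>R T) (fst a) (snd a))"
          using c by (simp add: blinfun.scaleR_left blinfun.scaleR_right s(3) right_diff_distrib)
        then show ?thesis using c by (simp add: abs_mult)
      qed
      also have "\<dots> < c * (e / 2 / c)" using S(2)[OF a] c(1) by (rule mult_strict_left_mono)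
      also have "\<dots> = e / 2" using c by simp
      finally show "\<bar>fst a ((c *\<^sub>R s) (snd a)) - fst a (snd a)\<bar> < e" using T(3)[OF a] by linarith
    qed
  qed
  show ?thesis
    by (rule Lip_K_BAP_from_compact_ops[of "c * r"])
      (rule convex_weak_approximation_imp_strong[where g = "\<lambda>x. x", OF convex_compact_ops weak])
qed

end
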